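(* Let $T>0$, let $g_1,\dots,g_{n-1}\colon\mathbb{R}^m\to\mathbb{R}^m$ be continuous and let $h\colon[0,T]\times(\mathbb{R}^m)^n\to\mathbb{R}^m$ be an $L^1$-Carathéodory function. Let $\Omega$ be an open (possibly unbounded) subset of $X=\mathcal{C}([0,T],\mathbb{R}^{mn})$. Suppose that the following conditions hold. ($c_1$) There exists a compact set $\mathcal{K}\subseteq\Omega$ containing all the possible $T$-periodic solutions of $$(\mathscr{C}_\vartheta)\qquad x_i'=g_i(x_{i+1}),\ i=1,\dots,n-1,\qquad x_n'=\vartheta h(t,x_1,\dots,x_n),$$ for any $\vartheta\in\,]0,1]$. ($c_2$) The set $\hat g^{-1}(0)\cap\Omega$ is compact. If $$\deg_B(\hat g,\Omega\cap\mathbb{R}^{mn},0)\neq0,$$ then there exists at least a $T$-periodic solution in $\Omega$ of $$(\mathscr{C})\qquad x_i'=g_i(x_{i+1}),\ i=1,\dots,n-1,\qquad x_n'=h(t,x_1,\dots,x_n).$$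
   Context: $X=\mathcal{C}([0,T],\mathbb{R}^{mn})$ carries the sup-norm; $\mathbb{R}^{mn}$ is identified with the constant functions in $X$, so $\Omega\cap\mathbb{R}^{mn}$ is the set of $s\in\mathbb{R}^{mn}$ whose constant function lies in $\Omega$ (and $\hat g^{-1}(0)\cap\Omega$ is understood accordingly). A $T$-periodic solution of a system $x_i'=g_i(x_{i+1})$, $i=1,\dots,n-1$, $x_n'=f(t,x_1,\dots,x_n)$ (where $f=\vartheta h$ or $f=h$) is a function $x=(x_1,\dots,x_n)$ with each $x_i\colon[0,T]\to\mathbb{R}^m$ absolutely continuous, $x_i(0)=x_i(T)$, satisfying the system for a.e. $t\in[0,T]$. $h^{\#}(s):=\frac1T\int_0^Th(t,s_1,\dots,s_n)\,dt$ and $\hat g\colon\mathbb{R}^{mn}\to\mathbb{R}^{mn}$ is $\hat g(s):=(g_1(s_2),\dots,g_{n-1}(s_n),h^{\#}(s))$ for $s=(s_1,\dots,s_n)$. $\deg_B$ is the Brouwer degree, extended to open, possibly unbounded sets $U$: when the zero set in $U$ is compact, it equals the usual degree on any bounded open $V$ containing the zero set with $\overline V\subseteq U$. *)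

theory Defs
  imports "HOL-Analysis.Analysis"
begin

text \<open>
  Vectors of \<open>(\<real>\<^sup>m)\<^sup>n\<close> are elements of \<open>real ^ ('n \<times> 'm)\<close>.  The blocks are numbered
  \<open>1, \<dots>, n\<close> by an enumeration \<open>e\<close> of the index type \<open>'n\<close>, that is,
  \<open>bij_betw e {1..n} UNIV\<close>, which is a hypothesis of every result about them.
\<close>

definition block :: "(nat \<Rightarrow> 'n::finite) \<Rightarrow> real ^ ('n \<times> 'm::finite) \<Rightarrow> nat \<Rightarrow> real ^ 'm" where
  "block e s i = (\<chi> j. s $ (e i, j))"

text \<open>\<open>stack e n v\<close> is the vector with blocks \<open>(v 1, \<dots>, v n)\<close>, the inverse of \<^term>\<open>block e\<close>.\<close>

definition stack :: "(nat \<Rightarrow> 'n::finite) \<Rightarrow> nat \<Rightarrow> (nat \<Rightarrow> real ^ 'm::finite) \<Rightarrow> real ^ ('n \<times> 'm)" where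
  "stack e n v = (\<chi> p. v (inv_into {1..n} e (fst p)) $ snd p)"

lemma block_stack:
  assumes "bij_betw e {1..n} UNIV" "i \<in> {1..n}"
  shows "block e (stack e n v) i = v i"
  using assms by (simp add: block_def stack_def vec_eq_iff bij_betw_def inv_into_f_f)

lemma stack_block:
  assumes "bij_betw e {1..n} UNIV"
  shows "stack e n (block e s) = s"
  using assms by (simp add: block_def stack_def vec_eq_iff bij_betw_def f_inv_into_f)


text \<open>
  The space \<open>C([0,T], \<real>\<^sup>k)\<close> with the sup-metric.  Its elements are the continuous functions on
  \<open>{0..T}\<close>, made \<^const>\<open>undefined\<close> outside \<open>{0..T}\<close> so that equality is equality on \<open>{0..T}\<close>.
\<close>

definition C_space :: "real \<Rightarrow> (real \<Rightarrow> real ^ 'k::finite) metric" where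
  "C_space T = cfunspace (top_of_set {0..T}) euclidean_metric"

definition const_fun :: "real \<Rightarrow> 'b \<Rightarrow> real \<Rightarrow> 'b" where
  "const_fun T s = (\<lambda>t\<in>{0..T}. s)"

text \<open>The set \<open>\<Omega> \<inter> \<real>\<^sup>k\<close>, with \<open>\<real>\<^sup>k\<close> identified with the constant functions.\<close>

definition const_part :: "real \<Rightarrow> (real \<Rightarrow> 'b) set \<Rightarrow> 'b set" where
  "const_part T \<Omega> = {s. const_fun T s \<in> \<Omega>}"


definition L1_Caratheodory ::
    "real \<Rightarrow> (real \<Rightarrow> real ^ 'k::finite \<Rightarrow> real ^ 'm::finite) \<Rightarrow> bool" where
  "L1_Caratheodory T h \<longleftrightarrow>
     (\<forall>s. (\<lambda>t. h t s) \<in> borel_measurable (lebesgue_on {0..T})) \<and>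
     (AE t in lebesgue_on {0..T}. continuous_on UNIV (h t)) \<and>
     (\<forall>r>0. \<exists>\<alpha>. integrable (lebesgue_on {0..T}) \<alpha> \<and>
        (AE t in lebesgue_on {0..T}. \<forall>s. norm s \<le> r \<longrightarrow> norm (h t s) \<le> \<alpha> t))"

definition abs_continuous_on :: "real \<Rightarrow> real \<Rightarrow> (real \<Rightarrow> 'b::real_normed_vector) \<Rightarrow> bool" where
  "abs_continuous_on a b f \<longleftrightarrow>
     (\<forall>\<epsilon>>0. \<exists>\<delta>>0. \<forall>(N::nat) u v.
        (\<forall>i<N. a \<le> u i \<and> u i \<le> v i \<and> v i \<le> b) \<longrightarrow>
        (\<forall>i<N. \<forall>j<N. i \<noteq> j \<longrightarrow> {u i<..<v i} \<inter> {u j<..<v j} = {}) \<longrightarrow>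
        (\<Sum>i<N. v i - u i) < \<delta> \<longrightarrow>
        (\<Sum>i<N. norm (f (v i) - f (u i))) < \<epsilon>)"

text \<open>
  \<open>T\<close>-periodic solutions of \<open>x\<^sub>i' = g\<^sub>i(x\<^sub>i\<^sub>+\<^sub>1)\<close> for \<open>i < n\<close> and
  \<open>x\<^sub>n' = f(t, x\<^sub>1, \<dots>, x\<^sub>n)\<close>, as elements of \<^const>\<open>C_space\<close>.
\<close>

definition periodic_solution ::
    "real \<Rightarrow> nat \<Rightarrow> (nat \<Rightarrow> 'n::finite) \<Rightarrow> (nat \<Rightarrow> real ^ 'm::finite \<Rightarrow> real ^ 'm) \<Rightarrow>
     (real \<Rightarrow> real ^ ('n \<times> 'm) \<Rightarrow> real ^ 'm) \<Rightarrow> (real \<Rightarrow> real ^ ('n \<times> 'm)) \<Rightarrow> bool" where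
  "periodic_solution T n e g f x \<longleftrightarrow>
     x \<in> mspace (C_space T) \<and>
     (\<forall>i\<in>{1..n}. abs_continuous_on 0 T (\<lambda>t. block e (x t) i) \<and>
                  block e (x 0) i = block e (x T) i) \<and>
     (AE t in lebesgue_on {0..T}.
        (\<forall>i\<in>{1..<n}. ((\<lambda>\<tau>. block e (x \<tau>) i) has_vector_derivative
                        g i (block e (x t) (i + 1))) (at t within {0..T})) \<and>
        ((\<lambda>\<tau>. block e (x \<tau>) n) has_vector_derivative f t (x t)) (at t within {0..T}))"

definition mean_value :: "real \<Rightarrow> (real \<Rightarrow> 'a \<Rightarrow> real ^ 'm::finite) \<Rightarrow> 'a \<Rightarrow> real ^ 'm" where
  "mean_value T h s = (1 / T) *\<^sub>R integral\<^sup>L (lebesgue_on {0..T}) (\<lambda>t. h t s)"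

definition g_hat ::
    "real \<Rightarrow> nat \<Rightarrow> (nat \<Rightarrow> 'n::finite) \<Rightarrow> (nat \<Rightarrow> real ^ 'm::finite \<Rightarrow> real ^ 'm) \<Rightarrow>
     (real \<Rightarrow> real ^ ('n \<times> 'm) \<Rightarrow> real ^ 'm) \<Rightarrow> real ^ ('n \<times> 'm) \<Rightarrow> real ^ ('n \<times> 'm)" where
  "g_hat T n e g h s =
     stack e n (\<lambda>i. if i < n then g i (block e s (i + 1)) else mean_value T h s)"


definition C1_on :: "(real ^ 'k::finite) set \<Rightarrow> (real ^ 'k \<Rightarrow> real ^ 'k) \<Rightarrow> bool" where
  "C1_on V g \<longleftrightarrow> (\<forall>x\<in>V. g differentiable (at x)) \<and> continuous_on V (\<lambda>x. jacobian g (at x))"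

text \<open>
  The Brouwer degree for bounded open \<open>V\<close>, \<open>f\<close> continuous on \<^term>\<open>closure V\<close> and
  \<open>y \<notin> f ` frontier V\<close> (there is no convention outside this range).  It is the sum of the signs of
  the Jacobian determinants over \<open>g -` {y} \<inter> V\<close>, for any \<open>g\<close> that is \<open>C\<^sup>1\<close> on \<open>V\<close> and continuous on
  its closure, has \<open>y\<close> as a regular value, and is closer to \<open>f\<close> on \<^term>\<open>closure V\<close> than the distance
  of \<open>y\<close> to \<open>f ` frontier V\<close>; the value does not depend on the choice of \<open>g\<close>.
\<close>

definition brouwer_degree ::
    "(real ^ 'k::finite \<Rightarrow> real ^ 'k) \<Rightarrow> (real ^ 'k) set \<Rightarrow> real ^ 'k \<Rightarrow> int" where
  "brouwer_degree f V y = (THE d. \<exists>g.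
     C1_on V g \<and> continuous_on (closure V) g \<and>
     (\<forall>x\<in>closure V. dist (f x) (g x) < infdist y (f ` frontier V)) \<and>
     (\<forall>x\<in>V. g x = y \<longrightarrow> det (jacobian g (at x)) \<noteq> 0) \<and>
     real_of_int d = (\<Sum>x | x \<in> V \<and> g x = y. sgn (det (jacobian g (at x)))))"

text \<open>
  Extension to open, possibly unbounded \<open>U\<close>, for \<open>f\<close> continuous on \<open>U\<close> with \<open>f -` {y} \<inter> U\<close>
  compact; by excision the value does not depend on the choice of \<open>V\<close>.
\<close>

definition brouwer_degree_ext ::
    "(real ^ 'k::finite \<Rightarrow> real ^ 'k) \<Rightarrow> (real ^ 'k) set \<Rightarrow> real ^ 'k \<Rightarrow> int" where
  "brouwer_degree_ext f U y = (THE d. \<exists>V.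
     open V \<and> bounded V \<and> f -` {y} \<inter> U \<subseteq> V \<and> closure V \<subseteq> U \<and> d = brouwer_degree f V y)"

end

theory Submission
  imports Defs "HOL-Complex_Analysis.Great_Picard" "HOL-Computational_Algebra.Polynomial"
begin

text \<open>
  Suppose that \<open>(C)\<close> has no \<open>T\<close>-periodic solution in \<open>\<Omega>\<close>.  Instead of the Leray-Schauder degree,
  a shooting argument keeps the dimension \<open>m * n\<close> throughout.  Write the system as \<open>x' = D\<^sub>p N(t, x)\<close>,
  where the diagonal matrix \<open>D\<^sub>p\<close> multiplies the first \<open>n - 1\<close> blocks by \<open>a\<close> and the last one by \<open>\<theta>\<close>, and
  \<open>(a, \<theta>)\<close> runs from \<open>(0, 0)\<close> through \<open>(1, 0)\<close> to \<open>(1, 1)\<close>.  Tonelli's delayed equation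
  \<open>z(t) = s + D\<^sub>p \<integral>\<^sub>0\<^sup>t\<^sup>-\<^sup>\<delta> N(\<tau>, z(\<tau>)) d\<tau>\<close> has a unique solution, which depends continuously on \<open>(p, s)\<close>, and
  the mean value of \<open>N(t, z(t))\<close> is a homotopy from \<open>g_hat\<close> to a map without zeros: as \<open>\<delta> \<rightarrow> 0\<close>, its
  zeros approach periodic solutions of \<open>(C\<^sub>\<theta>)\<close>, or, if \<open>\<theta> = 0\<close>, constant zeros of \<open>g_hat\<close>.

  The homotopy invariance of sums of signs of Jacobian determinants rests on the fact that
  \<open>\<integral> det F' = 0\<close> for every \<open>C\<^sup>1\<close> map \<open>F\<close> with compact support, which is proved as in Milnor's and
  Rogers' proofs of the Brouwer fixed point theorem.  It is applied to maps that are composed with a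
  coordinatewise truncation, so that only neighbourhoods of the zeros contribute to the integral.
\<close>


text \<open>As \<open>h\<close> is merely continuous in the state, initial value problems need not
  be uniquely solvable, so the system itself has no shooting map; the delay makes the solution
  explicit, interval by interval. The map is the mean of \<open>N\<close> rather than the
  displacement \<open>z(T) - z(0)\<close>, because \<open>D_p\<close> is singular while
  \<open>a\<close> or \<open>\<theta>\<close> vanishes: the displacement would lose the last block,
  whereas the mean keeps the average of \<open>h\<close> even for \<open>\<theta> = 0\<close>. The
  order of the two parameters matters. While \<open>\<theta> = 0\<close> the last block is frozen,
  and a zero in the limit forces \<open>g_i(x_{i+1}) = 0\<close> for one block after the other,
  starting from the end, so that only constants survive. Once \<open>a = 1\<close>, the hypothesis
  on the systems with \<open>\<theta> > 0\<close> takes over. Since \<open>\<Omega>\<close> is a set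
  of functions and not of starting points, the domain of the homotopy consists of the pairs
  \<open>(p, s)\<close> whose whole path is close to a compact subset of \<open>\<Omega>\<close>.
  Its slices change with \<open>p\<close>, hence homotopy invariance is proved for varying
  domains.\<close>

section \<open>Continuously differentiable maps\<close>

text \<open>The derivative is an explicit argument, so that determinants of composed and glued maps
  can be computed. Continuity is asked direction by direction, which in finite dimension is
  continuity in the operator norm and is easier to check.\<close>

definition C1_der ::
    "'a::euclidean_space set \<Rightarrow> ('a \<Rightarrow> 'b::euclidean_space) \<Rightarrow> ('a \<Rightarrow> 'a \<Rightarrow> 'b) \<Rightarrow> bool" where
  "C1_der W F F' \<longleftrightarrow>
     (\<forall>x\<in>W. (F has_derivative F' x) (at x)) \<and> (\<forall>v. continuous_on W (\<lambda>x. F' x v))"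

lemma C1_derD:
  assumes "C1_der W F F'" "x \<in> W"
  shows "(F has_derivative F' x) (at x)" "linear (F' x)"
  using assms by (auto simp: C1_der_def dest: has_derivative_linear)

lemma C1_der_imp_continuous_on: "C1_der W F F' \<Longrightarrow> continuous_on W F"
  by (meson C1_derD(1) continuous_at_imp_continuous_on has_derivative_continuous)

lemma C1_der_subset: "C1_der W F F' \<Longrightarrow> V \<subseteq> W \<Longrightarrow> C1_der V F F'"
  by (meson C1_der_def continuous_on_subset subset_eq)

lemma C1_der_const: "C1_der W (\<lambda>x. c) (\<lambda>x v. 0)"
  by (simp add: C1_der_def)

lemma C1_der_bounded_linear: "bounded_linear f \<Longrightarrow> C1_der W f (\<lambda>x. f)"
  by (simp add: C1_der_def bounded_linear_imp_has_derivative)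

lemma C1_der_add:
  assumes "C1_der W F F'" "C1_der W G G'"
  shows "C1_der W (\<lambda>x. F x + G x) (\<lambda>x v. F' x v + G' x v)"
  using assms by (auto simp: C1_der_def intro!: has_derivative_add continuous_intros)

lemma C1_der_diff:
  assumes "C1_der W F F'" "C1_der W G G'"
  shows "C1_der W (\<lambda>x. F x - G x) (\<lambda>x v. F' x v - G' x v)"
  using assms by (auto simp: C1_der_def intro!: has_derivative_diff continuous_intros)

lemma C1_der_scaleR:
  assumes c: "C1_der W c c'" and F: "C1_der W F F'"
  shows "C1_der W (\<lambda>x. c x *\<^sub>R F x) (\<lambda>x v. c x *\<^sub>R F' x v + c' x v *\<^sub>R F x)"
  unfolding C1_der_def
proof (intro conjI ballI allI)
  show "((\<lambda>x. c x *\<^sub>R F x) has_derivative (\<lambda>v. c x *\<^sub>R F' x v + c' x v *\<^sub>R F x)) (at x)"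
    if "x \<in> W" for x
    using C1_derD(1)[OF c that] C1_derD(1)[OF F that] by (rule has_derivative_scaleR)
  show "continuous_on W (\<lambda>x. c x *\<^sub>R F' x v + c' x v *\<^sub>R F x)" for v
    using c F C1_der_imp_continuous_on[OF c] C1_der_imp_continuous_on[OF F]
    by (auto simp: C1_der_def intro!: continuous_intros)
qed

lemma C1_der_compose_real:
  fixes u :: "'a::euclidean_space \<Rightarrow> real"
  assumes u: "C1_der W u u'" and s: "\<And>r. (s has_real_derivative s' r) (at r)"
    and s': "continuous_on UNIV s'"
  shows "C1_der W (\<lambda>x. s (u x)) (\<lambda>x v. s' (u x) * u' x v)"
  unfolding C1_der_def
proof (intro conjI ballI allI)
  show "((\<lambda>x. s (u x)) has_derivative (\<lambda>v. s' (u x) * u' x v)) (at x)" if "x \<in> W" for x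
    using has_derivative_compose[OF C1_derD(1)[OF u that] s[of "u x", unfolded has_field_derivative_def]]
    by simp
  show "continuous_on W (\<lambda>x. s' (u x) * u' x v)" for v
    using u C1_der_imp_continuous_on[OF u]
    by (auto simp: C1_der_def intro!: continuous_intros continuous_on_compose2[OF s'])
qed

lemma C1_der_component:
  fixes F :: "'a::euclidean_space \<Rightarrow> real ^ 'n"
  assumes "C1_der W F F'"
  shows "C1_der W (\<lambda>x. F x $ i) (\<lambda>x v. F' x v $ i)"
  using assms by (auto simp: C1_der_def intro!: continuous_intros
      bounded_linear.has_derivative[OF bounded_linear_vec_nth])

lemma C1_der_vec:
  fixes F :: "'a::euclidean_space \<Rightarrow> real ^ 'n"
  assumes "\<And>i. C1_der W (\<lambda>x. F x $ i) (\<lambda>x v. F' x v $ i)"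
  shows "C1_der W F F'"
  unfolding C1_der_def
proof (intro conjI ballI allI)
  fix x assume x: "x \<in> W"
  show "(F has_derivative F' x) (at x)"
    apply (subst has_derivative_componentwise_within)
    using C1_derD(1)[OF assms x]
    by (auto simp: Basis_vec_def inner_axis)
next
  show "continuous_on W (\<lambda>x. F' x v)" for v
    using assms by (subst continuous_on_componentwise) (auto simp: C1_der_def Basis_vec_def inner_axis)
qed

text \<open>\<open>W\<close> and the complement of \<open>K\<close> are open and cover the space; on
  their overlap \<open>F\<close> and hence its derivative vanish, so \<open>F\<close> and 0 glue to
  a \<open>C\<^sup>1\<close> map.\<close>

lemma C1_der_extend_zero:
  assumes F: "C1_der W F F'" and W: "open W" and K: "closed K" "K \<subseteq> W"
    and z: "\<And>x. x \<in> W - K \<Longrightarrow> F x = 0"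
  shows "C1_der UNIV (\<lambda>x. if x \<in> W then F x else 0) (\<lambda>x v. if x \<in> W then F' x v else 0)"
  unfolding C1_der_def
proof (intro conjI ballI allI)
  fix x
  show "((\<lambda>x. if x \<in> W then F x else 0) has_derivative (\<lambda>v. if x \<in> W then F' x v else 0)) (at x)"
  proof (cases "x \<in> W")
    case True
    then show ?thesis
      using has_derivative_transform_within_open[OF C1_derD(1)[OF F True] W True,
          of "\<lambda>x. if x \<in> W then F x else 0"] by simp
  next
    case False
    have "((\<lambda>x. 0) has_derivative (\<lambda>v. 0)) (at x)" by simp
    then have "((\<lambda>x. if x \<in> W then F x else 0) has_derivative (\<lambda>v. 0)) (at x)"
      by (rule has_derivative_transform_within_open[where s = "- K"]) (use False K z in auto)
    then show ?thesis using False by simp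
  qed
next
  fix v
  have z': "F' x v = 0" if x: "x \<in> W - K" for x
  proof -
    have "((\<lambda>x. 0) has_derivative F' x) (at x)"
      using W K z x
      by (intro has_derivative_transform_within_open[OF C1_derD(1)[OF F], of _ "W - K"]) auto
    then have "F' x = (\<lambda>v. 0)"
      by (rule has_derivative_unique) simp
    then show ?thesis by simp
  qed
  have "continuous_on (W \<union> - K) (\<lambda>x. if x \<in> W then F' x v else 0)"
  proof (intro continuous_on_open_Un W)
    show "continuous_on W (\<lambda>x. if x \<in> W then F' x v else 0)"
      using F by (subst continuous_on_cong[OF refl, where g = "\<lambda>x. F' x v"]) (auto simp: C1_der_def)
    show "continuous_on (- K) (\<lambda>x. if x \<in> W then F' x v else 0)"
      using z' by (subst continuous_on_cong[OF refl, where g = "\<lambda>x. 0"]) auto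
  qed (use K in auto)
  moreover have "W \<union> - K = UNIV" using K by auto
  ultimately show "continuous_on UNIV (\<lambda>x. if x \<in> W then F' x v else 0)" by simp
qed

lemma real_polynomial_function_C1_der:
  "real_polynomial_function p \<Longrightarrow> \<exists>p'. C1_der UNIV p p'"
proof (induction rule: real_polynomial_function.induct)
  case (linear f)
  then show ?case using C1_der_bounded_linear by blast
next
  case (const c)
  then show ?case using C1_der_const by blast
next
  case (add f g)
  then show ?case using C1_der_add by blast
next
  case (mult f g)
  then show ?case using C1_der_scaleR[where 'b = real] by fastforce
qed

lemma polynomial_function_C1_der:
  fixes p :: "'a::euclidean_space \<Rightarrow> real ^ 'n"
  assumes "polynomial_function p"
  obtains p' where "C1_der UNIV p p'"
proof -
  have "\<exists>p'. C1_der UNIV (\<lambda>x. p x $ i) p'" for i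
  proof -
    have "real_polynomial_function ((\<lambda>v. v $ i) \<circ> p)"
      using assms bounded_linear_vec_nth unfolding polynomial_function_def by blast
    then show ?thesis using real_polynomial_function_C1_der by (simp add: o_def)
  qed
  then obtain q where q: "\<And>i. C1_der UNIV (\<lambda>x. p x $ i) (q i)" by metis
  have "C1_der UNIV p (\<lambda>x v. \<chi> i. q i x v)"
    using q by (intro C1_der_vec) simp
  then show thesis by (rule that)
qed

lemma C1_der_continuous_det:
  fixes F :: "real ^ 'n \<Rightarrow> real ^ 'n"
  assumes "C1_der W F F'"
  shows "continuous_on W (\<lambda>x. det (matrix (F' x)))"
proof -
  have "continuous_on W (\<lambda>x. F' x (axis j 1) $ i)" for i j
    using assms by (auto simp: C1_der_def intro!: continuous_intros)
  then show ?thesis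
    by (simp add: det_def matrix_def)
       (intro continuous_on_sum continuous_on_mult_left continuous_on_prod; simp)
qed

text \<open>Directional continuity bounds \<open>F' x\<close> on each of the finitely many basis
  vectors; linearity combines these into one operator bound over \<open>K\<close>.\<close>

lemma C1_der_bound_compact:
  fixes F :: "'a::euclidean_space \<Rightarrow> 'b::euclidean_space"
  assumes F: "C1_der W F F'" and K: "compact K" "K \<subseteq> W"
  obtains M where "M > 0" "\<And>x v. x \<in> K \<Longrightarrow> norm (F' x v) \<le> M * norm v"
proof -
  have "\<exists>B. \<forall>x\<in>K. norm (F' x b) \<le> B" for b
  proof -
    have "compact ((\<lambda>x. F' x b) ` K)"
      using F K by (auto simp: C1_der_def intro!: compact_continuous_image elim: continuous_on_subset)
    then show ?thesis by (auto dest!: compact_imp_bounded simp: bounded_iff)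
  qed
  then obtain B where B: "\<And>x b. x \<in> K \<Longrightarrow> norm (F' x b) \<le> B b" by metis
  define M where "M = 1 + (\<Sum>b\<in>Basis. \<bar>B b\<bar>)"
  show thesis
  proof
    show "M > 0" by (simp add: M_def add_pos_nonneg sum_nonneg)
    fix x v assume x: "x \<in> K"
    interpret linear "F' x" using C1_derD(2)[OF F] K x by auto
    have "F' x v = F' x (\<Sum>b\<in>Basis. (v \<bullet> b) *\<^sub>R b)" by (simp add: euclidean_representation)
    also have "\<dots> = (\<Sum>b\<in>Basis. (v \<bullet> b) *\<^sub>R F' x b)" by (simp add: sum scaleR)
    finally have "norm (F' x v) \<le> (\<Sum>b\<in>Basis. norm ((v \<bullet> b) *\<^sub>R F' x b))"
      by (simp only: norm_sum)
    also have "\<dots> \<le> (\<Sum>b\<in>Basis. norm v * \<bar>B b\<bar>)"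
    proof (rule sum_mono)
      fix b :: 'a assume "b \<in> Basis"
      then have "\<bar>v \<bullet> b\<bar> \<le> norm v" by (rule Basis_le_norm)
      moreover have "norm (F' x b) \<le> \<bar>B b\<bar>" using B[OF x, of b] by linarith
      ultimately show "norm ((v \<bullet> b) *\<^sub>R F' x b) \<le> norm v * \<bar>B b\<bar>"
        by (simp add: mult_mono)
    qed
    also have "\<dots> \<le> M * norm v"
      by (simp add: M_def algebra_simps flip: sum_distrib_left)
    finally show "norm (F' x v) \<le> M * norm v" .
  qed
qed

section \<open>Truncation in one real variable\<close>

definition tent :: "real \<Rightarrow> real \<Rightarrow> real" where
  "tent \<epsilon> u = max 0 (u + \<epsilon>) - 2 * max 0 u + max 0 (u - \<epsilon>)"

text \<open>Half the second difference of the squared positive part, hence a primitive of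
  \<open>tent\<close>, the hat of height \<open>\<epsilon>\<close> on
  \<open>[-\<epsilon>, \<epsilon>]\<close>. It is a \<open>C\<^sup>1\<close> step, equal to 0 up to
  \<open>-\<epsilon>\<close> and to \<open>\<epsilon>^2\<close> from \<open>\<epsilon>\<close> on,
  so its derivative vanishes outside the window.\<close>

definition clamp1 :: "real \<Rightarrow> real \<Rightarrow> real" where
  "clamp1 \<epsilon> u = ((max 0 (u + \<epsilon>))\<^sup>2 - 2 * (max 0 u)\<^sup>2 + (max 0 (u - \<epsilon>))\<^sup>2) / 2"

lemma has_real_derivative_max0_square:
  "((\<lambda>u. (max 0 u)\<^sup>2) has_real_derivative 2 * max 0 u) (at u)"
proof -
  consider "u > 0" | "u < 0" | "u = 0" by linarith
  then show ?thesis
  proof cases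
    case 1
    have "((\<lambda>u. u\<^sup>2) has_real_derivative 2 * max 0 u) (at u)"
      using 1 by (auto intro!: derivative_eq_intros)
    then show ?thesis
      by (rule has_field_derivative_transform_within_open[where S = "{0<..}"]) (use 1 in auto)
  next
    case 2
    have "((\<lambda>u. 0) has_real_derivative 2 * max 0 u) (at u)"
      using 2 by (auto intro!: derivative_eq_intros)
    then show ?thesis
      by (rule has_field_derivative_transform_within_open[where S = "{..<0}"]) (use 2 in auto)
  next
    case 3
    have "((\<lambda>h::real. (max 0 h)\<^sup>2 / h) \<longlongrightarrow> 0) (at 0)"
    proof (rule Lim_null_comparison)
      show "\<forall>\<^sub>F h::real in at 0. norm ((max 0 h)\<^sup>2 / h) \<le> \<bar>h\<bar>"
        by (intro always_eventually allI) (auto simp: max_def power2_eq_square)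
      show "((\<lambda>h::real. \<bar>h\<bar>) \<longlongrightarrow> 0) (at 0)" by (auto intro!: tendsto_eq_intros)
    qed
    then show ?thesis using 3 by (simp add: DERIV_def)
  qed
qed

lemma has_real_derivative_clamp1: "(clamp1 \<epsilon> has_real_derivative tent \<epsilon> u) (at u)"
proof -
  have shift: "((\<lambda>u. (max 0 (u + a))\<^sup>2) has_real_derivative 2 * max 0 (u + a)) (at u)" for a
    using DERIV_shift[of "\<lambda>u. (max 0 u)\<^sup>2" "2 * max 0 (u + a)" u a]
      has_real_derivative_max0_square[of "u + a"] by simp
  have "((\<lambda>u. ((max 0 (u + \<epsilon>))\<^sup>2 - 2 * (max 0 (u + 0))\<^sup>2 + (max 0 (u + - \<epsilon>))\<^sup>2) / 2)
      has_real_derivative (2 * max 0 (u + \<epsilon>) - 2 * (2 * max 0 (u + 0)) + 2 * max 0 (u + - \<epsilon>)) / 2) (at u)"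
    by (intro DERIV_add DERIV_diff DERIV_cmult DERIV_cdivide shift)
  moreover have "(2 * max 0 (u + \<epsilon>) - 2 * (2 * max 0 (u + 0)) + 2 * max 0 (u + - \<epsilon>)) / 2 = tent \<epsilon> u"
    by (simp add: tent_def)
  ultimately show ?thesis by (simp add: clamp1_def[abs_def])
qed

lemma continuous_on_tent: "continuous_on UNIV (tent \<epsilon>)"
  unfolding tent_def[abs_def] by (intro continuous_intros)

lemma tent_nonneg: "\<epsilon> \<ge> 0 \<Longrightarrow> tent \<epsilon> u \<ge> 0"
  by (auto simp: tent_def max_def)

lemma tent_eq_0: "\<epsilon> > 0 \<Longrightarrow> \<bar>u\<bar> \<ge> \<epsilon> \<Longrightarrow> tent \<epsilon> u = 0"
  by (auto simp: tent_def max_def)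

lemma tent_0: "\<epsilon> > 0 \<Longrightarrow> tent \<epsilon> 0 = \<epsilon>"
  by (auto simp: tent_def max_def)

lemma clamp1_mono: "\<epsilon> \<ge> 0 \<Longrightarrow> u \<le> v \<Longrightarrow> clamp1 \<epsilon> u \<le> clamp1 \<epsilon> v"
  by (rule DERIV_nonneg_imp_nondecreasing)
     (auto intro!: exI[of _ "tent \<epsilon> _"] has_real_derivative_clamp1 tent_nonneg)

text \<open>\<open>clamp1 (1/4)\<close> rises to \<open>1/16\<close>, which the factor 16
  normalises; the shift moves the rise to \<open>[1/4, 3/4]\<close> and leaves room for an
  approximation error at both ends.\<close>

definition step1 :: "real \<Rightarrow> real" where
  "step1 u = 16 * clamp1 (1/4) (u - 1/2)"

lemma has_real_derivative_step1: "(step1 has_real_derivative 16 * tent (1/4) (u - 1/2)) (at u)"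
proof -
  have "((\<lambda>u. clamp1 (1/4) (u + - (1/2))) has_real_derivative tent (1/4) (u + - (1/2))) (at u)"
    using DERIV_shift[of "clamp1 (1/4)" _ u "- (1/2)"] has_real_derivative_clamp1[of "1/4" "u + - (1/2)"]
    by simp
  from DERIV_cmult[OF this, of 16] show ?thesis by (simp add: step1_def[abs_def])
qed

lemma step1_eq_0: "u \<le> 1/4 \<Longrightarrow> step1 u = 0"
  by (auto simp: step1_def clamp1_def max_def)

lemma step1_eq_1: "u \<ge> 3/4 \<Longrightarrow> step1 u = 1"
  by (auto simp: step1_def clamp1_def max_def power2_eq_square algebra_simps)

lemma step1_range: "0 \<le> step1 u" "step1 u \<le> 1"
proof -
  have mono: "step1 u \<le> step1 v" if "u \<le> v" for u v
    using clamp1_mono[of "1/4" "u - 1/2" "v - 1/2"] that by (simp add: step1_def)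
  show "0 \<le> step1 u" using mono[of "min u 0" u] step1_eq_0[of "min u 0"] by (simp add: min_def split: if_splits)
  show "step1 u \<le> 1" using mono[of u "max u 1"] step1_eq_1[of "max u 1"] by (simp add: max_def split: if_splits)
qed

section \<open>The integral of a Jacobian determinant with compact support\<close>

text \<open>The characteristic polynomial of \<open>- A\<close>. As a Leibniz sum it shows its
  degree bound and the continuity of each coefficient in the entries of \<open>A\<close> term by
  term.\<close>

definition det_poly :: "real ^ 'n ^ 'n::finite \<Rightarrow> real poly" where
  "det_poly A = (\<Sum>p | p permutes (UNIV :: 'n set).
     smult (of_int (sign p)) (\<Prod>i\<in>UNIV. if p i = i then [:A $ i $ p i, 1:] else [:A $ i $ p i:]))"

lemma poly_det_poly: "poly (det_poly A) c = det (mat c + A)"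
proof -
  have "poly (if p i = i then [:A $ i $ p i, 1:] else [:A $ i $ p i:]) c = (mat c + A) $ i $ p i"
    for p :: "'a \<Rightarrow> 'a" and i
    by (auto simp: mat_def)
  then show ?thesis
    by (simp add: det_poly_def det_def poly_sum poly_prod)
qed

lemma degree_det_poly: "degree (det_poly (A :: real ^ 'n ^ 'n::finite)) \<le> CARD('n)"
  unfolding det_poly_def
proof (intro degree_sum_le)
  fix p :: "'n \<Rightarrow> 'n"
  have "degree (\<Prod>i\<in>UNIV. if p i = i then [:A $ i $ p i, 1:] else [:A $ i $ p i:])
      \<le> (\<Sum>i\<in>UNIV. degree (if p i = i then [:A $ i $ p i, 1:] else [:A $ i $ p i:]))"
    using degree_prod_sum_le[of UNIV "\<lambda>i. if p i = i then [:A $ i $ p i, 1:] else [:A $ i $ p i:]"]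
    by (simp add: o_def)
  also have "\<dots> \<le> (\<Sum>i\<in>(UNIV :: 'n set). 1)"
    by (intro sum_mono) auto
  finally show "degree (smult (of_int (sign p))
      (\<Prod>i\<in>UNIV. if p i = i then [:A $ i $ p i, 1:] else [:A $ i $ p i:])) \<le> CARD('n)"
    using degree_smult_le order_trans by fastforce
qed simp

lemma continuous_on_coeff_prod:
  fixes P :: "'i \<Rightarrow> 'a::topological_space \<Rightarrow> real poly"
  assumes "\<And>i k. i \<in> I \<Longrightarrow> continuous_on S (\<lambda>x. coeff (P i x) k)"
  shows "continuous_on S (\<lambda>x. coeff (\<Prod>i\<in>I. P i x) k)"
  using assms
proof (induction I arbitrary: k rule: infinite_finite_induct)
  case (insert i I)
  then show ?case
    by (auto simp: coeff_mult intro!: continuous_intros)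
qed auto

lemma continuous_on_coeff_det_poly:
  fixes A :: "'a::topological_space \<Rightarrow> real ^ 'n ^ 'n::finite"
  assumes "\<And>i j. continuous_on S (\<lambda>x. A x $ i $ j)"
  shows "continuous_on S (\<lambda>x. coeff (det_poly (A x)) k)"
proof -
  have "continuous_on S (\<lambda>x. coeff (if p i = i then [:A x $ i $ p i, 1:] else [:A x $ i $ p i:]) k)"
    for p :: "'n \<Rightarrow> 'n" and i k
    using assms by (cases "p i = i"; cases k; simp add: coeff_pCons split: nat.splits)
  then show ?thesis
    by (simp add: det_poly_def coeff_sum)
       (intro continuous_on_sum continuous_on_mult_left continuous_on_coeff_prod; simp)
qed

lemma matrix_add_scaleR:
  fixes f :: "real ^ 'n \<Rightarrow> real ^ 'n::finite"
  shows "matrix (\<lambda>v. c *\<^sub>R v + f v) = mat c + matrix f"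
  by (auto simp: matrix_def mat_def axis_def vec_eq_iff)

lemma det_matrix_zero: "det (matrix (\<lambda>v :: real ^ 'n::finite. 0 :: real ^ 'n)) = 0"
proof -
  have "matrix (\<lambda>v :: real ^ 'n. 0 :: real ^ 'n) = mat 0"
    by (simp add: matrix_def mat_def vec_eq_iff)
  then show ?thesis using det_0 by metis
qed

text \<open>
  For large \<open>c\<close> the map \<open>c I + F\<close> is a diffeomorphism carrying a ball onto a ball, so the integral
  of \<open>det (c I + F')\<close> is \<open>C * c ^ N\<close> for large \<open>c\<close>; it is a polynomial in \<open>c\<close>, so it vanishes
  at \<open>c = 0\<close>.
\<close>

lemma has_integral_det_compact_support:
  fixes F :: "real ^ 'n::{finite,wellorder} \<Rightarrow> real ^ 'n::_"
  assumes F: "C1_der UNIV F F'" and supp: "\<And>x. norm x \<ge> R \<Longrightarrow> F x = 0" and R: "R > 0"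
  shows "((\<lambda>x. det (matrix (F' x))) has_integral 0) UNIV"
proof -
  have lin: "linear (F' x)" and der: "(F has_derivative F' x) (at x)" for x
    using C1_derD[OF F] by auto
  have F'0: "F' x = (\<lambda>v. 0)" if x: "norm x > R" for x
  proof -
    have "((\<lambda>x. 0) has_derivative F' x) (at x)"
    proof (rule has_derivative_transform_within_open[OF der])
      show "open (- cball 0 R)" by auto
    qed (use x supp in auto)
    then show ?thesis by (rule has_derivative_unique) simp
  qed
  obtain M where M: "M > 0" "\<And>x v. x \<in> cball 0 R \<Longrightarrow> norm (F' x v) \<le> M * norm v"
    using C1_der_bound_compact[OF F compact_cball, of 0 R] by auto
  have bound: "norm (F' x v) \<le> M * norm v" for x v
    using M F'0[of x] by (cases "norm x > R") auto
  have lip: "norm (F x - F y) \<le> M * norm (x - y)" for x y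
  proof (rule differentiable_bound[where S = UNIV and f' = F'])
    show "onorm (F' x) \<le> M" for x
      using bound M by (intro onorm_le) auto
  qed (use der in auto)
  define f where "f c x = c *\<^sub>R x + F x" for c x
  have f_der: "(f c has_derivative (\<lambda>v. c *\<^sub>R v + F' x v)) (at x within S)" for c x S
    unfolding f_def by (intro derivative_intros has_derivative_at_withinI[OF der])
  have f_inj: "inj (f c)" if c: "c > M" for c
  proof (rule injI)
    fix x y assume "f c x = f c y"
    then have "c *\<^sub>R (x - y) = F y - F x" by (simp add: f_def algebra_simps)
    then have "c * norm (x - y) \<le> M * norm (x - y)"
      using lip[of y x] M(1) c by (metis abs_of_pos norm_minus_commute norm_scaleR order_less_trans)
    then have "(c - M) * norm (x - y) \<le> 0" by (simp add: algebra_simps)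
    then show "x = y" using c by (simp add: mult_le_0_iff)
  qed
  have f_surj: "\<exists>x. f c x = y" if c: "c > M" for c y
  proof -
    \<comment> \<open>\<open>c x + F x = y\<close> is a fixed point equation for a map with
      contraction factor \<open>M / c < 1\<close>.\<close>
    have "\<exists>!x\<in>UNIV. (y - F x) /\<^sub>R c = x"
    proof (rule Banach_fix)
      show "0 \<le> M / c" "M / c < 1" using M(1) c by auto
      show "dist ((y - F x) /\<^sub>R c) ((y - F z) /\<^sub>R c) \<le> M / c * dist x z" for x z
      proof -
        have "dist ((y - F x) /\<^sub>R c) ((y - F z) /\<^sub>R c) = norm ((F z - F x) /\<^sub>R c)"
          by (simp add: dist_norm flip: scaleR_diff_right)
        also have "\<dots> = norm (F z - F x) / c" using M(1) c by (simp add: divide_inverse)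
        also have "\<dots> \<le> M * norm (z - x) / c"
          using lip M(1) c by (intro divide_right_mono) auto
        finally show ?thesis by (simp add: dist_norm norm_minus_commute)
      qed
    qed auto
    then obtain x where x: "(y - F x) /\<^sub>R c = x" by auto
    have "f c x = c *\<^sub>R ((y - F x) /\<^sub>R c) + F x" by (simp only: x f_def)
    also have "\<dots> = y" using M(1) c by simp
    finally show ?thesis by blast
  qed
  \<comment> \<open>Outside \<open>cball 0 R\<close> the map \<open>f c\<close> is multiplication by
    \<open>c\<close> and already fills the complement of \<open>cball 0 (c * R)\<close>; bijectivity
    leaves exactly that ball as the image of \<open>cball 0 R\<close>.\<close>
  have f_image: "f c ` cball 0 R = cball 0 (c * R)" if c: "c > M" for c
  proof (intro equalityI subsetI)
    have c0: "c > 0" using c M(1) by simp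
    have out: "f c x = c *\<^sub>R x" if "norm x > R" for x using that supp by (simp add: f_def)
    {
      fix y
      assume "y \<in> f c ` cball 0 R"
      then obtain x where x: "norm x \<le> R" "y = f c x" by auto
      show "y \<in> cball 0 (c * R)"
      proof (rule ccontr)
        assume "y \<notin> cball 0 (c * R)"
        then have n: "norm (y /\<^sub>R c) > R" using c0 by (simp add: field_simps)
        have "f c (y /\<^sub>R c) = f c x" using out[OF n] x c0 by simp
        then have "y /\<^sub>R c = x" using f_inj[OF c] by (simp add: inj_def)
        then show False using n x by simp
      qed
    }
    {
      fix y :: "real ^ 'n::_"
      assume y: "y \<in> cball 0 (c * R)"
      obtain x where x: "f c x = y" using f_surj[OF c] by blast
      have "norm x \<le> R"
      proof (rule ccontr)
        assume n: "\<not> norm x \<le> R"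
        then have "y = c *\<^sub>R x" using x out[of x] by simp
        then show False using y n c0 by simp
      qed
      then show "y \<in> f c ` cball 0 R" using x by auto
    }
  qed
  have detpos: "det (mat c + matrix (F' x)) > 0" if c: "c > M" for c x
  proof -
    have c0: "c > 0" using c M(1) by simp
    \<comment> \<open>The path from \<open>c I\<close> to \<open>c I + F'\<close> stays invertible,
      since the perturbation has norm at most \<open>M < c\<close>; hence the determinant keeps the
      positive sign of \<open>det (mat c)\<close>.\<close>
    define D where "D s = det (mat c + s *\<^sub>R matrix (F' x))" for s :: real
    have D0: "D s \<noteq> 0" if s: "s \<in> {0..1}" for s
    proof -
      have eq: "mat c + s *\<^sub>R matrix (F' x) = matrix (\<lambda>v. c *\<^sub>R v + s *\<^sub>R F' x v)"
        by (auto simp: matrix_def mat_def axis_def vec_eq_iff)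
      have l: "linear (\<lambda>v. c *\<^sub>R v + s *\<^sub>R F' x v)"
        using lin by (intro linear_compose_add linear_compose_scale_right linear_ident)
      have "v = 0" if v: "c *\<^sub>R v + s *\<^sub>R F' x v = 0" for v
      proof -
        have "c * norm v = norm (s *\<^sub>R F' x v)"
          using v c0 by (metis abs_of_pos add_eq_0_iff norm_minus_cancel norm_scaleR)
        also have "\<dots> \<le> M * norm v"
          using s bound[of x v] mult_mono[of "\<bar>s\<bar>" 1 "norm (F' x v)" "M * norm v"] by simp
        finally have "(c - M) * norm v \<le> 0" by (simp add: algebra_simps)
        then show "v = 0" using c by (simp add: mult_le_0_iff)
      qed
      then have "inj (\<lambda>v. c *\<^sub>R v + s *\<^sub>R F' x v)"
        using linear_injective_0[OF l] by blast
      then show ?thesis unfolding D_def eq using det_nz_iff_inj[OF l] by simp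
    qed
    have cont: "continuous_on {0..1} D"
      unfolding D_def det_def by (simp, intro continuous_intros)
    have "D 0 > 0" using c0 by (simp add: D_def det_diagonal mat_def)
    then have "D 1 > 0"
      using IVT2'[of D 1 0 0] cont D0 by (meson atLeastAtMost_iff linorder_not_le order_less_imp_le zero_le_one)
    then show ?thesis by (simp add: D_def)
  qed
  have contF': "continuous_on UNIV (\<lambda>x. matrix (F' x) $ i $ j)" for i j
    using F by (auto simp: matrix_def C1_der_def intro!: continuous_intros)
  define b where "b k x = coeff (det_poly (matrix (F' x))) k" for k x
  have contb: "continuous_on UNIV (b k)" for k
    unfolding b_def using contF' by (rule continuous_on_coeff_det_poly)
  have intb: "b k integrable_on cball 0 R" for k
  proof -
    obtain a where a: "cball (0 :: real ^ 'n::_) R \<subseteq> cbox (- a) a"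
      using bounded_subset_cbox_symmetric[OF bounded_cball] by blast
    have "b k absolutely_integrable_on cbox (- a) a"
      by (intro absolutely_integrable_continuous continuous_on_subset[OF contb]) auto
    then have "b k absolutely_integrable_on cball 0 R"
      by (rule set_integrable_subset) (use a in auto)
    then show ?thesis by (simp add: absolutely_integrable_on_def)
  qed
  define P where "P = (\<Sum>k\<le>CARD('n). monom (integral (cball 0 R) (b k)) k)"
  have detb: "det (mat c + matrix (F' x)) = (\<Sum>k\<le>CARD('n). c ^ k * b k x)" for c x
  proof -
    have "det (mat c + matrix (F' x)) = (\<Sum>k\<le>degree (det_poly (matrix (F' x))). c ^ k * b k x)"
      by (simp add: b_def poly_altdef mult.commute flip: poly_det_poly)
    also have "\<dots> = (\<Sum>k\<le>CARD('n). c ^ k * b k x)"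
      using degree_det_poly[of "matrix (F' x)"]
      by (intro sum.mono_neutral_left) (auto simp: b_def coeff_eq_0)
    finally show ?thesis .
  qed
  have hasint: "((\<lambda>x. det (mat c + matrix (F' x))) has_integral poly P c) (cball 0 R)" for c
  proof -
    have "((\<lambda>x. \<Sum>k\<le>CARD('n). c ^ k * b k x) has_integral
        (\<Sum>k\<le>CARD('n). c ^ k * integral (cball 0 R) (b k))) (cball 0 R)"
      by (intro has_integral_sum has_integral_mult_right integrable_integral intb) auto
    then show ?thesis by (simp add: detb P_def poly_sum poly_monom mult.commute)
  qed
  \<comment> \<open>\<open>C * c ^ CARD('n)\<close> is the volume of \<open>cball 0 (c * R)\<close>,
    the image of the ball.\<close>
  define C where "C = unit_ball_vol (real CARD('n)) * R ^ CARD('n)"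
  have large: "poly P c = poly (monom C (CARD('n))) c" if c: "c > M" for c
  proof -
    have eq: "\<bar>det (matrix (\<lambda>v. c *\<^sub>R v + F' x v))\<bar> = det (mat c + matrix (F' x))" for x
      using detpos[OF c, of x] by (simp add: matrix_add_scaleR)
    have "((\<lambda>x. \<bar>det (matrix (\<lambda>v. c *\<^sub>R v + F' x v))\<bar>) has_integral poly P c) (cball 0 R)"
      unfolding eq by (rule hasint)
    then have "measure lebesgue (f c ` cball 0 R) = poly P c"
      using has_measure_differentiable_image[of "cball 0 R" "f c" "\<lambda>x v. c *\<^sub>R v + F' x v" "poly P c"]
        f_der f_inj[OF c] by (auto simp: inj_on_def inj_def)
    moreover have "measure lebesgue (cball 0 (c * R) :: (real ^ 'n::_) set) = C * c ^ CARD('n)"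
      using R M(1) c by (simp add: content_cball C_def power_mult_distrib)
    ultimately show ?thesis by (simp add: f_image[OF c] poly_monom)
  qed
  \<comment> \<open>Two polynomials that agree for all \<open>c > M\<close> are equal; at
    \<open>c = 0\<close> the monomial vanishes because the dimension is positive.\<close>
  have "P = monom C (CARD('n))"
  proof (rule ccontr)
    assume "P \<noteq> monom C (CARD('n))"
    then have "finite {c. poly (P - monom C (CARD('n))) c = 0}" by (intro poly_roots_finite) simp
    moreover have "{M<..} \<subseteq> {c. poly (P - monom C (CARD('n))) c = 0}" using large by auto
    ultimately show False using infinite_Ioi finite_subset by blast
  qed
  then have "((\<lambda>x. det (matrix (F' x))) has_integral 0) (cball 0 R)"
    using hasint[of 0] by (simp add: poly_monom mat_0 power_0_left)
  moreover have "det (matrix (F' x)) = 0" if "x \<notin> cball 0 R" for x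
    using that F'0[of x] by (simp add: det_matrix_zero)
  ultimately show ?thesis
    by (rule has_integral_on_superset) auto
qed

section \<open>Integral representation of the degree\<close>

lemma infdist_le_imp_mem:
  fixes K :: "'a::heine_borel set"
  assumes "compact K" "K \<noteq> {}" "(\<Union>x\<in>K. cball x r) \<subseteq> U" "infdist x K \<le> r"
  shows "x \<in> U"
proof -
  obtain y where "y \<in> K" "infdist x K = dist x y"
    using infdist_attains_inf[OF compact_imp_closed[OF assms(1)] assms(2)] by metis
  then show ?thesis using assms(3,4) by (force simp: dist_commute)
qed

text \<open>The distance to \<open>K\<close> is only continuous, so a polynomial close to
  \<open>1 - 2 * infdist x K / e\<close> is fed into \<open>step1\<close>, which flattens both ends.
  The cutoff is 1 on a whole neighbourhood \<open>A\<close> of \<open>K\<close>, so that its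
  derivative vanishes there and Jacobians of cut-off maps are unchanged.\<close>

lemma C1_cutoff:
  fixes K W :: "'a::euclidean_space set"
  assumes K: "compact K" and W: "open W" and KW: "K \<subseteq> W"
  obtains c :: "'a \<Rightarrow> real" and c' A L where
    "C1_der UNIV c c'" "\<And>x. 0 \<le> c x" "\<And>x. c x \<le> 1"
    "open A" "K \<subseteq> A" "A \<subseteq> L" "\<And>x. x \<in> A \<Longrightarrow> c x = 1" "\<And>x. x \<in> A \<Longrightarrow> c' x = (\<lambda>v. 0)"
    "compact L" "L \<subseteq> W" "\<And>x. x \<notin> L \<Longrightarrow> c x = 0" "\<And>x. x \<notin> L \<Longrightarrow> c' x = (\<lambda>v. 0)"
proof (cases "K = {}")
  \<comment> \<open>The distance to the empty set is 0 by convention, so this case cannot go through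
    \<open>infdist\<close>.\<close>
  case True
  show ?thesis
    by (rule that[of "\<lambda>x. 0" "\<lambda>x v. 0" "{}" "{}"]) (use True in \<open>auto simp: C1_der_const\<close>)
next
  case False
  obtain e where e: "e > 0" "(\<Union>x\<in>K. cball x e) \<subseteq> W"
    using compact_subset_open_imp_cball_epsilon_subset[OF K W KW] by auto
  note sub = infdist_le_imp_mem[OF K False e(2)]
  have comp: "compact {x. infdist x K \<le> e}" using compact_infdist_le[OF False K e(1)] .
  obtain p where p: "real_polynomial_function p"
    "\<And>x. infdist x K \<le> e \<Longrightarrow> \<bar>1 - 2 * infdist x K / e - p x\<bar> < 1/8"
  proof (rule Stone_Weierstrass_real_polynomial_function[OF comp])
    show "continuous_on {x. infdist x K \<le> e} (\<lambda>x. 1 - 2 * infdist x K / e)"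
      using e(1) by (intro continuous_intros) auto
    show "0 < (1/8 :: real)" by simp
  qed (use that in auto)
  obtain p' where p': "C1_der UNIV p p'" using real_polynomial_function_C1_der[OF p(1)] by blast
  \<comment> \<open>The approximation error is \<open>1/8\<close>: at distance below
    \<open>e/16\<close> the polynomial exceeds \<open>7/8 - 1/8 = 3/4\<close>, and beyond
    \<open>e/2\<close> it is below \<open>1/8\<close>. Both lie in the flat ranges of
    \<open>step1\<close>.\<close>
  let ?W = "{x. infdist x K < e}" and ?L = "{x. infdist x K \<le> e/2}" and ?A = "{x. infdist x K < e/16}"
  have C1: "C1_der ?W (\<lambda>x. step1 (p x)) (\<lambda>x v. 16 * tent (1/4) (p x - 1/2) * p' x v)"
    by (rule C1_der_compose_real[OF C1_der_subset[OF p'] has_real_derivative_step1])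
       (auto intro!: continuous_intros continuous_on_compose2[OF continuous_on_tent])
  have op: "open ?W" "open ?A" by (auto intro!: open_Collect_less continuous_intros)
  have cl: "closed ?L" by (auto intro!: closed_Collect_le continuous_intros)
  have zero: "step1 (p x) = 0" if "x \<in> ?W - ?L" for x
  proof -
    have "2 * infdist x K / e \<ge> 1" using that e(1) by (simp add: field_simps)
    moreover have "\<bar>1 - 2 * infdist x K / e - p x\<bar> < 1/8" using p(2)[of x] that by simp
    ultimately show ?thesis by (intro step1_eq_0) linarith
  qed
  have one: "step1 (p x) = 1" if "x \<in> ?A" for x
  proof -
    have "2 * infdist x K / e < 1/8" using that e(1) by (simp add: field_simps)
    moreover have "\<bar>1 - 2 * infdist x K / e - p x\<bar> < 1/8" using p(2)[of x] that e(1) by simp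
    ultimately show ?thesis by (intro step1_eq_1) linarith
  qed
  let ?c = "\<lambda>x. if x \<in> ?W then step1 (p x) else 0"
    and ?c' = "\<lambda>x v. if x \<in> ?W then 16 * tent (1/4) (p x - 1/2) * p' x v else 0"
  have C: "C1_der UNIV ?c ?c'"
    by (rule C1_der_extend_zero[OF C1 op(1) cl _ zero]) (use e in auto)
  have locally_const: "?c' x = (\<lambda>v. 0)" if "open S" "x \<in> S" "\<And>y. y \<in> S \<Longrightarrow> ?c y = k" for S x k
  proof -
    have "((\<lambda>x. k) has_derivative ?c' x) (at x)"
      by (rule has_derivative_transform_within_open[OF C1_derD(1)[OF C] that(1)]) (use that in auto)
    then show ?thesis by (rule has_derivative_unique) simp
  qed
  show thesis
  proof (rule that[OF C, of ?A ?L])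
    show "compact ?L" using compact_infdist_le[OF False K, of "e/2"] e by simp
    show "?c x = 1" if "x \<in> ?A" for x using one[OF that] that e by auto
    then show "?c' x = (\<lambda>v. 0)" if "x \<in> ?A" for x by (rule locally_const[OF op(2) that])
    show z: "?c x = 0" if "x \<notin> ?L" for x using zero[of x] that by auto
    show "?c' x = (\<lambda>v. 0)" if "x \<notin> ?L" for x
      by (rule locally_const[of "- ?L" x 0]) (use that cl z in auto)
    show "K \<subseteq> ?A" using e by auto
    show "?L \<subseteq> W" using sub e by force
  qed (use op e step1_range in auto)
qed

section \<open>Degree densities and their homotopy invariance\<close>

definition clamp :: "real \<Rightarrow> real ^ 'n \<Rightarrow> real ^ 'n" where
  "clamp \<epsilon> y = (\<chi> i. clamp1 \<epsilon> (y $ i))"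

text \<open>The Jacobian determinant of \<open>clamp \<epsilon>\<close> at \<open>y\<close>; for
  \<open>\<epsilon> > 0\<close> a nonnegative bump supported in the cube of half-width
  \<open>\<epsilon>\<close>.\<close>

definition bump :: "real \<Rightarrow> real ^ 'n::finite \<Rightarrow> real" where
  "bump \<epsilon> y = (\<Prod>i\<in>UNIV. tent \<epsilon> (y $ i))"

lemma continuous_on_bump: "continuous_on UNIV (bump \<epsilon>)"
  unfolding bump_def[abs_def]
  by (intro continuous_on_prod continuous_on_compose2[OF continuous_on_tent] continuous_intros) auto

lemma bump_eq_0: "\<epsilon> > 0 \<Longrightarrow> \<bar>y $ i\<bar> \<ge> \<epsilon> \<Longrightarrow> bump \<epsilon> y = 0"
  unfolding bump_def by (rule prod_zero) (auto intro: tent_eq_0)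

lemma C1_der_clamp:
  assumes "C1_der W F F'"
  shows "C1_der W (\<lambda>x. clamp \<epsilon> (F x)) (\<lambda>x v. \<chi> i. tent \<epsilon> (F x $ i) * F' x v $ i)"
  unfolding clamp_def
  by (rule C1_der_vec)
     (simp add: C1_der_compose_real[OF C1_der_component[OF assms] has_real_derivative_clamp1 continuous_on_tent])

text \<open>Truncating coordinatewise makes the outer derivative diagonal, so the chain rule
  multiplies row \<open>i\<close> by \<open>tent \<epsilon> (y $ i)\<close>.\<close>

lemma det_matrix_clamp:
  "det (matrix (\<lambda>v. \<chi> i. tent \<epsilon> (y $ i) * A v $ i)) = bump \<epsilon> y * det (matrix A)"
proof -
  have "matrix (\<lambda>v. \<chi> i. tent \<epsilon> (y $ i) * A v $ i) = (\<chi> i. tent \<epsilon> (y $ i) *s (matrix A $ i))"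
    by (auto simp: matrix_def vec_eq_iff)
  then show ?thesis by (simp add: det_rows_mul bump_def)
qed

text \<open>The pull-back under \<open>F\<close> of the density \<open>bump \<epsilon>\<close>. If 0
  is a regular value and \<open>\<epsilon>\<close> is small, its integral is the degree times the
  integral of \<open>bump \<epsilon>\<close>; the integral still makes sense when zeros are
  critical.\<close>

definition deg_density ::
    "real \<Rightarrow> (real ^ 'n) set \<Rightarrow> (real ^ 'n \<Rightarrow> real ^ 'n) \<Rightarrow> (real ^ 'n \<Rightarrow> real ^ 'n \<Rightarrow> real ^ 'n::finite)
      \<Rightarrow> real ^ 'n \<Rightarrow> real" where
  "deg_density \<epsilon> W F F' x = (if x \<in> W then bump \<epsilon> (F x) * det (matrix (F' x)) else 0)"

lemma deg_density_eq_0: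
  "\<epsilon> > 0 \<Longrightarrow> (\<exists>i. \<epsilon> \<le> \<bar>F x $ i\<bar>) \<Longrightarrow> deg_density \<epsilon> W F F' x = 0"
  by (auto simp: deg_density_def bump_eq_0)

text \<open>\<open>F\<close> is deformed into \<open>G\<close> only near \<open>K\<close>:
  \<open>G1\<close> is \<open>G\<close> around \<open>K\<close> and \<open>F\<close> outside
  \<open>L\<close>. Truncated and cut off by \<open>d\<close>, both \<open>F\<close> and
  \<open>G1\<close> become compactly supported maps, whose Jacobian determinants integrate to 0. The
  unwanted contribution where \<open>d\<close> decays is the same for both and cancels in the
  difference.\<close>

lemma deg_density_homotopy:
  fixes F G :: "real ^ 'n::{finite,wellorder} \<Rightarrow> real ^ 'n::_"
  assumes F: "C1_der W F F'" and G: "C1_der W G G'" and W: "open W"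
    and K: "compact K" "K \<subseteq> W" and \<epsilon>: "\<epsilon> > 0"
    and conv: "\<And>x t. x \<in> W - K \<Longrightarrow> 0 \<le> t \<Longrightarrow> t \<le> 1 \<Longrightarrow> \<exists>i. \<epsilon> \<le> \<bar>((1 - t) *\<^sub>R F x + t *\<^sub>R G x) $ i\<bar>"
  shows "((\<lambda>x. deg_density \<epsilon> W F F' x - deg_density \<epsilon> W G G' x) has_integral 0) UNIV"
proof -
  obtain c c' A L where c: "C1_der UNIV c c'" "\<And>x. (0::real) \<le> c x" "\<And>x. c x \<le> 1"
    "open A" "K \<subseteq> A" "A \<subseteq> L" "\<And>x. x \<in> A \<Longrightarrow> c x = 1" "\<And>x. x \<in> A \<Longrightarrow> c' x = (\<lambda>v. 0)"
    "compact L" "L \<subseteq> W" "\<And>x. x \<notin> L \<Longrightarrow> c x = 0" "\<And>x. x \<notin> L \<Longrightarrow> c' x = (\<lambda>v. 0)"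
    by (rule C1_cutoff[OF K(1) W K(2)]) (rule that, assumption+)
  obtain d d' B M where d: "C1_der UNIV d d'"
    "open B" "L \<subseteq> B" "B \<subseteq> M" "\<And>x. x \<in> B \<Longrightarrow> d x = (1::real)" "\<And>x. x \<in> B \<Longrightarrow> d' x = (\<lambda>v. 0)"
    "compact M" "M \<subseteq> W" "\<And>x. x \<notin> M \<Longrightarrow> d x = 0" "\<And>x. x \<notin> M \<Longrightarrow> d' x = (\<lambda>v. 0)"
    by (rule C1_cutoff[OF c(9) W c(10)]) (rule that, assumption+)
  define G1 where "G1 x = F x + c x *\<^sub>R (G x - F x)" for x
  define G1' where "G1' x v = F' x v + (c x *\<^sub>R (G' x v - F' x v) + c' x v *\<^sub>R (G x - F x))" for x v
  have G1: "C1_der W G1 G1'"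
    unfolding G1_def G1'_def
    by (intro C1_der_add C1_der_scaleR C1_der_diff F G C1_der_subset[OF c(1)]) auto
  define E where "E H x = (if x \<in> W then d x *\<^sub>R clamp \<epsilon> (H x) else 0)"
    for H :: "real ^ 'n::_ \<Rightarrow> real ^ 'n::_" and x
  define E' where "E' H H' x v = (if x \<in> W then d x *\<^sub>R (\<chi> i. tent \<epsilon> (H x $ i) * H' x v $ i)
      + d' x v *\<^sub>R clamp \<epsilon> (H x) else 0)"
    for H :: "real ^ 'n::_ \<Rightarrow> real ^ 'n::_" and H' x v
  have integral_E: "((\<lambda>x. det (matrix (E' H H' x))) has_integral 0) UNIV" if H: "C1_der W H H'" for H H'
  proof -
    obtain R where R: "R > 0" "\<And>x. x \<in> M \<Longrightarrow> norm x < R"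
      using compact_imp_bounded[OF d(7)] by (meson bounded_pos_less)
    show ?thesis
    proof (rule has_integral_det_compact_support[OF _ _ R(1)])
      show "C1_der UNIV (E H) (E' H H')"
        unfolding E_def E'_def
        by (rule C1_der_extend_zero[OF C1_der_scaleR[OF C1_der_subset[OF d(1)] C1_der_clamp[OF H]] W
              compact_imp_closed[OF d(7)]])
           (use d in auto)
      show "E H x = 0" if "norm x \<ge> R" for x
      proof -
        have "x \<notin> M" using R(2)[of x] that by auto
        then show ?thesis by (simp add: E_def d)
      qed
    qed
  qed
  have det_B: "det (matrix (E' H H' x)) = bump \<epsilon> (H x) * det (matrix (H' x))" if "x \<in> B" for H H' x
    using that d by (auto simp: E'_def[abs_def] det_matrix_clamp)
  have eq: "det (matrix (E' F F' x)) - det (matrix (E' G1 G1' x))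
      = deg_density \<epsilon> W F F' x - deg_density \<epsilon> W G G' x" for x
  proof -
    have zeroF: "bump \<epsilon> (F x) = 0" if "x \<in> W - K"
      using conv[OF that, of 0] \<epsilon> by (auto simp: bump_eq_0)
    have zeroG: "bump \<epsilon> (G x) = 0" if "x \<in> W - K"
      using conv[OF that, of 1] \<epsilon> by (auto simp: bump_eq_0)
    have zeroG1: "bump \<epsilon> (G1 x) = 0" if "x \<in> W - K"
    proof -
      have "G1 x = (1 - c x) *\<^sub>R F x + c x *\<^sub>R G x" by (simp add: G1_def algebra_simps)
      then show ?thesis using conv[OF that, of "c x"] c(2,3) \<epsilon> by (auto simp: bump_eq_0)
    qed
    \<comment> \<open>On \<open>K\<close> the map \<open>G1\<close> is \<open>G\<close>; on
      \<open>L - K\<close> all bumps vanish; on \<open>W - L\<close> the two cut-off maps coincide,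
      including the region where \<open>d\<close> is not constant.\<close>
    consider "x \<in> K" | "x \<in> L - K" | "x \<in> W - L" | "x \<notin> W" using K c by auto
    then show ?thesis
    proof cases
      case 1
      then have "x \<in> A" "x \<in> B" "x \<in> W" using K c d by auto
      moreover have "G1 x = G x" "G1' x = G' x"
        using \<open>x \<in> A\<close> c by (auto simp: G1_def G1'_def)
      ultimately show ?thesis by (simp add: det_B deg_density_def)
    next
      case 2
      then have "x \<in> B" "x \<in> W - K" using c d by auto
      then show ?thesis by (simp add: det_B deg_density_def zeroF zeroG zeroG1)
    next
      case 3
      then have x: "x \<in> W - K" using c by auto
      have "G1 x = F x" "G1' x = F' x" using 3 c by (auto simp: G1_def G1'_def)
      then have "E' G1 G1' x = E' F F' x" by (auto simp: E'_def)
      then show ?thesis using x by (simp add: deg_density_def zeroF zeroG)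
    next
      case 4
      then have "E' H H' x = (\<lambda>v. 0)" for H H' by (auto simp: E'_def)
      then show ?thesis using 4 by (simp add: deg_density_def det_matrix_zero)
    qed
  qed
  show ?thesis
    using has_integral_diff[OF integral_E[OF F] integral_E[OF G1]] by (simp add: eq)
qed

text \<open>The density vanishes off the compact \<open>K\<close>, which lies inside the open
  \<open>W\<close>; it is therefore continuous on the whole space, with compact support.\<close>

lemma deg_density_integrable:
  fixes F :: "real ^ 'n::finite \<Rightarrow> real ^ 'n"
  assumes F: "C1_der W F F'" and W: "open W" and K: "compact K" "K \<subseteq> W" and \<epsilon>: "\<epsilon> > 0"
    and big: "\<And>x. x \<in> W - K \<Longrightarrow> \<exists>i. \<epsilon> \<le> \<bar>F x $ i\<bar>"
  shows "deg_density \<epsilon> W F F' integrable_on UNIV"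
proof -
  have z: "deg_density \<epsilon> W F F' x = 0" if "x \<notin> K" for x
    using that deg_density_eq_0[OF \<epsilon>, of F x W F'] big[of x] by (cases "x \<in> W") (auto simp: deg_density_def)
  have "continuous_on (W \<union> - K) (deg_density \<epsilon> W F F')"
  proof (intro continuous_on_open_Un W)
    have "continuous_on W (\<lambda>x. bump \<epsilon> (F x) * det (matrix (F' x)))"
      by (intro continuous_intros continuous_on_compose2[OF continuous_on_bump]
          C1_der_continuous_det[OF F] C1_der_imp_continuous_on[OF F]) auto
    then show "continuous_on W (deg_density \<epsilon> W F F')"
      by (rule continuous_on_eq) (simp add: deg_density_def)
    show "continuous_on (- K) (deg_density \<epsilon> W F F')"
      by (rule continuous_on_eq[of _ "\<lambda>x. 0"]) (auto simp: z)
  qed (use K compact_imp_closed in auto)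
  moreover have "W \<union> - K = UNIV" using K by auto
  ultimately have cont: "continuous_on UNIV (deg_density \<epsilon> W F F')" by simp
  obtain a where a: "K \<subseteq> cbox (- a) a"
    using bounded_subset_cbox_symmetric[OF compact_imp_bounded[OF K(1)]] by blast
  have "deg_density \<epsilon> W F F' integrable_on cbox (- a) a"
    by (intro integrable_continuous continuous_on_subset[OF cont]) auto
  then show ?thesis
    by (rule integrable_on_superset) (use a z in auto)
qed

section \<open>Regular zeros counted by an integral\<close>

lemma integral_eq_integral_UNIV:
  fixes f :: "'a::euclidean_space \<Rightarrow> 'b::banach"
  assumes "\<And>x. x \<notin> S \<Longrightarrow> f x = 0"
  shows "integral S f = integral UNIV f"
proof -
  have "(\<lambda>x. if x \<in> S then f x else 0) = f" using assms by auto
  then show ?thesis using Henstock_Kurzweil_Integration.integral_restrict_UNIV[of S f] by simp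
qed

text \<open>Translates norm estimates into the coordinatewise lower bounds that make
  \<open>bump\<close> vanish.\<close>

lemma component_norm_le:
  fixes y :: "real ^ 'n::finite"
  obtains i where "norm y \<le> CARD('n) * \<bar>y $ i\<bar>"
proof -
  have "Max (range (\<lambda>i. \<bar>y $ i\<bar>)) \<in> range (\<lambda>i. \<bar>y $ i\<bar>)" by (rule Max_in) auto
  then obtain i where i: "Max (range (\<lambda>i. \<bar>y $ i\<bar>)) = \<bar>y $ i\<bar>" by (rule imageE)
  have "norm y \<le> (\<Sum>j\<in>UNIV. \<bar>y $ j\<bar>)" by (rule norm_le_l1_cart)
  also have "\<dots> \<le> (\<Sum>j\<in>(UNIV :: 'n set). \<bar>y $ i\<bar>)"
    unfolding i[symmetric] by (intro sum_mono Max_ge) auto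
  finally show thesis by (intro that[of i]) simp
qed

text \<open>An invertible derivative that varies continuously in the operator norm makes
  \<open>F\<close> injective on a small ball. The ball is shrunk until the determinant stays closer
  to its value at \<open>z\<close> than that value is to 0, which fixes its sign.\<close>

lemma C1_der_local_injective:
  fixes F :: "real ^ 'n::finite \<Rightarrow> real ^ 'n"
  assumes F: "C1_der W F F'" and W: "open W" and z: "z \<in> W" and det: "det (matrix (F' z)) \<noteq> 0"
  obtains r where "r > 0" "ball z r \<subseteq> W" "inj_on F (ball z r)"
    "\<And>x. x \<in> ball z r \<Longrightarrow> sgn (det (matrix (F' x))) = sgn (det (matrix (F' z)))"
proof -
  have bl: "bounded_linear (F' x)" if "x \<in> W" for x
    using C1_derD(1)[OF F that] by (rule has_derivative_bounded_linear)
  have "inj (F' z)" using det det_nz_iff_inj[OF C1_derD(2)[OF F z]] by simp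
  then obtain g where g: "linear g" "g \<circ> F' z = id"
    using linear_injective_left_inverse C1_derD(2)[OF F z] by blast
  \<comment> \<open>Here directional continuity becomes continuity in the operator norm.\<close>
  have cont: "continuous_on W (\<lambda>x. Blinfun (F' x))"
  proof (rule continuous_on_blinfun_componentwise)
    fix b :: "real ^ 'n"
    have "continuous_on W (\<lambda>x. F' x b)" using F by (auto simp: C1_der_def)
    then show "continuous_on W (\<lambda>x. blinfun_apply (Blinfun (F' x)) b)"
      by (rule continuous_on_eq) (simp add: bounded_linear_Blinfun_apply bl)
  qed
  obtain r1 where r1: "r1 > 0" "ball z r1 \<subseteq> W" "inj_on F (ball z r1)"
  proof (rule has_derivative_locally_injective[OF z W _ g(2) C1_derD(1)[OF F]])
    show "bounded_linear g" using g linear_conv_bounded_linear by blast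
    fix e :: real assume e: "e > 0"
    obtain d1 where d1: "d1 > 0" "\<And>x. x \<in> W \<Longrightarrow> dist x z < d1 \<Longrightarrow>
        dist (Blinfun (F' x)) (Blinfun (F' z)) < e"
      using cont z e unfolding continuous_on_iff by blast
    obtain d2 where d2: "d2 > 0" "ball z d2 \<subseteq> W" using W z open_contains_ball by blast
    show "\<exists>d>0. \<forall>x. dist z x < d \<longrightarrow> onorm (\<lambda>v. F' x v - F' z v) < e"
    proof (intro exI[of _ "min d1 d2"] conjI allI impI)
      fix x assume "dist z x < min d1 d2"
      then have x: "x \<in> W" "dist x z < d1" using d2 by (auto simp: dist_commute)
      have "norm (Blinfun (F' x) - Blinfun (F' z)) < e" using d1(2)[OF x] by (simp add: dist_norm)
      moreover have "blinfun_apply (Blinfun (F' x) - Blinfun (F' z)) = (\<lambda>v. F' x v - F' z v)"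
        by (simp add: fun_eq_iff minus_blinfun.rep_eq bounded_linear_Blinfun_apply bl x z)
      ultimately show "onorm (\<lambda>v. F' x v - F' z v) < e" by (simp add: norm_blinfun.rep_eq)
    qed (use d1 d2 in auto)
  qed (use that in auto)
  let ?D = "\<lambda>x. det (matrix (F' x))"
  have "continuous (at z) ?D"
    using C1_der_continuous_det[OF F] W z continuous_on_eq_continuous_at by blast
  then obtain r2 where r2: "r2 > 0" "\<And>x. dist x z < r2 \<Longrightarrow> dist (?D x) (?D z) < \<bar>?D z\<bar>"
    using det unfolding continuous_at_eps_delta dist_norm by (meson zero_less_abs_iff)
  show thesis
  proof (rule that[of "min r1 r2"])
    show "sgn (?D x) = sgn (?D z)" if "x \<in> ball z (min r1 r2)" for x
    proof -
      have "\<bar>?D x - ?D z\<bar> < \<bar>?D z\<bar>" using r2(2)[of x] that by (simp add: dist_commute dist_real_def)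
      then show ?thesis by (auto simp: sgn_if abs_if split: if_splits)
    qed
    show "inj_on F (ball z (min r1 r2))" using r1(3) by (rule inj_on_subset) auto
  qed (use r1 r2 in auto)
qed

text \<open>The vector-valued theorem is applied to \<open>vec\<close> of the integrand, with values
  in \<open>real ^ 1\<close>.\<close>

lemma has_integral_change_of_variables_real_valued:
  fixes f :: "real ^ 'n::{finite,wellorder} \<Rightarrow> real" and g :: "real ^ 'n::_ \<Rightarrow> real ^ 'n::_"
  assumes "S \<in> sets lebesgue" "\<And>x. x \<in> S \<Longrightarrow> (g has_derivative g' x) (at x within S)" "inj_on g S"
    and f: "f absolutely_integrable_on g ` S"
  shows "((\<lambda>x. \<bar>det (matrix (g' x))\<bar> * f (g x)) has_integral integral (g ` S) f) S"
proof -
  have "(\<lambda>x. \<bar>det (matrix (g' x))\<bar> *\<^sub>R vec (f (g x)) :: real ^ 1) absolutely_integrable_on S \<and>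
      integral S (\<lambda>x. \<bar>det (matrix (g' x))\<bar> *\<^sub>R vec (f (g x))) = (vec (integral (g ` S) f) :: real ^ 1)
    \<longleftrightarrow> (\<lambda>x. vec (f x) :: real ^ 1) absolutely_integrable_on (g ` S) \<and>
      integral (g ` S) (\<lambda>x. vec (f x)) = (vec (integral (g ` S) f) :: real ^ 1)"
    by (intro has_absolute_integral_change_of_variables assms)
  then have "(\<lambda>x. \<bar>det (matrix (g' x))\<bar> * f (g x)) absolutely_integrable_on S \<and>
      integral S (\<lambda>x. \<bar>det (matrix (g' x))\<bar> * f (g x)) = integral (g ` S) f"
    using f by (simp add: absolutely_integrable_on_1_iff integral_on_1_eq)
  then show ?thesis
    by (metis has_integral_integral set_lebesgue_integral_eq_integral(1))
qed

text \<open>The integral is nonzero because \<open>bump \<epsilon>\<close> is continuous,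
  nonnegative and positive at 0; the degree identities are later divided by it.\<close>

lemma bump_integral:
  fixes S :: "(real ^ 'n::finite) set"
  assumes \<epsilon>: "\<epsilon> > 0"
  shows "bump \<epsilon> absolutely_integrable_on (UNIV :: (real ^ 'n) set)"
    and "integral (UNIV :: (real ^ 'n) set) (bump \<epsilon>) \<noteq> 0"
proof -
  let ?a = "(\<chi> i. \<epsilon>) :: real ^ 'n"
  have z: "bump \<epsilon> x = 0" if x: "x \<notin> cbox (- ?a) ?a" for x :: "real ^ 'n"
  proof -
    obtain i where "\<not> (- \<epsilon> \<le> x $ i \<and> x $ i \<le> \<epsilon>)" using x by (auto simp: mem_box_cart)
    then show ?thesis using bump_eq_0[OF \<epsilon>, of x i] by auto
  qed
  have c: "continuous_on (cbox (- ?a) ?a) (bump \<epsilon>)"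
    using continuous_on_bump by (rule continuous_on_subset) auto
  have i: "bump \<epsilon> integrable_on cbox (- ?a) ?a"
    by (intro integrable_continuous c)
  then have "bump \<epsilon> integrable_on (UNIV :: (real ^ 'n) set)"
    by (rule integrable_on_superset) (use z in auto)
  then show "bump \<epsilon> absolutely_integrable_on (UNIV :: (real ^ 'n) set)"
    using \<epsilon> by (intro nonnegative_absolutely_integrable_1) (auto simp: bump_def intro!: prod_nonneg tent_nonneg)
  show "integral (UNIV :: (real ^ 'n) set) (bump \<epsilon>) \<noteq> 0"
  proof
    assume 0: "integral (UNIV :: (real ^ 'n) set) (bump \<epsilon>) = 0"
    have "(bump \<epsilon> has_integral integral (cbox (- ?a) ?a) (bump \<epsilon>)) (cbox (- ?a) ?a)"
      using i by blast
    moreover have "integral (cbox (- ?a) ?a) (bump \<epsilon>) = integral (UNIV :: (real ^ 'n) set) (bump \<epsilon>)"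
      by (rule integral_eq_integral_UNIV) (use z in auto)
    ultimately have "(bump \<epsilon> has_integral 0) (cbox (- ?a) ?a)" using 0 by simp
    then have "bump \<epsilon> (0 :: real ^ 'n) = 0"
      by (rule has_integral_0_cbox_imp_0[OF c, rotated])
         (use \<epsilon> in \<open>auto simp: bump_def mem_box_cart interval_ne_empty_cart intro!: prod_nonneg tent_nonneg\<close>)
    then show False using \<epsilon> by (simp add: bump_def tent_0)
  qed
qed

text \<open>Regular zeros are isolated, and all of them lie in the compact \<open>K\<close>, so they
  are finitely many. For small \<open>\<epsilon>\<close> the density lives in disjoint balls around
  them; on each ball \<open>F\<close> is injective with image containing the support of
  \<open>bump \<epsilon>\<close>, and the change of variables yields the sign times the full
  integral.\<close>

lemma integral_deg_density_regular:
  fixes F :: "real ^ 'n::{finite,wellorder} \<Rightarrow> real ^ 'n::_"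
  assumes F: "C1_der W F F'" and W: "open W" and K: "compact K" "K \<subseteq> W"
    and big: "\<And>x. x \<in> W - K \<Longrightarrow> \<exists>i. e1 \<le> \<bar>F x $ i\<bar>" and e1: "e1 > 0"
    and reg: "\<And>x. x \<in> W \<Longrightarrow> F x = 0 \<Longrightarrow> det (matrix (F' x)) \<noteq> 0"
  obtains \<epsilon>0 where "\<epsilon>0 > 0" "\<And>\<epsilon>. 0 < \<epsilon> \<Longrightarrow> \<epsilon> < \<epsilon>0 \<Longrightarrow> 
    (deg_density \<epsilon> W F F' has_integral
      integral (UNIV :: (real ^ 'n::_) set) (bump \<epsilon>) *
      (\<Sum>x | x \<in> W \<and> F x = 0. sgn (det (matrix (F' x))))) UNIV"
proof -
  define Z where "Z = {x. x \<in> W \<and> F x = 0}"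
  let ?D = "\<lambda>x. det (matrix (F' x))"
  have ZK: "Z \<subseteq> K" using big e1 by (fastforce simp: Z_def)
  have contF: "continuous_on W F" using F by (rule C1_der_imp_continuous_on)
  have "\<exists>r>0. ball z r \<subseteq> W \<and> inj_on F (ball z r) \<and> (\<forall>x\<in>ball z r. sgn (?D x) = sgn (?D z))"
    if "z \<in> Z" for z
    using C1_der_local_injective[OF F W, of z] reg that unfolding Z_def
    by (metis (mono_tags, lifting) mem_Collect_eq)
  then obtain r where r: "\<And>z. z \<in> Z \<Longrightarrow> r z > 0" "\<And>z. z \<in> Z \<Longrightarrow> ball z (r z) \<subseteq> W"
    "\<And>z. z \<in> Z \<Longrightarrow> inj_on F (ball z (r z))"
    "\<And>z x. z \<in> Z \<Longrightarrow> x \<in> ball z (r z) \<Longrightarrow> sgn (?D x) = sgn (?D z)" by metis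
  have isolated: "y = z" if "z \<in> Z" "y \<in> Z" "dist z y < r z" for y z
    using r(1,3)[OF that(1)] that by (auto simp: inj_on_def Z_def)
  have "closed (K \<inter> F -` {0})"
    using continuous_closed_preimage[OF continuous_on_subset[OF contF K(2)] compact_imp_closed[OF K(1)], of "{0}"]
    by simp
  moreover have "Z = K \<inter> F -` {0}" using ZK K by (auto simp: Z_def)
  ultimately have "compact Z" using K compact_Int_closed[of K Z] by (simp add: inf.absorb2)
  then obtain D where D: "D \<subseteq> Z" "finite D" "Z \<subseteq> (\<Union>z\<in>D. ball z (r z))"
    by (rule compactE_image[where C = Z and f = "\<lambda>z. ball z (r z)"]) (use r in auto)
  have "Z \<subseteq> D"
  proof
    fix y assume y: "y \<in> Z"
    then obtain z where z: "z \<in> D" "dist z y < r z" using D(3) by auto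
    then show "y \<in> D" using isolated[of z y] D(1) y by auto
  qed
  then have fin: "finite Z" using D finite_subset by blast
  \<comment> \<open>Half of the smallest radius keeps the balls disjoint: a common point of two of
    them would put one zero into the injectivity ball of the other. The 1 is there for an empty
    \<open>Z\<close>.\<close>
  define \<rho> where "\<rho> = Min (insert 1 (r ` Z)) / 2"
  have \<rho>: "\<rho> > 0" "\<And>z. z \<in> Z \<Longrightarrow> 2 * \<rho> \<le> r z"
    using fin r by (auto simp: \<rho>_def)
  have sub: "ball z \<rho> \<subseteq> ball z (r z)" if "z \<in> Z" for z using \<rho>(2)[OF that] \<rho>(1) by auto
  have disj: "y = z" if "y \<in> Z" "z \<in> Z" "x \<in> ball y \<rho>" "x \<in> ball z \<rho>" for x y z
  proof -
    have "dist z y < 2 * \<rho>" using that(3,4) dist_triangle_less_add[of z x \<rho> y \<rho>] by (simp add: dist_commute)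
    then show ?thesis using isolated[of z y] \<rho>(2)[OF that(2)] that by simp
  qed
  \<comment> \<open>By invariance of domain the image of the ball is open around 0, so it contains a
    small cube.\<close>
  have "\<exists>e>0. \<forall>y. (\<forall>i. \<bar>y $ i\<bar> < e) \<longrightarrow> y \<in> F ` ball z \<rho>" if z: "z \<in> Z" for z
  proof -
    have "open (F ` ball z \<rho>)"
      using sub[OF z] r(2,3)[OF z]
      by (intro invariance_of_domain continuous_on_subset[OF contF]) (auto intro: inj_on_subset)
    moreover have "0 \<in> F ` ball z \<rho>" using z \<rho>(1) by (force simp: Z_def)
    ultimately obtain e where e: "e > 0" "ball 0 e \<subseteq> F ` ball z \<rho>" using open_contains_ball by blast
    have "y \<in> F ` ball z \<rho>" if "\<forall>i. \<bar>y $ i\<bar> < e / CARD('n)" for y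
    proof -
      obtain i where "norm y \<le> CARD('n) * \<bar>y $ i\<bar>" by (rule component_norm_le)
      also have "\<dots> < e" using that by (simp add: field_simps)
      finally show ?thesis using e by auto
    qed
    then show ?thesis using e(1) by (intro exI[of _ "e / CARD('n)"]) auto
  qed
  then obtain eZ where eZ: "\<And>z. z \<in> Z \<Longrightarrow> eZ z > 0"
    "\<And>z y. z \<in> Z \<Longrightarrow> (\<And>i. \<bar>y $ i\<bar> < eZ z) \<Longrightarrow> y \<in> F ` ball z \<rho>" by metis
  \<comment> \<open>On what is left of \<open>K\<close> away from the zeros, some coordinate of
    \<open>F\<close> is bounded below.\<close>
  define K' where "K' = K - (\<Union>z\<in>Z. ball z \<rho>)"
  have "compact K'" unfolding K'_def using K by (intro compact_diff) auto
  have "\<exists>e2>0. \<forall>x\<in>K'. \<exists>i. e2 \<le> \<bar>F x $ i\<bar>"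
  proof (cases "K' = {}")
    case False
    have "continuous_on K' (\<lambda>x. norm (F x))"
      using K by (intro continuous_on_norm continuous_on_subset[OF contF]) (auto simp: K'_def)
    then obtain x0 where x0: "x0 \<in> K'" "\<And>x. x \<in> K' \<Longrightarrow> norm (F x0) \<le> norm (F x)"
      using continuous_attains_inf[OF \<open>compact K'\<close> False] by blast
    have "F x0 \<noteq> 0" using x0(1) K \<rho>(1) by (force simp: K'_def Z_def)
    moreover have "\<exists>i. norm (F x0) / CARD('n) \<le> \<bar>F x $ i\<bar>" if x: "x \<in> K'" for x
    proof -
      obtain i where "norm (F x) \<le> CARD('n) * \<bar>F x $ i\<bar>" by (rule component_norm_le)
      then show ?thesis using x0(2)[OF x] by (intro exI[of _ i]) (simp add: field_simps)
    qed
    ultimately show ?thesis by (intro exI[of _ "norm (F x0) / CARD('n)"]) auto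
  qed (auto intro: exI[of _ 1])
  then obtain e2 where e2: "e2 > 0" "\<And>x. x \<in> K' \<Longrightarrow> \<exists>i. e2 \<le> \<bar>F x $ i\<bar>" by blast
  define \<epsilon>0 where "\<epsilon>0 = Min ({e1, e2} \<union> eZ ` Z)"
  show thesis
  proof (rule that[of \<epsilon>0])
    show "\<epsilon>0 > 0" using fin e1 e2 eZ by (auto simp: \<epsilon>0_def)
    fix \<epsilon> :: real assume \<epsilon>: "0 < \<epsilon>" "\<epsilon> < \<epsilon>0"
    then have \<epsilon>': "\<epsilon> < e1" "\<epsilon> < e2" "\<And>z. z \<in> Z \<Longrightarrow> \<epsilon> < eZ z" using fin by (auto simp: \<epsilon>0_def)
    let ?B = "integral (UNIV :: (real ^ 'n::_) set) (bump \<epsilon>)"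
    \<comment> \<open>The absolute determinant from the change of variables times the sign, constant
      on the ball, is the signed determinant of the density.\<close>
    let ?h = "\<lambda>z x. if x \<in> ball z \<rho> then sgn (?D z) * (\<bar>?D x\<bar> * bump \<epsilon> (F x)) else 0"
    have loc: "(?h z has_integral sgn (?D z) * ?B) UNIV" if z: "z \<in> Z" for z
    proof -
      have zero: "bump \<epsilon> y = 0" if y: "y \<notin> F ` ball z \<rho>" for y
      proof -
        obtain i where "\<not> \<bar>y $ i\<bar> < eZ z" using eZ(2)[OF z] y by blast
        then show ?thesis using \<epsilon>'(3)[OF z] \<epsilon> by (intro bump_eq_0[of _ _ i]) auto
      qed
      have op: "open (F ` ball z \<rho>)"
        using sub[OF z] r(2,3)[OF z]
        by (intro invariance_of_domain continuous_on_subset[OF contF]) (auto intro: inj_on_subset)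
      have "bump \<epsilon> absolutely_integrable_on F ` ball z \<rho>"
        using bump_integral(1)[OF \<epsilon>(1)] by (rule set_integrable_subset) (use op in auto)
      then have "((\<lambda>x. \<bar>?D x\<bar> * bump \<epsilon> (F x)) has_integral integral (F ` ball z \<rho>) (bump \<epsilon>)) (ball z \<rho>)"
        using sub[OF z] r(2,3)[OF z]
        by (intro has_integral_change_of_variables_real_valued has_derivative_at_withinI[OF C1_derD(1)[OF F]])
           (auto intro: inj_on_subset)
      moreover have "integral (F ` ball z \<rho>) (bump \<epsilon>) = ?B"
        by (rule integral_eq_integral_UNIV) (use zero in auto)
      ultimately have "((\<lambda>x. \<bar>?D x\<bar> * bump \<epsilon> (F x)) has_integral ?B) (ball z \<rho>)" by simp
      then have "((\<lambda>x. sgn (?D z) * (\<bar>?D x\<bar> * bump \<epsilon> (F x))) has_integral sgn (?D z) * ?B) (ball z \<rho>)"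
        by (rule has_integral_mult_right)
      then show ?thesis by (subst has_integral_restrict_UNIV)
    qed
    have "((\<lambda>x. \<Sum>z\<in>Z. ?h z x) has_integral (\<Sum>z\<in>Z. sgn (?D z) * ?B)) UNIV"
      using fin loc by (rule has_integral_sum)
    moreover have "(\<Sum>z\<in>Z. ?h z x) = deg_density \<epsilon> W F F' x" for x
    proof (cases "\<exists>z\<in>Z. x \<in> ball z \<rho>")
      case True
      then obtain z where z: "z \<in> Z" "x \<in> ball z \<rho>" by blast
      then have x: "x \<in> W" "x \<in> ball z (r z)" using sub r(2) by blast+
      have "(\<Sum>y\<in>Z. ?h y x) = (\<Sum>y\<in>{z}. ?h y x)"
        using fin z disj by (intro sum.mono_neutral_right) auto
      also have "\<dots> = sgn (?D x) * \<bar>?D x\<bar> * bump \<epsilon> (F x)" using z r(4)[OF z(1) x(2)] by simp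
      also have "\<dots> = deg_density \<epsilon> W F F' x" using x by (simp add: deg_density_def sgn_mult_abs)
      finally show ?thesis .
    next
      case False
      then have "(\<Sum>z\<in>Z. ?h z x) = 0" by (intro sum.neutral) auto
      moreover have "deg_density \<epsilon> W F F' x = 0"
      proof (cases "x \<in> W")
        case True
        then have "\<exists>i. \<epsilon> \<le> \<bar>F x $ i\<bar>"
        proof (cases "x \<in> K")
          case True
          then have "x \<in> K'" using False by (auto simp: K'_def)
          then obtain i where "e2 \<le> \<bar>F x $ i\<bar>" using e2(2) by blast
          then show ?thesis using \<epsilon>'(2) by (intro exI[of _ i]) simp
        next
          case False
          then obtain i where "e1 \<le> \<bar>F x $ i\<bar>" using big[of x] True by blast
          then show ?thesis using \<epsilon>'(1) by (intro exI[of _ i]) simp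
        qed
        then show ?thesis using \<epsilon> deg_density_eq_0 by blast
      qed (simp add: deg_density_def)
      ultimately show ?thesis by simp
    qed
    ultimately show "(deg_density \<epsilon> W F F' has_integral
        ?B * (\<Sum>x | x \<in> W \<and> F x = 0. sgn (?D x))) UNIV"
      by (simp add: Z_def mult.commute sum_distrib_left)
  qed
qed

section \<open>Homotopy invariance over a varying domain\<close>

lemma compact_norm_lower_bound:
  fixes f :: "'a::topological_space \<Rightarrow> 'b::real_normed_vector"
  assumes "compact S" "continuous_on S f" "\<And>x. x \<in> S \<Longrightarrow> f x \<noteq> 0"
  obtains m where "m > 0" "\<And>x. x \<in> S \<Longrightarrow> m \<le> norm (f x)"
proof (cases "S = {}")
  case True
  then show thesis by (intro that[of 1]) auto
next
  case False
  obtain x0 where "x0 \<in> S" "\<And>x. x \<in> S \<Longrightarrow> norm (f x0) \<le> norm (f x)"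
    using continuous_attains_inf[OF assms(1) False continuous_on_norm[OF assms(2)]] by blast
  then show thesis using assms(3) by (intro that[of "norm (f x0)"]) auto
qed

lemma C1_der_slice:
  fixes F :: "'a::euclidean_space \<times> 'b::euclidean_space \<Rightarrow> 'c::euclidean_space"
  assumes F: "C1_der UNIV F F'"
  shows "C1_der W (\<lambda>s. F (p, s)) (\<lambda>s v. F' (p, s) (0, v))"
  unfolding C1_der_def
proof (intro conjI ballI allI)
  fix s :: 'b
  have "((\<lambda>s. (p, s)) has_derivative (\<lambda>v. (0, v))) (at s)"
    by (auto intro!: derivative_eq_intros)
  then show "((\<lambda>s. F (p, s)) has_derivative (\<lambda>v. F' (p, s) (0, v))) (at s)"
    using has_derivative_compose[of "\<lambda>s. (p, s)" _ s UNIV F "F' (p, s)"] C1_derD(1)[OF F] by simp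
next
  fix v
  have "continuous_on UNIV (\<lambda>x. F' x (0, v))" using F by (auto simp: C1_der_def)
  then show "continuous_on W (\<lambda>s. F' (p, s) (0, v))"
    by (rule continuous_on_compose2) (auto intro!: continuous_intros)
qed

lemma locally_constant_unit_interval:
  fixes J :: "real \<Rightarrow> 'a"
  assumes "\<delta> > 0" "\<And>p q. p \<in> {0..1} \<Longrightarrow> q \<in> {0..1} \<Longrightarrow> \<bar>p - q\<bar> < \<delta> \<Longrightarrow> J p = J q"
  shows "J 0 = J 1"
proof -
  obtain n :: nat where n: "n > 0" "1 / real n < \<delta>"
    using reals_Archimedean[OF assms(1)] by (metis inverse_eq_divide zero_less_Suc)
  have "J 0 = J (real i / real n)" if "i \<le> n" for i
    using that
  proof (induction i)
    case (Suc i)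
    have "\<bar>real i / real n - real (Suc i) / real n\<bar> = 1 / real n"
      by (simp add: diff_divide_distrib[symmetric])
    then have "J (real i / real n) = J (real (Suc i) / real n)"
      using Suc n by (intro assms(2)) auto
    then show ?case using Suc by simp
  qed simp
  from this[of n] show ?thesis using n by simp
qed

text \<open>
  The domain of \<open>H p\<close> is the slice \<open>{s. (p, s) \<in> P}\<close>, which may vary with \<open>p\<close>.
\<close>

definition null_homotopy ::
    "(real \<Rightarrow> 'a::topological_space \<Rightarrow> 'b::{zero,topological_space}) \<Rightarrow> (real \<times> 'a) set \<Rightarrow> 'a set \<Rightarrow> bool" where
  "null_homotopy H P V \<longleftrightarrow>
     open P \<and> continuous_on (P \<inter> {0..1} \<times> UNIV) (\<lambda>x. H (fst x) (snd x)) \<and>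
     compact {x \<in> P \<inter> {0..1} \<times> UNIV. H (fst x) (snd x) = 0} \<and>
     (\<forall>s. (1, s) \<in> P \<longrightarrow> H 1 s \<noteq> 0) \<and>
     (\<forall>s\<in>closure V. (0, s) \<in> P) \<and> (\<forall>s. (0, s) \<in> P \<longrightarrow> H 0 s = 0 \<longrightarrow> s \<in> V)"

lemma null_homotopyD:
  assumes "null_homotopy H P V"
  shows "open P" "continuous_on (P \<inter> {0..1} \<times> UNIV) (\<lambda>x. H (fst x) (snd x))"
    "compact {x \<in> P \<inter> {0..1} \<times> UNIV. H (fst x) (snd x) = 0}"
    "\<And>s. (1, s) \<in> P \<Longrightarrow> H 1 s \<noteq> 0" "\<And>s. s \<in> closure V \<Longrightarrow> (0, s) \<in> P"
    "\<And>s. (0, s) \<in> P \<Longrightarrow> H 0 s = 0 \<Longrightarrow> s \<in> V"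
  using assms unfolding null_homotopy_def by blast+

text \<open>Near its zero set the homotopy is approximated by a polynomial map \<open>F\<close>. The
  integral \<open>J p\<close> of the degree density of \<open>F (p, _)\<close> over the slice
  \<open>W p\<close> is locally constant in \<open>p\<close>. It is 0 at \<open>p = 1\<close>, where
  there are no zeros; at \<open>p = 0\<close> it equals the integral for \<open>g\<close> on
  \<open>V\<close>, because a segment joins \<open>F (0, _)\<close> to \<open>g\<close> without
  zeros near the frontier.\<close>

lemma sum_sgn_det_eq_0_wellorder:
  fixes H :: "real \<Rightarrow> real ^ 'n::{finite,wellorder} \<Rightarrow> real ^ 'n::_"
    and P :: "(real \<times> (real ^ 'n::_)) set"
  assumes hom: "null_homotopy H P V" and V: "open V" "bounded V"
    and g: "C1_der V g g'" "continuous_on (closure V) g"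
    and near: "\<And>x. x \<in> frontier V \<Longrightarrow> norm (H 0 x - g x) < norm (H 0 x)"
    and reg: "\<And>x. x \<in> V \<Longrightarrow> g x = 0 \<Longrightarrow> det (matrix (g' x)) \<noteq> 0"
  shows "(\<Sum>x | x \<in> V \<and> g x = 0. sgn (det (matrix (g' x)))) = 0"
proof (cases "V = {}")
  case False
  note P = null_homotopyD(1)[OF hom] and contH = null_homotopyD(2)[OF hom]
    and compZ = null_homotopyD(3)[OF hom] and one = null_homotopyD(4)[OF hom]
    and V0 = null_homotopyD(5)[OF hom] and VZ = null_homotopyD(6)[OF hom]
  define Hc where "Hc x = H (fst x) (snd x)" for x
  \<comment> \<open>The part \<open>{0} \<times> closure V\<close> is added so that the
    neighbourhood of \<open>Z\<close> contains all of \<open>closure V\<close> at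
    \<open>p = 0\<close>, where \<open>H 0\<close> is compared with \<open>g\<close>.\<close>
  define Z where "Z = {x \<in> P \<inter> {0..1} \<times> UNIV. Hc x = 0} \<union> {0} \<times> closure V"
  have compVc: "compact (closure V)" using V by (simp add: compact_closure)
  have Z: "compact Z" "Z \<noteq> {}" "Z \<subseteq> P"
    using compZ compVc V0 False by (auto simp: Z_def Hc_def intro!: compact_Un compact_Times)
  obtain r where r: "r > 0" "(\<Union>x\<in>Z. cball x r) \<subseteq> P"
    using compact_subset_open_imp_cball_epsilon_subset[OF Z(1) P Z(3)] by auto
  note sub = infdist_le_imp_mem[OF Z(1,2) r(2)]
  have compball: "compact {x. infdist x Z \<le> c}" if "c > 0" for c
    using compact_infdist_le[OF Z(2,1) that] .
  define C where "C = {x. infdist x Z \<le> r} \<inter> {0..1} \<times> UNIV"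
  have compC: "compact C"
    unfolding C_def using compball[OF r(1)] by (intro compact_Int_closed closed_Times) auto
  have CP: "C \<subseteq> P \<inter> {0..1} \<times> UNIV" using sub by (auto simp: C_def)
  have contC: "continuous_on S Hc" if "S \<subseteq> C" for S
    using continuous_on_subset[OF contH] CP that unfolding Hc_def by blast
  have zeroC: "infdist x Z = 0" if "x \<in> C" "Hc x = 0" for x
    using that CP Z(2) by (intro infdist_zero) (auto simp: Z_def)
  have inf0: "infdist (0, s) Z = 0" if "s \<in> closure V" for s
    using that Z(2) by (intro infdist_zero) (auto simp: Z_def)
  \<comment> \<open>Three compact parts of \<open>C\<close> carry no zeros: the points at distance
    at least \<open>r/4\<close> from \<open>Z\<close>, the slice \<open>p = 1\<close>, and the slice
    \<open>p = 0\<close> outside \<open>V\<close>.\<close>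
  obtain m1 where m1: "m1 > 0" "\<And>x. x \<in> C \<inter> {x. r/4 \<le> infdist x Z} \<Longrightarrow> m1 \<le> norm (Hc x)"
  proof (rule compact_norm_lower_bound)
    show "compact (C \<inter> {x. r/4 \<le> infdist x Z})"
      by (intro compact_Int_closed compC closed_Collect_le continuous_intros)
    show "Hc x \<noteq> 0" if "x \<in> C \<inter> {x. r/4 \<le> infdist x Z}" for x using zeroC[of x] that r(1) by auto
  qed (use contC in auto)
  obtain m2 where m2: "m2 > 0" "\<And>x. x \<in> C \<inter> {1} \<times> UNIV \<Longrightarrow> m2 \<le> norm (Hc x)"
  proof (rule compact_norm_lower_bound)
    show "compact (C \<inter> {1} \<times> UNIV)" by (intro compact_Int_closed compC closed_Times) auto
    show "Hc x \<noteq> 0" if "x \<in> C \<inter> {1} \<times> UNIV" for x using that CP one by (auto simp: Hc_def)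
  qed (use contC in auto)
  obtain m3 where m3: "m3 > 0" "\<And>x. x \<in> C \<inter> {0} \<times> (- V) \<Longrightarrow> m3 \<le> norm (Hc x)"
  proof (rule compact_norm_lower_bound)
    show "compact (C \<inter> {0} \<times> (- V))"
      using V by (intro compact_Int_closed compC closed_Times) auto
    show "Hc x \<noteq> 0" if "x \<in> C \<inter> {0} \<times> (- V)" for x using that CP VZ by (auto simp: Hc_def)
  qed (use contC in auto)
  have contV: "continuous_on (closure V) (H 0)"
  proof -
    have "continuous_on (closure V) (\<lambda>s. Hc (0, s))"
      using inf0 r(1)
      by (intro continuous_on_compose2[OF contC[OF order_refl]] continuous_intros) (auto simp: C_def)
    then show ?thesis by (simp add: Hc_def)
  qed
  \<comment> \<open>\<open>D x\<close> is a lower bound for the norm of every convex combination of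
    \<open>H 0 x\<close> and \<open>g x\<close>. Being positive on the frontier, it exceeds
    \<open>m4/2\<close> off a compact subset \<open>KV\<close> of \<open>V\<close>.\<close>
  define D where "D x = norm (H 0 x) - norm (H 0 x - g x)" for x
  have contD: "continuous_on (closure V) D"
    unfolding D_def by (intro continuous_intros contV g)
  obtain m4 where m4: "m4 > 0" "\<And>x. x \<in> frontier V \<Longrightarrow> m4 \<le> norm (D x)"
  proof (rule compact_norm_lower_bound)
    show "compact (frontier V)" using V compact_frontier_bounded by blast
    show "continuous_on (frontier V) D" using contD by (rule continuous_on_subset) (simp add: frontier_def)
    show "D x \<noteq> 0" if "x \<in> frontier V" for x using near[OF that] by (simp add: D_def)
  qed auto
  have m4': "m4 \<le> D x" if "x \<in> frontier V" for x
    using m4(2)[OF that] near[OF that] by (simp add: D_def)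
  define KV where "KV = {x \<in> closure V. D x \<le> m4/2}"
  have "closed KV"
    using continuous_closed_preimage[OF contD closed_closure, of "{..m4/2}"]
    by (simp add: KV_def vimage_def Int_def)
  then have compKV: "compact KV"
    using compVc by (metis (no_types, lifting) KV_def compact_Int_closed inf.absorb_iff2 mem_Collect_eq subsetI)
  have KV: "KV \<subseteq> V"
    using m4' m4(1) V(1) by (force simp: KV_def frontier_def interior_open)
  \<comment> \<open>With errors of size \<open>\<eta>\<close> against lower bounds of
    \<open>8 * \<eta>\<close>, several approximations can be added and a norm of at least
    \<open>\<eta>\<close> remains.\<close>
  define \<eta> where "\<eta> = Min {m1, m2, m3, m4/2} / 8"
  have \<eta>: "\<eta> > 0" "8 * \<eta> \<le> m1" "8 * \<eta> \<le> m2" "8 * \<eta> \<le> m3" "8 * \<eta> \<le> m4/2"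
    using m1(1) m2(1) m3(1) m4(1) by (auto simp: \<eta>_def)
  obtain F where F: "polynomial_function F" "\<And>x. x \<in> C \<Longrightarrow> norm (Hc x - F x) < \<eta>"
    using Stone_Weierstrass_polynomial_function[OF compC contC[OF order_refl] \<eta>(1)] by blast
  obtain F' where F': "C1_der UNIV F F'" using polynomial_function_C1_der[OF F(1)] by blast
  note slice = C1_der_slice[OF F']
  have conv: "norm (H 0 x - t *\<^sub>R (H 0 x - g x)) \<ge> D x" if "0 \<le> t" "t \<le> 1" for x t
  proof -
    have "t * norm (H 0 x - g x) \<le> norm (H 0 x - g x)"
      using that by (simp add: mult_left_le_one_le)
    moreover have "norm (H 0 x) - norm (t *\<^sub>R (H 0 x - g x)) \<le> norm (H 0 x - t *\<^sub>R (H 0 x - g x))"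
      by (rule norm_triangle_ineq2)
    ultimately show ?thesis using that by (simp add: D_def)
  qed
  obtain \<epsilon>0 where \<epsilon>0: "\<epsilon>0 > 0" "\<And>\<epsilon>. 0 < \<epsilon> \<Longrightarrow> \<epsilon> < \<epsilon>0 \<Longrightarrow> 
    (deg_density \<epsilon> V g g' has_integral integral (UNIV :: (real ^ 'n::_) set) (bump \<epsilon>) *
      (\<Sum>x | x \<in> V \<and> g x = 0. sgn (det (matrix (g' x))))) UNIV"
  proof (rule integral_deg_density_regular[OF g(1) V(1) compKV KV _ _ reg])
    show "m4 / 2 / CARD('n) > 0" using m4 by simp
    fix x assume x: "x \<in> V - KV"
    then have "x \<in> closure V" using closure_subset by blast
    then have "m4/2 < D x" using x by (simp add: KV_def)
    also have "D x \<le> norm (g x)" using conv[of 1 x] by simp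
    finally have "m4/2 \<le> norm (g x)" by simp
    moreover obtain i where "norm (g x) \<le> CARD('n) * \<bar>g x $ i\<bar>" by (rule component_norm_le)
    ultimately have "m4/2 / CARD('n) \<le> \<bar>g x $ i\<bar>" by (simp add: field_simps)
    then show "\<exists>i. m4/2 / CARD('n) \<le> \<bar>g x $ i\<bar>" ..
  qed (assumption, assumption, rule that, assumption+)
  \<comment> \<open>Small enough to count the zeros of \<open>g\<close>, and such that a norm of at
    least \<open>\<eta>\<close> forces a coordinate of size at least
    \<open>\<epsilon>\<close>.\<close>
  define \<epsilon> where "\<epsilon> = min (\<epsilon>0 / 2) (\<eta> / CARD('n))"
  have \<epsilon>: "0 < \<epsilon>" "\<epsilon> < \<epsilon>0" "CARD('n) * \<epsilon> \<le> \<eta>"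
    using \<epsilon>0(1) \<eta>(1) by (auto simp: \<epsilon>_def min_def field_simps)
  have big: "\<exists>i. \<epsilon> \<le> \<bar>y $ i\<bar>" if "\<eta> \<le> norm y" for y :: "real ^ 'n::_"
  proof -
    obtain i where "norm y \<le> CARD('n) * \<bar>y $ i\<bar>" by (rule component_norm_le)
    then have "CARD('n) * \<epsilon> \<le> CARD('n) * \<bar>y $ i\<bar>" using that \<epsilon>(3) by linarith
    then show ?thesis by auto
  qed
  have Fbig: "7 * \<eta> \<le> norm (F x)" if "x \<in> C" "8 * \<eta> \<le> norm (Hc x)" for x
    using F(2)[OF that(1)] that(2) norm_triangle_ineq2[of "Hc x" "Hc x - F x"] by simp
  define W where "W p = {s. infdist (p, s) Z < r}" for p
  let ?F = "\<lambda>p s. F (p, s)" and ?F' = "\<lambda>p s v. F' (p, s) (0, v)"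
  have opW: "open (W p)" for p
    unfolding W_def by (intro open_Collect_less continuous_intros)
  have WC: "(p, s) \<in> C" if "p \<in> {0..1}" "s \<in> W p" for p s
    using that by (auto simp: W_def C_def)
  define K where "K p = {s. infdist (p, s) Z \<le> r/2}" for p
  have compK: "compact (K p)" for p
  proof -
    have "closed (K p)" unfolding K_def by (intro closed_Collect_le continuous_intros)
    moreover have "bounded (snd ` {x. infdist x Z \<le> r/2})"
      using compball[of "r/2"] r(1)
      by (intro compact_imp_bounded compact_continuous_image continuous_intros) auto
    then have "bounded (K p)" by (rule bounded_subset) (force simp: K_def)
    ultimately show ?thesis by (simp add: compact_eq_bounded_closed)
  qed
  have KW: "K p \<subseteq> W p" for p using r(1) by (auto simp: K_def W_def)
  have outK: "7 * \<eta> \<le> norm (F (p, s))" if "p \<in> {0..1}" "s \<in> W p" "r/4 \<le> infdist (p, s) Z" for p s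
    using m1(2)[of "(p, s)"] that \<eta> WC[OF that(1,2)] by (intro Fbig) auto
  have integrable: "deg_density \<epsilon> (W p) (?F p) (?F' p) integrable_on UNIV" if "p \<in> {0..1}" for p
  proof (rule deg_density_integrable[OF slice opW compK KW \<epsilon>(1)])
    fix s assume "s \<in> W p - K p"
    then have "7 * \<eta> \<le> norm (F (p, s))" using that r(1) by (intro outK) (auto simp: K_def)
    then show "\<exists>i. \<epsilon> \<le> \<bar>F (p, s) $ i\<bar>" using \<eta>(1) by (intro big) simp
  qed
  define J where "J p = integral UNIV (deg_density \<epsilon> (W p) (?F p) (?F' p))" for p
  have "uniformly_continuous_on C Hc" using contC compC compact_uniformly_continuous by blast
  then obtain \<delta>0 where \<delta>0: "\<delta>0 > 0"
    "\<And>x y. x \<in> C \<Longrightarrow> y \<in> C \<Longrightarrow> dist y x < \<delta>0 \<Longrightarrow> dist (Hc y) (Hc x) < \<eta>"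
    using \<eta>(1) unfolding uniformly_continuous_on_def by blast
  \<comment> \<open>A change of \<open>p\<close> by less than \<open>r/4\<close> moves distances to
    \<open>Z\<close> by less than \<open>r/4\<close>. Hence \<open>K p\<close>, with radius
    \<open>r/2\<close>, stays in \<open>W q\<close>, and points of \<open>W p\<close> outside
    \<open>W q\<close> have distance more than \<open>3 * r / 4\<close>, where \<open>F\<close> is
    bounded below.\<close>
  define \<delta> where "\<delta> = min \<delta>0 (r/4)"
  have \<delta>: "\<delta> > 0" "\<delta> \<le> \<delta>0" "\<delta> \<le> r/4" using \<delta>0 r by (auto simp: \<delta>_def)
  have step: "J p = J q" if p: "p \<in> {0..1}" and q: "q \<in> {0..1}" and pq: "\<bar>p - q\<bar> < \<delta>" for p q
  proof -
    have dpq: "dist (p, s) (q, s) = \<bar>p - q\<bar>" for s :: "real ^ 'n::_"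
      by (simp add: dist_Pair_Pair dist_real_def)
    have ip: "infdist (p, s) Z < infdist (q, s) Z + \<delta>" for s
      using infdist_triangle[of "(p, s)" Z "(q, s)"] dpq[of s] pq by linarith
    have iq: "infdist (q, s) Z < infdist (p, s) Z + \<delta>" for s
      using infdist_triangle[of "(q, s)" Z "(p, s)"] dpq[of s] pq by (simp add: dist_commute)
    have KWpq: "K p \<subseteq> W p \<inter> W q"
    proof
      fix s assume "s \<in> K p"
      then show "s \<in> W p \<inter> W q" using iq[of s] \<delta> r(1) by (simp add: K_def W_def)
    qed
    \<comment> \<open>The segment from \<open>F (p, _)\<close> to \<open>F (q, _)\<close> is taken
      on the common part of the two slices; the densities vanish on the rest.\<close>
    have "((\<lambda>x. deg_density \<epsilon> (W p \<inter> W q) (?F p) (?F' p) x - deg_density \<epsilon> (W p \<inter> W q) (?F q) (?F' q) x)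
        has_integral 0) UNIV"
    proof (rule deg_density_homotopy[OF slice slice open_Int[OF opW opW] compK KWpq \<epsilon>(1)])
      fix s t :: real and x assume x: "x \<in> W p \<inter> W q - K p" and t: "0 \<le> t" "t \<le> 1"
      have "7 * \<eta> \<le> norm (F (p, x))" using x p r(1) by (intro outK) (auto simp: K_def)
      \<comment> \<open>One \<open>\<eta>\<close> comes from the uniform continuity of
        \<open>Hc\<close>, two from the polynomial approximation.\<close>
      moreover have "norm (F (p, x) - F (q, x)) \<le> 3 * \<eta>"
      proof -
        have C: "(p, x) \<in> C" "(q, x) \<in> C" using x p q WC by auto
        have "norm (Hc (p, x) - Hc (q, x)) < \<eta>"
          using \<delta>0(2)[OF C(2,1)] dpq[of x] pq \<delta>(2) by (simp add: dist_norm)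
        moreover have "norm (F (p, x) - F (q, x)) \<le> norm (Hc (p, x) - Hc (q, x)) + norm (Hc (p, x) - F (p, x))
            + norm (Hc (q, x) - F (q, x))"
          by norm
        ultimately show ?thesis using F(2)[OF C(1)] F(2)[OF C(2)] by linarith
      qed
      moreover have "norm (t *\<^sub>R (F (p, x) - F (q, x))) \<le> norm (F (p, x) - F (q, x))"
        using t by (simp add: mult_left_le_one_le)
      moreover have "norm (F (p, x)) - norm (t *\<^sub>R (F (p, x) - F (q, x)))
          \<le> norm (F (p, x) - t *\<^sub>R (F (p, x) - F (q, x)))" by (rule norm_triangle_ineq2)
      ultimately have le: "\<eta> \<le> norm (F (p, x) - t *\<^sub>R (F (p, x) - F (q, x)))"
        using \<eta>(1) by linarith
      have eq: "(1 - t) *\<^sub>R F (p, x) + t *\<^sub>R F (q, x) = F (p, x) - t *\<^sub>R (F (p, x) - F (q, x))"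
        by (simp add: algebra_simps)
      show "\<exists>i. \<epsilon> \<le> \<bar>((1 - t) *\<^sub>R F (p, x) + t *\<^sub>R F (q, x)) $ i\<bar>"
        unfolding eq using le by (rule big)
    qed
    moreover have "deg_density \<epsilon> (W p \<inter> W q) (?F p) (?F' p) = deg_density \<epsilon> (W p) (?F p) (?F' p)"
    proof
      fix s
      have "deg_density \<epsilon> (W p) (?F p) (?F' p) s = 0" if "s \<in> W p" "s \<notin> W q"
      proof -
        have "7 * \<eta> \<le> norm (F (p, s))"
          using that p iq[of s] \<delta>(3) r(1) by (intro outK) (auto simp: W_def)
        then show ?thesis using \<eta>(1) \<epsilon>(1) by (intro deg_density_eq_0 big) auto
      qed
      then show "deg_density \<epsilon> (W p \<inter> W q) (?F p) (?F' p) s = deg_density \<epsilon> (W p) (?F p) (?F' p) s"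
        by (auto simp: deg_density_def)
    qed
    moreover have "deg_density \<epsilon> (W p \<inter> W q) (?F q) (?F' q) = deg_density \<epsilon> (W q) (?F q) (?F' q)"
    proof
      fix s
      have "deg_density \<epsilon> (W q) (?F q) (?F' q) s = 0" if "s \<in> W q" "s \<notin> W p"
      proof -
        have "7 * \<eta> \<le> norm (F (q, s))"
          using that q ip[of s] \<delta>(3) r(1) by (intro outK) (auto simp: W_def)
        then show ?thesis using \<eta>(1) \<epsilon>(1) by (intro deg_density_eq_0 big) auto
      qed
      then show "deg_density \<epsilon> (W p \<inter> W q) (?F q) (?F' q) s = deg_density \<epsilon> (W q) (?F q) (?F' q) s"
        by (auto simp: deg_density_def)
    qed
    ultimately have "((\<lambda>x. deg_density \<epsilon> (W p) (?F p) (?F' p) x - deg_density \<epsilon> (W q) (?F q) (?F' q) x)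
        has_integral 0) UNIV" by simp
    moreover have "((\<lambda>x. deg_density \<epsilon> (W p) (?F p) (?F' p) x - deg_density \<epsilon> (W q) (?F q) (?F' q) x)
        has_integral J p - J q) UNIV"
      unfolding J_def by (intro has_integral_diff integrable_integral integrable p q)
    ultimately have "J p - J q = 0" by (rule has_integral_unique[rotated])
    then show ?thesis by simp
  qed
  have "J 0 = J 1" using \<delta>(1) step by (rule locally_constant_unit_interval)
  also have "J 1 = 0"
  proof -
    have "deg_density \<epsilon> (W 1) (?F 1) (?F' 1) s = 0" for s
    proof (cases "s \<in> W 1")
      case True
      then have "7 * \<eta> \<le> norm (F (1, s))"
        using m2(2)[of "(1, s)"] \<eta> WC[of 1 s] by (intro Fbig) auto
      then show ?thesis using \<eta>(1) \<epsilon>(1) by (intro deg_density_eq_0 big) auto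
    qed (simp add: deg_density_def)
    then have "deg_density \<epsilon> (W 1) (?F 1) (?F' 1) = (\<lambda>s. 0)" by (rule ext)
    then show ?thesis by (simp add: J_def)
  qed
  finally have J0: "J 0 = 0" .
  have VW: "V \<subseteq> W 0" using inf0 r(1) closure_subset[of V] by (auto simp: W_def subset_iff)
  have "deg_density \<epsilon> (W 0) (?F 0) (?F' 0) = deg_density \<epsilon> V (?F 0) (?F' 0)"
  proof
    fix s
    have "deg_density \<epsilon> (W 0) (?F 0) (?F' 0) s = 0" if "s \<in> W 0" "s \<notin> V"
    proof -
      have "7 * \<eta> \<le> norm (F (0, s))"
        using m3(2)[of "(0, s)"] \<eta> WC[of 0 s] that by (intro Fbig) auto
      then show ?thesis using \<eta>(1) \<epsilon>(1) by (intro deg_density_eq_0 big) auto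
    qed
    then show "deg_density \<epsilon> (W 0) (?F 0) (?F' 0) s = deg_density \<epsilon> V (?F 0) (?F' 0) s"
      using VW by (auto simp: deg_density_def)
  qed
  then have "(deg_density \<epsilon> V (?F 0) (?F' 0) has_integral 0) UNIV"
    using integrable_integral[OF integrable[of 0]] J0 by (simp add: J_def)
  \<comment> \<open>The segment from \<open>F (0, _)\<close> to \<open>g\<close> stays within
    \<open>\<eta>\<close> of the one from \<open>H 0\<close> to \<open>g\<close>, whose norm off
    \<open>KV\<close> is at least \<open>8 * \<eta>\<close>.\<close>
  moreover have "((\<lambda>x. deg_density \<epsilon> V (?F 0) (?F' 0) x - deg_density \<epsilon> V g g' x) has_integral 0) UNIV"
  proof (rule deg_density_homotopy[OF slice g(1) V(1) compKV KV \<epsilon>(1)])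
    fix x t assume x: "x \<in> V - KV" and t: "(0::real) \<le> t" "t \<le> 1"
    have xc: "x \<in> closure V" using x closure_subset by blast
    then have "8 * \<eta> \<le> D x" using x \<eta>(5) by (simp add: KV_def)
    also have "\<dots> \<le> norm (H 0 x - t *\<^sub>R (H 0 x - g x))" using conv t by blast
    finally have 8: "8 * \<eta> \<le> norm (H 0 x - t *\<^sub>R (H 0 x - g x))" .
    have "(0, x) \<in> C" using inf0[OF xc] r(1) by (simp add: C_def)
    from F(2)[OF this] have "norm (H 0 x - F (0, x)) < \<eta>" by (simp add: Hc_def)
    moreover have "norm ((1 - t) *\<^sub>R (H 0 x - F (0, x))) \<le> norm (H 0 x - F (0, x))"
      using t by (simp add: mult_left_le_one_le)
    moreover have "norm (H 0 x - t *\<^sub>R (H 0 x - g x)) - norm ((1 - t) *\<^sub>R (H 0 x - F (0, x)))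
        \<le> norm ((H 0 x - t *\<^sub>R (H 0 x - g x)) - (1 - t) *\<^sub>R (H 0 x - F (0, x)))"
      by (rule norm_triangle_ineq2)
    ultimately have le: "\<eta> \<le> norm ((H 0 x - t *\<^sub>R (H 0 x - g x)) - (1 - t) *\<^sub>R (H 0 x - F (0, x)))"
      using 8 \<eta>(1) by linarith
    have eq: "(1 - t) *\<^sub>R F (0, x) + t *\<^sub>R g x
        = (H 0 x - t *\<^sub>R (H 0 x - g x)) - (1 - t) *\<^sub>R (H 0 x - F (0, x))"
      by (simp add: algebra_simps)
    show "\<exists>i. \<epsilon> \<le> \<bar>((1 - t) *\<^sub>R F (0, x) + t *\<^sub>R g x) $ i\<bar>"
      unfolding eq using le by (rule big)
  qed
  ultimately have "((\<lambda>x. deg_density \<epsilon> V (?F 0) (?F' 0) x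
      - (deg_density \<epsilon> V (?F 0) (?F' 0) x - deg_density \<epsilon> V g g' x)) has_integral 0 - 0) UNIV"
    by (rule has_integral_diff)
  then have "(deg_density \<epsilon> V g g' has_integral 0) UNIV" by simp
  then have "integral (UNIV :: (real ^ 'n::_) set) (bump \<epsilon>) *
      (\<Sum>x | x \<in> V \<and> g x = 0. sgn (det (matrix (g' x)))) = 0"
    using \<epsilon>0(2)[OF \<epsilon>(1,2)] has_integral_unique by blast
  then show ?thesis using bump_integral(2)[OF \<epsilon>(1), where 'n = 'n] by simp
qed simp

section \<open>Index types without a well-order\<close>

text \<open>
  The change of variables theorem and Sard's theorem of the library need a well-ordered index type.
\<close>

typedef 'a ordered_copy = "{..CARD('a) - 1}"
  by auto

instantiation ordered_copy :: (type) linorder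
begin

definition less_eq_ordered_copy :: "'a ordered_copy \<Rightarrow> 'a ordered_copy \<Rightarrow> bool" where
  "x \<le> y \<longleftrightarrow> Rep_ordered_copy x \<le> Rep_ordered_copy y"

definition less_ordered_copy :: "'a ordered_copy \<Rightarrow> 'a ordered_copy \<Rightarrow> bool" where
  "x < y \<longleftrightarrow> Rep_ordered_copy x < Rep_ordered_copy y"

instance
  by standard (auto simp: less_eq_ordered_copy_def less_ordered_copy_def Rep_ordered_copy_inject)

end

instance ordered_copy :: (type) wellorder
proof
  fix P :: "'a ordered_copy \<Rightarrow> bool" and a
  assume step: "\<And>x. (\<And>y. y < x \<Longrightarrow> P y) \<Longrightarrow> P x"
  show "P a"
  proof (induction a rule: measure_induct_rule[of Rep_ordered_copy])
    case (less x)
    then show ?case by (rule step) (simp add: less_ordered_copy_def)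
  qed
qed

instance ordered_copy :: (type) finite
proof
  show "finite (UNIV :: 'a ordered_copy set)"
    by (metis finite_atMost finite_imageI type_definition.Abs_image type_definition_ordered_copy)
qed

text \<open>\<open>{..k}\<close> has \<open>k + 1\<close> elements, hence the shift by 1 in the
  carrier; it gives back \<open>CARD('a)\<close> because a finite type has positive
  cardinality.\<close>

lemma card_ordered_copy: "CARD('a ordered_copy) = CARD('a::finite)"
proof -
  have "CARD('a ordered_copy) = card {..CARD('a) - 1}"
    using type_definition.card[OF type_definition_ordered_copy] .
  then show ?thesis using zero_less_card_finite[where 'a = 'a] by simp
qed

lemma bij_ordered_copy_exists: "\<exists>\<beta> :: 'a::finite \<Rightarrow> 'a ordered_copy. bij \<beta>"
  using finite_same_card_bij[of "UNIV :: 'a set" "UNIV :: 'a ordered_copy set"]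
  by (simp add: card_ordered_copy)

text \<open>For bijective \<open>\<beta>\<close> a relabelling of coordinates, hence a linear
  isometry; \<open>inv \<beta>\<close> occurs because coordinates pull back. Conjugation with it
  transfers results between index types.\<close>

definition reindex :: "('a \<Rightarrow> 'b) \<Rightarrow> real ^ 'a::finite \<Rightarrow> real ^ 'b::finite" where
  "reindex \<beta> s = (\<chi> i. s $ inv \<beta> i)"

lemma bounded_linear_reindex: "bounded_linear (reindex \<beta>)"
  by (intro linear_conv_bounded_linear[THEN iffD1] linearI) (auto simp: reindex_def vec_eq_iff)

lemma reindex_diff: "reindex \<beta> (x - y) = reindex \<beta> x - reindex \<beta> y"
  by (simp add: reindex_def vec_eq_iff)

lemma reindex_reindex_inv:
  assumes "bij \<beta>"
  shows "reindex (inv \<beta>) (reindex \<beta> s) = s" "reindex \<beta> (reindex (inv \<beta>) t) = t"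
  using assms by (simp_all add: reindex_def vec_eq_iff inv_inv_eq bij_is_inj bij_is_surj surj_f_inv_f)

lemma norm_reindex:
  fixes \<beta> :: "'a::finite \<Rightarrow> 'b::finite"
  assumes "bij \<beta>"
  shows "norm (reindex \<beta> s) = norm s"
proof -
  have "(\<Sum>i\<in>UNIV. (s $ inv \<beta> i)\<^sup>2) = (\<Sum>j\<in>UNIV. (s $ j)\<^sup>2)"
    using assms by (intro sum.reindex_bij_betw bij_betw_inv_into) (simp add: bij_imp_bij_inv)
  then show ?thesis by (simp add: norm_vec_def L2_set_def reindex_def)
qed

lemma reindex_eq_0_iff: "bij \<beta> \<Longrightarrow> reindex \<beta> s = 0 \<longleftrightarrow> s = 0"
  by (metis norm_eq_zero norm_reindex)

text \<open>Conjugation with \<open>\<beta>\<close> matches the permutations of the two index types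
  and preserves signs, so the Leibniz sums agree term by term.\<close>

lemma det_reindex:
  fixes \<beta> :: "'a::finite \<Rightarrow> 'b::finite" and B :: "real ^ 'a ^ 'a"
  assumes "bij \<beta>"
  shows "det ((\<chi> i j. B $ inv \<beta> i $ inv \<beta> j) :: real ^ 'b ^ 'b) = det B"
proof -
  have inv: "bij (inv \<beta>)" using assms by (rule bij_imp_bij_inv)
  have b: "inv \<beta> (\<beta> x) = x" "\<beta> (inv \<beta> y) = y" for x y
    using assms by (simp_all add: bij_is_inj bij_is_surj surj_f_inv_f)
  have perm: "bij (\<beta> \<circ> p \<circ> inv \<beta>)" if "bij p" for p
    using assms inv that by (intro bij_comp)
  have sgn: "sign (\<beta> \<circ> p \<circ> inv \<beta>) = sign p" if "p permutes UNIV" for p :: "'a \<Rightarrow> 'a"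
  proof -
    have "map_permutation UNIV \<beta> p = \<beta> \<circ> p \<circ> inv \<beta>"
      using assms by (simp add: map_permutation_def restrict_id_def bij_is_surj fun_eq_iff)
    then show ?thesis
      using sign_map_permutation[of \<beta> UNIV p] that assms by (simp add: bij_is_inj)
  qed
  have "det B = (\<Sum>p | p permutes UNIV. of_int (sign p) * (\<Prod>i\<in>UNIV. B $ i $ p i))"
    by (simp add: det_def)
  also have "\<dots> = (\<Sum>q | q permutes (UNIV :: 'b set).
      of_int (sign q) * (\<Prod>i\<in>UNIV. B $ inv \<beta> i $ inv \<beta> (q i)))"
  proof (rule sum.reindex_bij_witness[of _ "\<lambda>q. inv \<beta> \<circ> q \<circ> \<beta>" "\<lambda>p. \<beta> \<circ> p \<circ> inv \<beta>"])
    fix p :: "'a \<Rightarrow> 'a" assume p: "p \<in> {p. p permutes UNIV}"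
    show "inv \<beta> \<circ> (\<beta> \<circ> p \<circ> inv \<beta>) \<circ> \<beta> = p" by (simp add: fun_eq_iff b)
    show "\<beta> \<circ> p \<circ> inv \<beta> \<in> {p. p permutes UNIV}" using p perm by (simp add: permutes_univ bij_iff)
    have "(\<Prod>i\<in>UNIV. B $ inv \<beta> i $ inv \<beta> ((\<beta> \<circ> p \<circ> inv \<beta>) i)) = (\<Prod>i\<in>UNIV. B $ inv \<beta> i $ p (inv \<beta> i))"
      by (simp add: b)
    also have "\<dots> = (\<Prod>i\<in>UNIV. B $ i $ p i)" using inv by (rule prod.reindex_bij_betw)
    finally show "of_int (sign (\<beta> \<circ> p \<circ> inv \<beta>)) * (\<Prod>i\<in>UNIV. B $ inv \<beta> i $ inv \<beta> ((\<beta> \<circ> p \<circ> inv \<beta>) i))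
        = of_int (sign p) * (\<Prod>i\<in>UNIV. B $ i $ p i)"
      using p sgn by simp
  next
    fix q :: "'b \<Rightarrow> 'b" assume q: "q \<in> {p. p permutes UNIV}"
    show "\<beta> \<circ> (inv \<beta> \<circ> q \<circ> \<beta>) \<circ> inv \<beta> = q" by (simp add: fun_eq_iff b)
    have "bij (inv \<beta> \<circ> q \<circ> \<beta>)"
      using q assms inv by (intro bij_comp) (simp_all add: permutes_univ bij_iff)
    then show "inv \<beta> \<circ> q \<circ> \<beta> \<in> {p. p permutes UNIV}" by (simp add: permutes_univ bij_iff)
  qed
  also have "\<dots> = det ((\<chi> i j. B $ inv \<beta> i $ inv \<beta> j) :: real ^ 'b ^ 'b)"
    by (simp add: det_def)
  finally show ?thesis by simp
qed

lemma det_matrix_reindex: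
  fixes \<beta> :: "'a::finite \<Rightarrow> 'b::finite" and A :: "real ^ 'a \<Rightarrow> real ^ 'a"
  assumes "bij \<beta>"
  shows "det (matrix (\<lambda>v. reindex \<beta> (A (reindex (inv \<beta>) v)))) = det (matrix A)"
proof -
  have "reindex (inv \<beta>) (axis j 1) = axis (inv \<beta> j) 1" for j
    using assms by (auto simp: reindex_def vec_eq_iff axis_def inv_inv_eq bij_is_inj bij_is_surj surj_f_inv_f)
  then have "matrix (\<lambda>v. reindex \<beta> (A (reindex (inv \<beta>) v))) = (\<chi> i j. matrix A $ inv \<beta> i $ inv \<beta> j)"
    by (simp add: matrix_def reindex_def vec_eq_iff)
  then show ?thesis using det_reindex[OF assms] by simp
qed

lemma C1_der_reindex:
  fixes \<beta> :: "'a::finite \<Rightarrow> 'b::finite"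
  assumes F: "C1_der W F F'" and \<beta>: "bij \<beta>"
  shows "C1_der (reindex (inv \<beta>) -` W) (\<lambda>y. reindex \<beta> (F (reindex (inv \<beta>) y)))
    (\<lambda>y v. reindex \<beta> (F' (reindex (inv \<beta>) y) (reindex (inv \<beta>) v)))"
  unfolding C1_der_def
proof (intro conjI ballI allI)
  fix y assume "y \<in> reindex (inv \<beta>) -` W"
  then have "((\<lambda>y. F (reindex (inv \<beta>) y)) has_derivative (\<lambda>v. F' (reindex (inv \<beta>) y) (reindex (inv \<beta>) v))) (at y)"
    by (intro has_derivative_compose[OF bounded_linear_imp_has_derivative[OF bounded_linear_reindex]
          C1_derD(1)[OF F]]) simp
  then show "((\<lambda>y. reindex \<beta> (F (reindex (inv \<beta>) y))) has_derivative
      (\<lambda>v. reindex \<beta> (F' (reindex (inv \<beta>) y) (reindex (inv \<beta>) v)))) (at y)"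
    by (rule bounded_linear.has_derivative[OF bounded_linear_reindex])
next
  fix v
  have "continuous_on W (\<lambda>x. F' x (reindex (inv \<beta>) v))" using F by (auto simp: C1_der_def)
  then have "continuous_on (reindex (inv \<beta>) -` W) (\<lambda>y. F' (reindex (inv \<beta>) y) (reindex (inv \<beta>) v))"
    by (rule continuous_on_compose2)
       (auto intro!: linear_continuous_on bounded_linear_reindex)
  then show "continuous_on (reindex (inv \<beta>) -` W)
      (\<lambda>y. reindex \<beta> (F' (reindex (inv \<beta>) y) (reindex (inv \<beta>) v)))"
    by (rule bounded_linear.continuous_on[OF bounded_linear_reindex])
qed

text \<open>By Sard's theorem the critical values form a null set, which cannot contain a ball. The
  theorem is applied to the conjugate of \<open>F\<close> over the well-ordered copy of the index
  type.\<close>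

lemma regular_value_near_0:
  fixes F :: "real ^ 'n::finite \<Rightarrow> real ^ 'n"
  assumes F: "C1_der UNIV F F'" and e: "e > 0"
  obtains c where "norm c < e" "\<And>x. F x = c \<Longrightarrow> det (matrix (F' x)) \<noteq> 0"
proof -
  obtain \<beta> :: "'n \<Rightarrow> 'n ordered_copy" where \<beta>: "bij \<beta>" using bij_ordered_copy_exists by blast
  let ?G = "\<lambda>y. reindex \<beta> (F (reindex (inv \<beta>) y))"
    and ?G' = "\<lambda>y v. reindex \<beta> (F' (reindex (inv \<beta>) y) (reindex (inv \<beta>) v))"
  have G: "C1_der UNIV ?G ?G'" using C1_der_reindex[OF F \<beta>] by simp
  define S where "S = {y. det (matrix (?G' y)) = 0}"
  have "negligible (?G ` S)"
  proof (rule baby_Sard)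
    show "(?G has_derivative ?G' x) (at x within S)" for x
      using C1_derD(1)[OF G, of x] by (simp add: has_derivative_at_withinI)
    show "rank (matrix (?G' x)) < CARD('n ordered_copy)" if "x \<in> S" for x
      using that by (simp add: S_def flip: det_eq_0_rank)
  qed simp
  then have "\<not> ball 0 e \<subseteq> ?G ` S"
    using e by (meson negligible_subset open_ball open_not_negligible ball_eq_empty not_le)
  then obtain c where c: "c \<in> ball 0 e" "c \<notin> ?G ` S" by blast
  show thesis
  proof (rule that[of "reindex (inv \<beta>) c"])
    show "norm (reindex (inv \<beta>) c) < e"
      using c norm_reindex[OF bij_imp_bij_inv[OF \<beta>], of c] by simp
    fix x assume x: "F x = reindex (inv \<beta>) c"
    have "?G (reindex \<beta> x) = c" using x by (simp add: reindex_reindex_inv[OF \<beta>])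
    then have "reindex \<beta> x \<notin> S" using c by auto
    then show "det (matrix (F' x)) \<noteq> 0"
      using det_matrix_reindex[OF \<beta>, of "F' x"] by (simp add: S_def reindex_reindex_inv[OF \<beta>])
  qed
qed

text \<open>All data are conjugated by the linear isometry \<open>L\<close> with inverse
  \<open>M\<close>: domains, zeros and closures are carried over, while norms and Jacobian
  determinants are unchanged.\<close>

lemma sum_sgn_det_eq_0:
  fixes H :: "real \<Rightarrow> real ^ 'n::finite \<Rightarrow> real ^ 'n" and P :: "(real \<times> (real ^ 'n)) set"
  assumes hom: "null_homotopy H P V" and V: "open V" "bounded V"
    and g: "C1_der V g g'" "continuous_on (closure V) g"
    and near: "\<And>x. x \<in> frontier V \<Longrightarrow> norm (H 0 x - g x) < norm (H 0 x)"
    and reg: "\<And>x. x \<in> V \<Longrightarrow> g x = 0 \<Longrightarrow> det (matrix (g' x)) \<noteq> 0"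
  shows "(\<Sum>x | x \<in> V \<and> g x = 0. sgn (det (matrix (g' x)))) = 0"
proof -
  note P = null_homotopyD(1)[OF hom] and contH = null_homotopyD(2)[OF hom]
    and compZ = null_homotopyD(3)[OF hom] and one = null_homotopyD(4)[OF hom]
    and V0 = null_homotopyD(5)[OF hom] and VZ = null_homotopyD(6)[OF hom]
  obtain \<beta> :: "'n \<Rightarrow> 'n ordered_copy" where \<beta>: "bij \<beta>" using bij_ordered_copy_exists by blast
  define L where "L = (reindex \<beta> :: real ^ 'n \<Rightarrow> _)"
  define M where "M = (reindex (inv \<beta>) :: _ \<Rightarrow> real ^ 'n)"
  have M_L [simp]: "M (L s) = s" and L_M [simp]: "L (M t) = t" for s t
    unfolding L_def M_def by (simp_all add: reindex_reindex_inv[OF \<beta>])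
  have contL: "continuous_on S L" and contM: "continuous_on T M" for S T
    unfolding L_def M_def by (simp_all add: linear_continuous_on bounded_linear_reindex)
  have L0 [simp]: "L s = 0 \<longleftrightarrow> s = 0" for s by (simp add: L_def reindex_eq_0_iff[OF \<beta>])
  have Mimg: "M -` S = L ` S" for S by (auto simp: image_iff) (metis L_M)
  let ?M2 = "\<lambda>x. (fst x, M (snd x))" and ?L2 = "\<lambda>x. (fst x, L (snd x))"
  have contM2: "continuous_on S ?M2" and contL2: "continuous_on T ?L2" for S T
    by (auto intro!: continuous_intros continuous_on_compose2[OF contM] continuous_on_compose2[OF contL])
  have clos: "closure (M -` V) = M -` closure V"
  proof -
    have "linear L" "inj L"
      unfolding L_def using bounded_linear_reindex bounded_linear.linear \<beta>
      by (auto intro!: inj_on_inverseI[of _ "reindex (inv \<beta>)"] simp: reindex_reindex_inv)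
    then show ?thesis unfolding Mimg by (simp add: closure_injective_linear_image)
  qed
  have opV: "open (M -` V)" using V(1) contM by (rule open_vimage)
  have front: "M x \<in> frontier V" if "x \<in> frontier (M -` V)" for x
    using that opV V(1) by (simp add: frontier_def clos interior_open)
  define H' where "H' p y = L (H p (M y))" for p y
  define G where "G y = L (g (M y))" for y
  define G' where "G' y v = L (g' (M y) (M v))" for y v
  have "(\<Sum>y | y \<in> M -` V \<and> G y = 0. sgn (det (matrix (G' y)))) = 0"
  proof (rule sum_sgn_det_eq_0_wellorder)
    show "null_homotopy H' (?M2 -` P) (M -` V)"
      unfolding null_homotopy_def
    proof (intro conjI allI impI ballI)
      show "open (?M2 -` P)" using P contM2 by (rule open_vimage)
      have "continuous_on (?M2 -` P \<inter> {0..1} \<times> UNIV) (\<lambda>x. H (fst (?M2 x)) (snd (?M2 x)))"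
        by (rule continuous_on_compose2[OF contH contM2]) auto
      then show "continuous_on (?M2 -` P \<inter> {0..1} \<times> UNIV) (\<lambda>x. H' (fst x) (snd x))"
        unfolding H'_def by (intro continuous_on_compose2[OF contL]) auto
      have "{x \<in> ?M2 -` P \<inter> {0..1} \<times> UNIV. H' (fst x) (snd x) = 0}
          = ?L2 ` {x \<in> P \<inter> {0..1} \<times> UNIV. H (fst x) (snd x) = 0}"
      proof (intro equalityI subsetI)
        fix x assume "x \<in> {x \<in> ?M2 -` P \<inter> {0..1} \<times> UNIV. H' (fst x) (snd x) = 0}"
        then show "x \<in> ?L2 ` {x \<in> P \<inter> {0..1} \<times> UNIV. H (fst x) (snd x) = 0}"
          by (intro image_eqI[of _ _ "?M2 x"]) (auto simp: H'_def)
      qed (auto simp: H'_def)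
      then show "compact {x \<in> ?M2 -` P \<inter> {0..1} \<times> UNIV. H' (fst x) (snd x) = 0}"
        using compact_continuous_image[OF contL2 compZ] by simp
      show "H' 1 s \<noteq> 0" if "(1, s) \<in> ?M2 -` P" for s using one that by (auto simp: H'_def)
      show "(0, s) \<in> ?M2 -` P" if "s \<in> closure (M -` V)" for s using V0 that by (simp add: clos)
      show "s \<in> M -` V" if "(0, s) \<in> ?M2 -` P" "H' 0 s = 0" for s using VZ that by (auto simp: H'_def)
    qed
    show "open (M -` V)" by (rule opV)
    show "bounded (M -` V)"
      unfolding Mimg L_def using V(2) bounded_linear_reindex by (rule bounded_linear_image)
    show "C1_der (M -` V) G G'"
      using C1_der_reindex[OF g(1) \<beta>] by (simp add: G_def[abs_def] G'_def[abs_def] L_def M_def)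
    show "continuous_on (closure (M -` V)) G"
      unfolding G_def clos
      by (intro continuous_on_compose2[OF contL] continuous_on_compose2[OF g(2)] contM) auto
    show "norm (H' 0 x - G x) < norm (H' 0 x)" if "x \<in> frontier (M -` V)" for x
      using near[OF front[OF that]] by (simp add: H'_def G_def L_def norm_reindex[OF \<beta>] flip: reindex_diff)
    show "det (matrix (G' x)) \<noteq> 0" if "x \<in> M -` V" "G x = 0" for x
      using reg[of "M x"] that det_matrix_reindex[OF \<beta>, of "g' (M x)"]
      by (simp add: G_def G'_def[abs_def] L_def[symmetric] M_def[symmetric])
  qed
  moreover have "(\<Sum>y | y \<in> M -` V \<and> G y = 0. sgn (det (matrix (G' y))))
      = (\<Sum>x | x \<in> V \<and> g x = 0. sgn (det (matrix (g' x))))"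
    by (rule sum.reindex_bij_witness[of _ L M])
       (use det_matrix_reindex[OF \<beta>] in \<open>auto simp: G_def G'_def[abs_def] L_def[symmetric] M_def[symmetric]\<close>)
  ultimately show ?thesis by simp
qed

section \<open>Vanishing of the Brouwer degree\<close>

lemma C1_on_imp_C1_der:
  assumes "C1_on V g"
  shows "C1_der V g (\<lambda>x. frechet_derivative g (at x))"
  unfolding C1_der_def
proof (intro conjI ballI allI)
  show der: "(g has_derivative frechet_derivative g (at x)) (at x)" if "x \<in> V" for x
    using assms that frechet_derivative_works by (auto simp: C1_on_def)
  fix v
  have "continuous_on V (\<lambda>x. jacobian g (at x) *v v)"
    using assms unfolding C1_on_def matrix_vector_mult_def by (auto intro!: continuous_intros)
  then show "continuous_on V (\<lambda>x. frechet_derivative g (at x) v)"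
    by (rule continuous_on_eq)
       (use der has_derivative_linear in \<open>fastforce simp: jacobian_def matrix_works\<close>)
qed

lemma C1_der_imp_C1_on:
  assumes "C1_der V g g'"
  shows "C1_on V g" and "\<And>x. x \<in> V \<Longrightarrow> jacobian g (at x) = matrix (g' x)"
proof -
  show j: "jacobian g (at x) = matrix (g' x)" if "x \<in> V" for x
    using frechet_derivative_at[OF C1_derD(1)[OF assms that]] by (simp add: jacobian_def)
  have "continuous_on V (\<lambda>x. matrix (g' x))"
    using assms by (auto simp: matrix_def C1_der_def intro!: continuous_intros)
  then have "continuous_on V (\<lambda>x. jacobian g (at x))"
    by (rule continuous_on_eq) (simp add: j)
  then show "C1_on V g"
    using C1_derD(1)[OF assms] by (auto simp: C1_on_def differentiable_def)
qed

lemma open_bounded_between: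
  fixes K U :: "'a::euclidean_space set"
  assumes K: "compact K" and U: "open U" "K \<subseteq> U"
  obtains V where "open V" "bounded V" "K \<subseteq> V" "closure V \<subseteq> U"
proof (cases "K = {}")
  case True
  then show thesis by (intro that[of "{}"]) auto
next
  case False
  obtain e where e: "e > 0" "(\<Union>x\<in>K. cball x e) \<subseteq> U"
    using compact_subset_open_imp_cball_epsilon_subset[OF K U] by auto
  let ?V = "{x. infdist x K < e}" and ?C = "{x. infdist x K \<le> e}"
  have C: "compact ?C" using compact_infdist_le[OF False K e(1)] .
  have sub: "?C \<subseteq> U" using infdist_le_imp_mem[OF K False e(2)] by blast
  have VC: "closure ?V \<subseteq> ?C" using C by (intro closure_minimal compact_imp_closed) auto
  show thesis
  proof (rule that[of ?V])
    show "open ?V" by (intro open_Collect_less continuous_intros)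
    show "bounded ?V" using compact_imp_bounded[OF C] by (rule bounded_subset) auto
    show "K \<subseteq> ?V" using e(1) by auto
  qed (use sub VC in auto)
qed

text \<open>Both definite descriptions are evaluated directly. An admissible \<open>g\<close>
  exists, by Weierstrass approximation and a shift to a regular value, and the null homotopy gives
  every admissible \<open>g\<close> the sum 0. Hence 0 is the unique value for each
  \<open>V\<close>, and then for \<open>U\<close>.\<close>

lemma brouwer_degree_ext_eq_0:
  fixes f :: "real ^ 'k::finite \<Rightarrow> real ^ 'k"
  assumes U: "open U" and comp: "compact (f -` {0} \<inter> U)"
    and homotopy: "\<And>V. open V \<Longrightarrow> bounded V \<Longrightarrow> f -` {0} \<inter> U \<subseteq> V \<Longrightarrow> closure V \<subseteq> U \<Longrightarrow>
      \<exists>H P. null_homotopy H P V \<and> (\<forall>s\<in>closure V. H 0 s = f s)"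
  shows "brouwer_degree_ext f U 0 = 0"
proof -
  have deg: "brouwer_degree f V 0 = 0"
    if V: "open V" "bounded V" "f -` {0} \<inter> U \<subseteq> V" "closure V \<subseteq> U" for V
  proof -
    obtain H P where HP: "null_homotopy H P V" and H0: "\<And>s. s \<in> closure V \<Longrightarrow> H 0 s = f s"
      using homotopy[OF V] by blast
    have frontV: "x \<in> closure V" if "x \<in> frontier V" for x using that by (simp add: frontier_def)
    have sum0: "(\<Sum>x | x \<in> V \<and> g x = 0. sgn (det (jacobian g (at x)))) = 0"
      if g: "C1_on V g" "continuous_on (closure V) g"
        "\<forall>x\<in>closure V. dist (f x) (g x) < infdist 0 (f ` frontier V)"
        "\<forall>x\<in>V. g x = 0 \<longrightarrow> det (jacobian g (at x)) \<noteq> 0" for g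
    proof -
      have near: "norm (H 0 x - g x) < norm (H 0 x)" if x: "x \<in> frontier V" for x
      proof -
        have "dist (f x) (g x) < infdist 0 (f ` frontier V)" using g(3) frontV[OF x] by blast
        also have "\<dots> \<le> dist 0 (f x)" using x by (intro infdist_le) auto
        finally show ?thesis using H0[OF frontV[OF x]] by (simp add: dist_norm)
      qed
      show ?thesis
        unfolding jacobian_def
        by (rule sum_sgn_det_eq_0[OF HP V(1,2) C1_on_imp_C1_der[OF g(1)] g(2) near])
           (use g(4) in \<open>auto simp: jacobian_def\<close>)
    qed
    have "\<exists>g. C1_on V g \<and> continuous_on (closure V) g \<and>
        (\<forall>x\<in>closure V. dist (f x) (g x) < infdist 0 (f ` frontier V)) \<and>
        (\<forall>x\<in>V. g x = 0 \<longrightarrow> det (jacobian g (at x)) \<noteq> 0)"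
    proof (cases "V = {}")
      \<comment> \<open>For empty \<open>V\<close> the distance to the frontier is 0 by convention,
        but the closeness condition is vacuous.\<close>
      case True
      then show ?thesis by (intro exI[of _ "\<lambda>x. x"]) (auto simp: C1_on_def)
    next
      case False
      define \<rho> where "\<rho> = infdist 0 (f ` frontier V)"
      have "continuous_on (closure V) (\<lambda>s. (0 :: real, s))" by (intro continuous_intros)
      moreover have "(\<lambda>s. (0 :: real, s)) ` closure V \<subseteq> P \<inter> {0..1} \<times> UNIV"
        using null_homotopyD(5)[OF HP] by auto
      ultimately have "continuous_on (closure V) (\<lambda>s. H (fst (0 :: real, s)) (snd (0 :: real, s)))"
        by (rule continuous_on_compose2[OF null_homotopyD(2)[OF HP]])
      then have cV: "continuous_on (closure V) f"
        by (rule continuous_on_eq) (simp add: H0)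
      \<comment> \<open>A nonempty bounded open set has a frontier, so \<open>\<rho>\<close> is a
        genuine distance. It is positive, since a zero on the frontier would lie in
        \<open>U\<close>, hence in the open set \<open>V\<close>.\<close>
      have "frontier V \<noteq> {}" using False V(2) frontier_eq_empty not_bounded_UNIV by blast
      moreover have "compact (f ` frontier V)"
        using V(2) compact_frontier_bounded frontV
        by (intro compact_continuous_image continuous_on_subset[OF cV]) auto
      moreover have "0 \<notin> f ` frontier V"
      proof
        assume "0 \<in> f ` frontier V"
        then obtain x where x: "x \<in> frontier V" "f x = 0" by auto
        then have "x \<in> V" using V(3,4) frontV by auto
        then show False using x V(1) by (simp add: frontier_def interior_open)
      qed
      ultimately have \<rho>: "\<rho> > 0"
        unfolding \<rho>_def by (intro infdist_pos_not_in_closed compact_imp_closed) auto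
      have compV: "compact (closure V)" using V(2) by (simp add: compact_closure)
      \<comment> \<open>Half of \<open>\<rho>\<close> is spent on the polynomial, half on the shift
        by the regular value \<open>c\<close>.\<close>
      obtain p where p: "polynomial_function p" "\<And>x. x \<in> closure V \<Longrightarrow> norm (f x - p x) < \<rho>/2"
        using Stone_Weierstrass_polynomial_function[OF compV cV, of "\<rho>/2"] \<rho> by auto
      obtain p' where p': "C1_der UNIV p p'" using polynomial_function_C1_der[OF p(1)] .
      obtain c where c: "norm c < \<rho>/2" "\<And>x. p x = c \<Longrightarrow> det (matrix (p' x)) \<noteq> 0"
        using regular_value_near_0[OF p', of "\<rho>/2"] \<rho> by auto
      have g: "C1_der V (\<lambda>x. p x - c) p'"
        using C1_der_diff[OF C1_der_subset[OF p'] C1_der_const, of V c] by simp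
      have "dist (f x) (p x - c) < \<rho>" if "x \<in> closure V" for x
        using p(2)[OF that] c(1) norm_triangle_ineq[of "f x - p x" c] by (simp add: dist_norm algebra_simps)
      moreover have "continuous_on (closure V) (\<lambda>x. p x - c)"
        using C1_der_imp_continuous_on[OF C1_der_subset[OF p']] by (auto intro!: continuous_intros)
      ultimately show ?thesis
        using C1_der_imp_C1_on[OF g] c(2) by (intro exI[of _ "\<lambda>x. p x - c"]) (auto simp: \<rho>_def)
    qed
    then obtain g where g: "C1_on V g" "continuous_on (closure V) g"
        "\<forall>x\<in>closure V. dist (f x) (g x) < infdist 0 (f ` frontier V)"
        "\<forall>x\<in>V. g x = 0 \<longrightarrow> det (jacobian g (at x)) \<noteq> 0" by blast
    show ?thesis
      unfolding brouwer_degree_def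
    proof (rule the_equality)
      show "\<exists>g. C1_on V g \<and> continuous_on (closure V) g \<and>
          (\<forall>x\<in>closure V. dist (f x) (g x) < infdist 0 (f ` frontier V)) \<and>
          (\<forall>x\<in>V. g x = 0 \<longrightarrow> det (jacobian g (at x)) \<noteq> 0) \<and>
          real_of_int 0 = (\<Sum>x | x \<in> V \<and> g x = 0. sgn (det (jacobian g (at x))))"
        using g sum0[OF g] by auto
    next
      fix d
      assume "\<exists>g. C1_on V g \<and> continuous_on (closure V) g \<and>
          (\<forall>x\<in>closure V. dist (f x) (g x) < infdist 0 (f ` frontier V)) \<and>
          (\<forall>x\<in>V. g x = 0 \<longrightarrow> det (jacobian g (at x)) \<noteq> 0) \<and>
          real_of_int d = (\<Sum>x | x \<in> V \<and> g x = 0. sgn (det (jacobian g (at x))))"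
      then obtain g where "C1_on V g" "continuous_on (closure V) g"
          "\<forall>x\<in>closure V. dist (f x) (g x) < infdist 0 (f ` frontier V)"
          "\<forall>x\<in>V. g x = 0 \<longrightarrow> det (jacobian g (at x)) \<noteq> 0"
        and d: "real_of_int d = (\<Sum>x | x \<in> V \<and> g x = 0. sgn (det (jacobian g (at x))))" by blast
      then show "d = 0" using sum0[of g] by simp
    qed
  qed
  obtain V where V: "open V" "bounded V" "f -` {0} \<inter> U \<subseteq> V" "closure V \<subseteq> U"
    using open_bounded_between[OF comp U] by blast
  show ?thesis
    unfolding brouwer_degree_ext_def
  proof (rule the_equality)
    show "\<exists>V. open V \<and> bounded V \<and> f -` {0} \<inter> U \<subseteq> V \<and> closure V \<subseteq> U \<and> 0 = brouwer_degree f V 0"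
      using V deg[OF V] by auto
  qed (use deg in auto)
qed

section \<open>Tonelli's approximation scheme\<close>

text \<open>The bound is uniform in the state and continuity holds at every time: \<open>N\<close>
  is meant to be a field already truncated and reset on a null set. \<open>D p\<close> abstracts the
  diagonal scaling, and the constant 2 is the Lipschitz constant of \<open>2 * p\<close> and
  \<open>2 * p - 1\<close>.\<close>

locale tonelli_scheme =
  fixes T :: real and N :: "real \<Rightarrow> 'a::euclidean_space \<Rightarrow> 'a" and \<beta> :: "real \<Rightarrow> real"
    and D :: "real \<Rightarrow> 'a \<Rightarrow> 'a"
  assumes T: "T > 0"
    and meas: "\<And>s. (\<lambda>t. N t s) \<in> borel_measurable (lebesgue_on {0..T})"
    and cont: "\<And>t. t \<in> {0..T} \<Longrightarrow> continuous_on UNIV (N t)"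
    and integrable_bound: "integrable (lebesgue_on {0..T}) \<beta>"
    and bound: "\<And>t s. t \<in> {0..T} \<Longrightarrow> norm (N t s) \<le> \<beta> t"
    and D_linear: "\<And>p. linear (D p)"
    and D_norm: "\<And>p v. norm (D p v) \<le> norm v"
    and D_lipschitz: "\<And>p q v. norm (D p v - D q v) \<le> 2 * \<bar>p - q\<bar> * norm v"
begin

text \<open>\<open>N\<close> is measurable in \<open>t\<close> only for a fixed state, so the path
  is sampled on a grid: then countably many states occur, and continuity in the state carries
  measurability to the limit.\<close>

lemma measurable_superposition:
  assumes z: "continuous_on {0..T} z"
  shows "(\<lambda>t. N t (z t)) \<in> borel_measurable (lebesgue_on {0..T})"
proof (rule borel_measurable_LIMSEQ_metric)
  \<comment> \<open>Rounding \<open>t\<close> down to the grid of width \<open>T / (k + 1)\<close>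
    keeps the sample point in \<open>{0..T}\<close>.\<close>
  define d where "d k t = real_of_int \<lfloor>real (Suc k) * t / T\<rfloor> * T / real (Suc k)" for k t
  show "(\<lambda>t. N t (z (d k t))) \<in> borel_measurable (lebesgue_on {0..T})" for k
  proof -
    have "(\<lambda>t. (\<lambda>i t. N t (z (real_of_int i * T / real (Suc k)))) \<lfloor>real (Suc k) * t / T\<rfloor> t)
        \<in> borel_measurable (lebesgue_on {0..T})"
    proof (rule measurable_compose_countable[where f = "\<lambda>i t. N t (z (real_of_int i * T / real (Suc k)))"])
      show "(\<lambda>t. N t (z (real_of_int i * T / real (Suc k)))) \<in> borel_measurable (lebesgue_on {0..T})" for i
        by (rule meas)
      have "(\<lambda>t. real (Suc k) * t / T) \<in> borel_measurable (lebesgue_on {0..T})"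
        by (intro measurable_restrict_space1 measurable_completion) simp
      then show "(\<lambda>t. \<lfloor>real (Suc k) * t / T\<rfloor>) \<in> lebesgue_on {0..T} \<rightarrow>\<^sub>M count_space UNIV"
        by (rule measurable_compose[OF _ measurable_real_floor])
    qed
    then show ?thesis by (simp add: d_def)
  qed
  fix t assume "t \<in> space (lebesgue_on {0..T})"
  then have t: "t \<in> {0..T}" by simp
  have d: "0 \<le> d k t" "d k t \<le> t" "t - T / real (Suc k) \<le> d k t" for k
  proof -
    define c where "c = real (Suc k)"
    define w where "w = real_of_int \<lfloor>c * t / T\<rfloor>"
    have c: "c > 0" by (simp add: c_def)
    have "0 \<le> c * t / T" using t T c by simp
    then have "0 \<le> w" by (simp add: w_def)
    have "w \<le> c * t / T" "c * t / T - 1 \<le> w" unfolding w_def by linarith+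
    then have "w * T \<le> c * t" "c * t - T \<le> w * T" using T by (simp_all add: field_simps)
    moreover have d: "d k t = w * T / c" by (simp add: d_def c_def w_def)
    ultimately show "0 \<le> d k t" "d k t \<le> t"
      unfolding d using T c \<open>0 \<le> w\<close> by (simp_all add: field_simps)
    have "(c * t - T) / c \<le> w * T / c"
      using c \<open>c * t - T \<le> w * T\<close> by (intro divide_right_mono) auto
    moreover have "(c * t - T) / c = t - T / c" using c by (simp add: field_simps)
    ultimately show "t - T / real (Suc k) \<le> d k t"
      unfolding c_def[symmetric] d by simp
  qed
  have "(\<lambda>k. d k t) \<longlonglongrightarrow> t"
  proof (rule tendsto_sandwich[where f = "\<lambda>k. t - T / real (Suc k)" and h = "\<lambda>k. t"])
    have "(\<lambda>k. t - T * inverse (real (Suc k))) \<longlonglongrightarrow> t - T * 0"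
      by (intro tendsto_intros LIMSEQ_inverse_real_of_nat)
    then show "(\<lambda>k. t - T / real (Suc k)) \<longlonglongrightarrow> t" by (simp add: divide_inverse)
  qed (use d in auto)
  then have "(\<lambda>k. z (d k t)) \<longlonglongrightarrow> z t"
    using z t d
    by (intro continuous_on_tendsto_compose[OF z]) (auto intro!: always_eventually intro: order_trans)
  then show "(\<lambda>k. N t (z (d k t))) \<longlonglongrightarrow> N t (z t)"
    by (intro continuous_on_tendsto_compose[OF cont[OF t]]) auto
qed

lemma beta_integrable: "\<beta> integrable_on {0..T}"
  using integrable_bound by (rule integrable_on_lebesgue_on) simp

lemma superposition_integrable:
  assumes z: "continuous_on {0..T} z"
  shows "integrable (lebesgue_on {0..T}) (\<lambda>t. N t (z t))" "(\<lambda>t. N t (z t)) integrable_on {0..T}"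
proof -
  show *: "integrable (lebesgue_on {0..T}) (\<lambda>t. N t (z t))"
    using integrable_bound measurable_superposition[OF z]
    by (rule Bochner_Integration.integrable_bound) (auto intro!: AE_I2 order_trans[OF bound])
  show "(\<lambda>t. N t (z t)) integrable_on {0..T}"
    using * by (rule integrable_on_lebesgue_on) simp
qed

lemma superposition_integrable_sub:
  assumes "continuous_on {0..T} z" "0 \<le> u" "v \<le> T"
  shows "(\<lambda>t. N t (z t)) integrable_on {u..v}" "\<beta> integrable_on {u..v}"
  using integrable_on_subinterval[OF superposition_integrable(2)[OF assms(1)], of u v]
    integrable_on_subinterval[OF beta_integrable, of u v] assms by auto

text \<open>Its increments bound those of \<open>I z\<close> for every continuous path
  \<open>z\<close> at once; this common modulus of continuity is the source of
  equicontinuity.\<close>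

definition B :: "real \<Rightarrow> real" where "B t = integral {0..t} \<beta>"

lemma continuous_on_B: "continuous_on {0..T} B"
  unfolding B_def using beta_integrable by (rule indefinite_integral_continuous_1)

definition I :: "(real \<Rightarrow> 'a) \<Rightarrow> real \<Rightarrow> 'a" where "I z t = integral {0..t} (\<lambda>\<tau>. N \<tau> (z \<tau>))"

lemma I_0: "I z 0 = 0"
  by (simp add: I_def)

lemma I_diff:
  assumes z: "continuous_on {0..T} z" and uv: "0 \<le> u" "u \<le> v" "v \<le> T"
  shows "norm (I z v - I z u) \<le> B v - B u"
proof -
  have "I z u + integral {u..v} (\<lambda>\<tau>. N \<tau> (z \<tau>)) = I z v"
    unfolding I_def using uv by (intro Henstock_Kurzweil_Integration.integral_combine superposition_integrable_sub[OF z]) auto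
  then have eq: "I z v - I z u = integral {u..v} (\<lambda>\<tau>. N \<tau> (z \<tau>))" by (simp add: algebra_simps)
  have "B u + integral {u..v} \<beta> = B v"
    unfolding B_def using uv by (intro Henstock_Kurzweil_Integration.integral_combine superposition_integrable_sub[OF z]) auto
  moreover have "norm (integral {u..v} (\<lambda>\<tau>. N \<tau> (z \<tau>))) \<le> integral {u..v} \<beta>"
    using uv bound by (intro Henstock_Kurzweil_Integration.integral_norm_bound_integral superposition_integrable_sub[OF z]) auto
  ultimately show ?thesis by (simp add: eq)
qed

lemma B_mono:
  assumes "0 \<le> u" "u \<le> v" "v \<le> T"
  shows "B u \<le> B v"
  using I_diff[of "\<lambda>t. 0" u v] assms norm_ge_zero[of "I (\<lambda>t. 0) v - I (\<lambda>t. 0) u"] by (simp del: norm_ge_zero)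

lemma I_diff_abs:
  assumes z: "continuous_on {0..T} z" and uv: "u \<in> {0..T}" "v \<in> {0..T}"
  shows "norm (I z v - I z u) \<le> \<bar>B v - B u\<bar>"
proof (cases "u \<le> v")
  case True
  then show ?thesis using I_diff[OF z, of u v] uv by simp
next
  case False
  then show ?thesis using I_diff[OF z, of v u] uv by (simp add: norm_minus_commute)
qed

lemma I_bound:
  assumes z: "continuous_on {0..T} z" and t: "t \<in> {0..T}"
  shows "norm (I z t) \<le> B T"
  using I_diff[OF z, of 0 t] t T B_mono[of t T] by (simp add: I_0 B_def)

lemma continuous_on_I: "continuous_on {0..T} z \<Longrightarrow> continuous_on {0..T} (I z)"
  unfolding I_def by (rule indefinite_integral_continuous_1) (rule superposition_integrable)

text \<open>Dominated convergence with majorant \<open>2 * \<beta>\<close>; it is uniform in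
  \<open>t\<close> because the differences of all partial integrals are controlled by one integral
  over \<open>{0..T}\<close>.\<close>

lemma superposition_limit:
  assumes zk: "\<And>k. continuous_on {0..T} (zk k)" and lim: "uniform_limit {0..T} zk z sequentially"
  shows "uniform_limit {0..T} (\<lambda>k. I (zk k)) (I z) sequentially"
proof -
  have z: "continuous_on {0..T} z"
    using zk lim by (intro uniform_limit_theorem[OF _ lim]) auto
  let ?f = "\<lambda>k \<tau>. norm (N \<tau> (zk k \<tau>) - N \<tau> (z \<tau>))"
  have int: "?f k integrable_on {0..T}" for k
  proof -
    have "integrable (lebesgue_on {0..T}) (?f k)"
      using superposition_integrable(1)[OF zk] superposition_integrable(1)[OF z] by simp
    then show ?thesis by (rule integrable_on_lebesgue_on) simp
  qed
  have "(\<lambda>k. integral {0..T} (?f k)) \<longlonglongrightarrow> integral {0..T} (\<lambda>\<tau>. 0)"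
  proof (rule dominated_convergence)
    show "(\<lambda>\<tau>. 2 * \<beta> \<tau>) integrable_on {0..T}" using beta_integrable by (intro integrable_on_mult_right)
    show "norm (?f k \<tau>) \<le> 2 * \<beta> \<tau>" if "\<tau> \<in> {0..T}" for k \<tau>
      using bound[OF that, of "zk k \<tau>"] bound[OF that, of "z \<tau>"]
        norm_triangle_ineq4[of "N \<tau> (zk k \<tau>)" "N \<tau> (z \<tau>)"] by simp
    show "(\<lambda>k. ?f k \<tau>) \<longlonglongrightarrow> 0" if "\<tau> \<in> {0..T}" for \<tau>
    proof -
      have "(\<lambda>k. zk k \<tau>) \<longlonglongrightarrow> z \<tau>" using lim that by (rule tendsto_uniform_limitI)
      then have "(\<lambda>k. N \<tau> (zk k \<tau>)) \<longlonglongrightarrow> N \<tau> (z \<tau>)"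
        by (intro continuous_on_tendsto_compose[OF cont[OF that]]) auto
      then show ?thesis by (simp add: LIM_zero_iff tendsto_norm_zero_iff)
    qed
  qed (rule int)
  then have lim0: "(\<lambda>k. integral {0..T} (?f k)) \<longlonglongrightarrow> 0" by simp
  have le: "norm (I (zk k) t - I z t) \<le> integral {0..T} (?f k)" if "t \<in> {0..T}" for k t
  proof -
    have t: "t \<le> T" using that by simp
    have "I (zk k) t - I z t = integral {0..t} (\<lambda>\<tau>. N \<tau> (zk k \<tau>) - N \<tau> (z \<tau>))"
      unfolding I_def
      by (intro Henstock_Kurzweil_Integration.integral_diff[symmetric]
          superposition_integrable_sub(1)[OF zk _ t] superposition_integrable_sub(1)[OF z _ t]) auto
    also have "norm \<dots> \<le> integral {0..t} (?f k)"
      by (intro Henstock_Kurzweil_Integration.integral_norm_bound_integral Henstock_Kurzweil_Integration.integrable_diff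
          superposition_integrable_sub(1)[OF zk _ t] superposition_integrable_sub(1)[OF z _ t]
          integrable_on_subinterval[OF int]) (use that in auto)
    also have "\<dots> \<le> integral {0..T} (?f k)"
      by (intro integral_subset_le integrable_on_subinterval[OF int] int) (use that in auto)
    finally show ?thesis .
  qed
  show ?thesis
  proof (rule uniform_limitI)
    fix e :: real assume "e > 0"
    then have "\<forall>\<^sub>F k in sequentially. integral {0..T} (?f k) < e"
      using lim0 by (auto intro: order_tendstoD)
    then show "\<forall>\<^sub>F k in sequentially. \<forall>t\<in>{0..T}. dist (I (zk k) t) (I z t) < e"
      by eventually_elim (auto simp: dist_norm intro: le_less_trans[OF le])
  qed
qed

lemma D_bounded_linear: "bounded_linear (D p)"
  using D_linear linear_conv_bounded_linear by blast

lemma D_0: "D p 0 = 0"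
  using D_linear by (rule linear_0)

lemma D_diff: "D p (x - y) = D p x - D p y"
  using D_linear by (rule linear_diff)

text \<open>Picard iterates of the equation with delay \<open>\<delta>\<close>. Cutting the delayed
  time off at 0 makes the solution constant on \<open>[0, \<delta>]\<close>, and iterate
  \<open>j\<close> is exact on \<open>[0, (j + 1) * \<delta>]\<close>.\<close>

primrec tonelli :: "real \<Rightarrow> nat \<Rightarrow> real \<Rightarrow> 'a \<Rightarrow> real \<Rightarrow> 'a" where
  "tonelli \<delta> 0 p s = (\<lambda>t. s)"
| "tonelli \<delta> (Suc j) p s = (\<lambda>t. s + D p (I (tonelli \<delta> j p s) (max 0 (t - \<delta>))))"

lemma continuous_on_tonelli:
  assumes "\<delta> \<ge> 0"
  shows "continuous_on {0..T} (tonelli \<delta> j p s)"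
proof (induction j)
  case (Suc j)
  have "continuous_on {0..T} (\<lambda>t. I (tonelli \<delta> j p s) (max 0 (t - \<delta>)))"
    using assms T
    by (intro continuous_on_compose2[OF continuous_on_I[OF Suc]] continuous_intros) auto
  then have "continuous_on {0..T} (\<lambda>t. D p (I (tonelli \<delta> j p s) (max 0 (t - \<delta>))))"
    by (rule bounded_linear.continuous_on[OF D_bounded_linear])
  then show ?case by (simp add: continuous_on_add)
qed simp

text \<open>The method of steps: at time \<open>t\<close> the right-hand side sees the path only up
  to \<open>t - \<delta>\<close>, where the iterates already agree.\<close>

lemma tonelli_stable:
  assumes \<delta>: "\<delta> \<ge> 0" and t: "0 \<le> t" "t \<le> real (Suc j) * \<delta>"
  shows "tonelli \<delta> (Suc j) p s t = tonelli \<delta> j p s t"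
  using t
proof (induction j arbitrary: t)
  case 0
  then show ?case by (simp add: I_0 D_0 max_def)
next
  case (Suc j)
  have "I (tonelli \<delta> (Suc j) p s) (max 0 (t - \<delta>)) = I (tonelli \<delta> j p s) (max 0 (t - \<delta>))"
    unfolding I_def
  proof (rule Henstock_Kurzweil_Integration.integral_cong)
    fix \<tau> assume "\<tau> \<in> {0..max 0 (t - \<delta>)}"
    then have "0 \<le> \<tau>" "\<tau> \<le> real (Suc j) * \<delta>"
      using Suc.prems \<delta> by (auto simp: algebra_simps max_def split: if_splits)
    then have "tonelli \<delta> (Suc j) p s \<tau> = tonelli \<delta> j p s \<tau>" by (rule Suc.IH)
    then show "N \<tau> (tonelli \<delta> (Suc j) p s \<tau>) = N \<tau> (tonelli \<delta> j p s \<tau>)" by simp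
  qed
  then show ?case by (simp only: tonelli.simps)
qed

text \<open>Continuous dependence on \<open>(p, s)\<close> passes through each of the finitely many
  iterates by \<open>superposition_limit\<close>.\<close>

lemma uniform_limit_tonelli:
  assumes \<delta>: "\<delta> \<ge> 0" and p: "pk \<longlonglongrightarrow> p" and s: "sk \<longlonglongrightarrow> s"
  shows "uniform_limit {0..T} (\<lambda>k. tonelli \<delta> j (pk k) (sk k)) (tonelli \<delta> j p s) sequentially"
proof (induction j)
  case 0
  show ?case
  proof (rule uniform_limitI)
    fix e :: real assume "e > 0"
    then have "\<forall>\<^sub>F k in sequentially. dist (sk k) s < e" using s by (rule tendstoD[rotated])
    then show "\<forall>\<^sub>F k in sequentially. \<forall>t\<in>{0..T}. dist (tonelli \<delta> 0 (pk k) (sk k) t) (tonelli \<delta> 0 p s t) < e"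
      by eventually_elim simp
  qed
next
  case (Suc j)
  let ?zk = "\<lambda>k. tonelli \<delta> j (pk k) (sk k)" and ?z = "tonelli \<delta> j p s"
  have z: "continuous_on {0..T} ?z" by (rule continuous_on_tonelli[OF \<delta>])
  have lim: "uniform_limit {0..T} (\<lambda>k. I (?zk k)) (I ?z) sequentially"
    by (rule superposition_limit[OF continuous_on_tonelli[OF \<delta>] Suc])
  show ?case
  proof (rule uniform_limitI)
    fix e :: real assume e: "e > 0"
    have "\<forall>\<^sub>F k in sequentially. dist (sk k) s < e/3" using s e by (intro tendstoD) auto
    moreover have "\<forall>\<^sub>F k in sequentially. \<forall>t\<in>{0..T}. dist (I (?zk k) t) (I ?z t) < e/3"
      using lim e by (intro uniform_limitD) auto
    moreover have "\<forall>\<^sub>F k in sequentially. 2 * \<bar>pk k - p\<bar> * B T < e/3"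
    proof (rule order_tendstoD)
      have "(\<lambda>k. 2 * \<bar>pk k - p\<bar> * B T) \<longlonglongrightarrow> 2 * \<bar>p - p\<bar> * B T" by (intro tendsto_intros p)
      then show "(\<lambda>k. 2 * \<bar>pk k - p\<bar> * B T) \<longlonglongrightarrow> 0" by simp
    qed (use e in auto)
    ultimately show "\<forall>\<^sub>F k in sequentially. \<forall>t\<in>{0..T}.
        dist (tonelli \<delta> (Suc j) (pk k) (sk k) t) (tonelli \<delta> (Suc j) p s t) < e"
    proof eventually_elim
      case (elim k)
      show ?case
      proof
        fix t assume "t \<in> {0..T}"
        then have t': "max 0 (t - \<delta>) \<in> {0..T}" using \<delta> by auto
        let ?t = "max 0 (t - \<delta>)"
        have "norm (D (pk k) (I (?zk k) ?t - I ?z ?t)) < e/3"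
          using elim(2) t' D_norm[of "pk k" "I (?zk k) ?t - I ?z ?t"] by (fastforce simp: dist_norm)
        moreover have "norm (D (pk k) (I ?z ?t) - D p (I ?z ?t)) < e/3"
        proof -
          have "norm (D (pk k) (I ?z ?t) - D p (I ?z ?t)) \<le> 2 * \<bar>pk k - p\<bar> * norm (I ?z ?t)"
            by (rule D_lipschitz)
          also have "\<dots> \<le> 2 * \<bar>pk k - p\<bar> * B T"
            using I_bound[OF z t'] by (intro mult_left_mono) auto
          finally show ?thesis using elim(3) by simp
        qed
        \<comment> \<open>The three errors come from the initial value, the path and the parameter;
          the last is uniform in \<open>t\<close> because \<open>I\<close> is bounded by
          \<open>B T\<close>.\<close>
        moreover have "tonelli \<delta> (Suc j) (pk k) (sk k) t - tonelli \<delta> (Suc j) p s t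
            = (sk k - s) + D (pk k) (I (?zk k) ?t - I ?z ?t) + (D (pk k) (I ?z ?t) - D p (I ?z ?t))"
          by (simp add: D_diff)
        then have "norm (tonelli \<delta> (Suc j) (pk k) (sk k) t - tonelli \<delta> (Suc j) p s t)
            \<le> norm (sk k - s) + norm (D (pk k) (I (?zk k) ?t - I ?z ?t))
              + norm (D (pk k) (I ?z ?t) - D p (I ?z ?t))"
          by (simp only:) (intro norm_triangle_le add_right_mono norm_triangle_ineq)
        ultimately show "dist (tonelli \<delta> (Suc j) (pk k) (sk k) t) (tonelli \<delta> (Suc j) p s t) < e"
          using elim(1) by (simp only: dist_norm)
      qed
    qed
  qed
qed

text \<open>With delay \<open>T / (k + 1)\<close>, iterate \<open>k\<close> is the first one exact
  on all of \<open>{0..T}\<close>.\<close>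

definition approx_sol :: "nat \<Rightarrow> real \<Rightarrow> 'a \<Rightarrow> real \<Rightarrow> 'a" where
  "approx_sol k = tonelli (T / real (Suc k)) k"

lemma continuous_on_approx_sol: "continuous_on {0..T} (approx_sol k p s)"
  unfolding approx_sol_def using T by (intro continuous_on_tonelli) auto

lemma approx_sol_eq:
  assumes "t \<in> {0..T}"
  shows "approx_sol k p s t = s + D p (I (approx_sol k p s) (max 0 (t - T / real (Suc k))))"
proof -
  have "tonelli (T / real (Suc k)) (Suc k) p s t = tonelli (T / real (Suc k)) k p s t"
    using assms T by (intro tonelli_stable) auto
  then show ?thesis by (simp add: approx_sol_def)
qed

lemma uniform_limit_approx_sol:
  assumes "pk \<longlonglongrightarrow> p" "sk \<longlonglongrightarrow> s"
  shows "uniform_limit {0..T} (\<lambda>k. approx_sol j (pk k) (sk k)) (approx_sol j p s) sequentially"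
  unfolding approx_sol_def using T by (intro uniform_limit_tonelli assms) auto

lemma approx_sol_zero_parameter:
  assumes "\<And>v. D p v = 0" "t \<in> {0..T}"
  shows "approx_sol k p s t = s"
  using assms approx_sol_eq by simp

text \<open>All approximate paths inherit their equicontinuity from \<open>B\<close>, so
  Arzela-Ascoli applies; the delay tends to 0, and the limit solves the equation without
  delay.\<close>

lemma approx_sol_compactness:
  assumes bdd: "\<And>k t. t \<in> {0..T} \<Longrightarrow> norm (approx_sol k (pk k) (sk k) t) \<le> R"
    and pk: "\<And>k. pk k \<in> {0..1}"
  obtains r p z where "strict_mono (r :: nat \<Rightarrow> nat)" "p \<in> {0..1}" "(pk \<circ> r) \<longlonglongrightarrow> p"
    "continuous_on {0..T} z" "uniform_limit {0..T} (\<lambda>k. approx_sol (r k) (pk (r k)) (sk (r k))) z sequentially"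
    "\<And>t. t \<in> {0..T} \<Longrightarrow> z t = z 0 + D p (I z t)"
proof -
  let ?z = "\<lambda>k. approx_sol k (pk k) (sk k)"
  let ?d = "\<lambda>k t. max 0 (t - T / real (Suc k))"
  have d: "?d k t \<in> {0..T}" if "t \<in> {0..T}" for k t
  proof -
    have "T / real (Suc k) \<ge> 0" using T by simp
    then have "t - T / real (Suc k) \<le> T" using that by (simp only: atLeastAtMost_iff) linarith
    then show ?thesis using T by simp
  qed
  obtain r1 p where r1: "strict_mono (r1 :: nat \<Rightarrow> nat)" "p \<in> {0..1}" "(pk \<circ> r1) \<longlonglongrightarrow> p"
    using pk compact_Icc[of "0 :: real" 1] unfolding compact_def by meson
  have ucB: "uniformly_continuous_on {0..T} B"
    using continuous_on_B compact_uniformly_continuous by blast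
  obtain z r2 where z: "continuous_on {0..T} z" and r2: "strict_mono (r2 :: nat \<Rightarrow> nat)"
    and lim: "\<And>e. 0 < e \<Longrightarrow> \<exists>n. \<forall>k t. n \<le> k \<and> t \<in> {0..T} \<longrightarrow> norm (?z (r1 (r2 k)) t - z t) < e"
  proof (rule Arzela_Ascoli[of "{0..T}" "\<lambda>k. ?z (r1 k)" R])
    fix t e :: real assume t: "t \<in> {0..T}" and e: "0 < e"
    obtain \<delta> where \<delta>: "\<delta> > 0" "\<And>u v. u \<in> {0..T} \<Longrightarrow> v \<in> {0..T} \<Longrightarrow> dist v u < \<delta> \<Longrightarrow> dist (B v) (B u) < e"
      using ucB e unfolding uniformly_continuous_on_def by blast
    have "norm (?z k t - ?z k u) < e" if u: "u \<in> {0..T}" and tu: "norm (t - u) < \<delta>" for k u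
    proof -
      \<comment> \<open>The initial value cancels and \<open>D\<close> does not increase norms, so
        the increment is bounded by that of \<open>B\<close> between the delayed times.\<close>
      have "?z k t - ?z k u = D (pk k) (I (?z k) (?d k t) - I (?z k) (?d k u))"
        unfolding D_diff using approx_sol_eq[OF t, of k "pk k" "sk k"] approx_sol_eq[OF u, of k "pk k" "sk k"] by simp
      then have "norm (?z k t - ?z k u) \<le> norm (I (?z k) (?d k t) - I (?z k) (?d k u))"
        using D_norm by simp
      also have "\<dots> \<le> \<bar>B (?d k t) - B (?d k u)\<bar>"
        by (rule I_diff_abs[OF continuous_on_approx_sol d[OF u] d[OF t]])
      also have "\<dots> < e"
      proof -
        have "dist (?d k t) (?d k u) < \<delta>" using tu by (auto simp: dist_real_def max_def)
        then show ?thesis using \<delta>(2)[OF d[OF u] d[OF t]] by (simp add: dist_real_def)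
      qed
      finally show ?thesis .
    qed
    then show "\<exists>\<delta>. 0 < \<delta> \<and> (\<forall>k u. u \<in> {0..T} \<and> norm (t - u) < \<delta> \<longrightarrow> norm (?z (r1 k) t - ?z (r1 k) u) < e)"
      using \<delta>(1) by blast
  qed (use bdd in \<open>auto intro: that\<close>)
  define r where "r = r1 \<circ> r2"
  have r: "strict_mono r" unfolding r_def using r1(1) r2 by (rule strict_mono_o)
  have pr: "(pk \<circ> r) \<longlonglongrightarrow> p"
    using LIMSEQ_subseq_LIMSEQ[OF r1(3) r2] by (simp add: r_def o_assoc)
  have ul: "uniform_limit {0..T} (\<lambda>k. ?z (r k)) z sequentially"
  proof (rule uniform_limitI)
    fix e :: real assume "e > 0"
    from lim[OF this] show "\<forall>\<^sub>F k in sequentially. \<forall>t\<in>{0..T}. dist (?z (r k) t) (z t) < e"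
      unfolding eventually_sequentially r_def dist_norm o_def by (meson atLeastAtMost_iff)
  qed
  have ulI: "uniform_limit {0..T} (\<lambda>k. I (?z (r k))) (I z) sequentially"
    by (rule superposition_limit[OF continuous_on_approx_sol ul])
  have eq: "z t = z 0 + D p (I z t)" if t: "t \<in> {0..T}" for t
  proof -
    have T0: "0 \<in> {0..T}" using T by simp
    have zt: "(\<lambda>k. ?z (r k) t) \<longlonglongrightarrow> z t" using ul t by (rule tendsto_uniform_limitI)
    have z0: "(\<lambda>k. ?z (r k) 0) \<longlonglongrightarrow> z 0" using ul T0 by (rule tendsto_uniform_limitI)
    have "?z k 0 = sk k" for k using approx_sol_eq[OF T0] T by (simp add: I_0 D_0)
    then have zk: "?z (r k) t - ?z (r k) 0 = D (pk (r k)) (I (?z (r k)) (?d (r k) t))" for k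
      using approx_sol_eq[OF t, of "r k"] by simp
    have "(\<lambda>k. ?d (r k) t) \<longlonglongrightarrow> max 0 (t - 0)"
    proof -
      have "(\<lambda>k. T * inverse (real (Suc k))) \<longlonglongrightarrow> T * 0"
        by (intro tendsto_intros LIMSEQ_inverse_real_of_nat)
      then have "(\<lambda>k. T / real (Suc k)) \<longlonglongrightarrow> 0" by (simp add: divide_inverse)
      then have "((\<lambda>k. T / real (Suc k)) \<circ> r) \<longlonglongrightarrow> 0" using r by (rule LIMSEQ_subseq_LIMSEQ)
      then show ?thesis unfolding o_def by (intro tendsto_intros)
    qed
    then have dt: "(\<lambda>k. ?d (r k) t) \<longlonglongrightarrow> t" using t by simp
    have Id: "(\<lambda>k. I z (?d (r k) t)) \<longlonglongrightarrow> I z t"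
      using d[OF t] t by (intro continuous_on_tendsto_compose[OF continuous_on_I[OF z] dt]) auto
    have "(\<lambda>k. I (?z (r k)) (?d (r k) t) - I z (?d (r k) t)) \<longlonglongrightarrow> 0"
    proof (rule tendstoI)
      fix e :: real assume "e > 0"
      from uniform_limitD[OF ulI this]
      show "\<forall>\<^sub>F k in sequentially. dist (I (?z (r k)) (?d (r k) t) - I z (?d (r k) t)) 0 < e"
        by eventually_elim (use d[OF t] in \<open>auto simp: dist_norm\<close>)
    qed
    from tendsto_add[OF this Id]
    have Ik: "(\<lambda>k. I (?z (r k)) (?d (r k) t)) \<longlonglongrightarrow> I z t" by simp
    \<comment> \<open>Both the operator and its argument vary: the norm bound of \<open>D\<close>
      handles the argument, the Lipschitz bound in \<open>p\<close> the operator.\<close>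
    have "(\<lambda>k. D (pk (r k)) (I (?z (r k)) (?d (r k) t))) \<longlonglongrightarrow> D p (I z t)"
    proof (rule LIM_zero_cancel, rule Lim_null_comparison)
      show "\<forall>\<^sub>F k in sequentially. norm (D (pk (r k)) (I (?z (r k)) (?d (r k) t)) - D p (I z t))
          \<le> norm (I (?z (r k)) (?d (r k) t) - I z t) + 2 * \<bar>pk (r k) - p\<bar> * norm (I z t)"
      proof (intro always_eventually allI)
        fix k
        have "D (pk (r k)) (I (?z (r k)) (?d (r k) t)) - D p (I z t)
            = D (pk (r k)) (I (?z (r k)) (?d (r k) t) - I z t) + (D (pk (r k)) (I z t) - D p (I z t))"
          by (simp add: D_diff)
        then show "norm (D (pk (r k)) (I (?z (r k)) (?d (r k) t)) - D p (I z t))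
          \<le> norm (I (?z (r k)) (?d (r k) t) - I z t) + 2 * \<bar>pk (r k) - p\<bar> * norm (I z t)"
          by (simp only:) (intro order_trans[OF norm_triangle_ineq] add_mono D_norm D_lipschitz)
      qed
      have "(\<lambda>k. norm (I (?z (r k)) (?d (r k) t) - I z t) + 2 * \<bar>pk (r k) - p\<bar> * norm (I z t))
          \<longlonglongrightarrow> norm (I z t - I z t) + 2 * \<bar>p - p\<bar> * norm (I z t)"
        using pr unfolding o_def by (intro tendsto_intros Ik)
      then show "(\<lambda>k. norm (I (?z (r k)) (?d (r k) t) - I z t) + 2 * \<bar>pk (r k) - p\<bar> * norm (I z t))
          \<longlonglongrightarrow> 0" by simp
    qed
    then have "(\<lambda>k. ?z (r k) t - ?z (r k) 0) \<longlonglongrightarrow> D p (I z t)" by (simp only: zk)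
    from LIMSEQ_unique[OF tendsto_diff[OF zt z0] this] show ?thesis by (simp add: algebra_simps)
  qed
  show thesis by (rule that[OF r r1(2) pr z ul eq])
qed

end

section \<open>Absolutely continuous solutions\<close>

lemma mem_C_space_iff:
  "x \<in> mspace (C_space T) \<longleftrightarrow> x \<in> extensional {0..T} \<and> continuous_on {0..T} x"
proof -
  have "compactin (top_of_set {0..T}) (topspace (top_of_set {0..T}))"
    by (simp add: compactin_subtopology)
  then show ?thesis
    unfolding C_space_def by (simp only: compactin_mspace_cfunspace) auto
qed

lemma restrict_in_C_space:
  assumes "continuous_on {0..T} z"
  shows "restrict z {0..T} \<in> mspace (C_space T)"
proof -
  have "continuous_on {0..T} (restrict z {0..T})"
    using assms by (rule continuous_on_eq) simp
  then show ?thesis by (simp add: mem_C_space_iff)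
qed

lemma mdist_C_space_le_iff:
  assumes "T \<ge> 0" "x \<in> mspace (C_space T)" "y \<in> mspace (C_space T)"
  shows "mdist (C_space T) x y \<le> c \<longleftrightarrow> (\<forall>t\<in>{0..T}. dist (x t) (y t) \<le> c)"
  using assms cfunspace_mdist_le[of x "top_of_set {0..T}" euclidean_metric y c] by (simp add: C_space_def)

lemma const_fun_in_C_space: "const_fun T s \<in> mspace (C_space T)"
  unfolding mem_C_space_iff const_fun_def
  by (auto intro: continuous_on_eq[of _ "\<lambda>t. s"])

lemma mdist_const_fun:
  assumes "T \<ge> 0"
  shows "mdist (C_space T) (const_fun T s) (const_fun T s') = dist s s'"
proof (rule antisym)
  show "mdist (C_space T) (const_fun T s) (const_fun T s') \<le> dist s s'"
    using assms by (simp add: mdist_C_space_le_iff const_fun_in_C_space) (simp add: const_fun_def)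
  have "\<forall>t\<in>{0..T}. dist (const_fun T s t) (const_fun T s' t) \<le> mdist (C_space T) (const_fun T s) (const_fun T s')"
    using mdist_C_space_le_iff[OF assms const_fun_in_C_space const_fun_in_C_space, of s s'] by blast
  from bspec[OF this, of 0] show "dist s s' \<le> mdist (C_space T) (const_fun T s) (const_fun T s')"
    using assms by (simp add: const_fun_def)
qed

section \<open>Differentiation of indefinite integrals\<close>

lemma has_right_derivative_AE:
  fixes f :: "real \<Rightarrow> 'b::euclidean_space"
  assumes f: "f integrable_on {a..b}"
  obtains S where "negligible S"
    "\<And>x e. x \<in> {a..b} - S \<Longrightarrow> e > 0 \<Longrightarrow>
      \<exists>d>0. \<forall>y\<in>{x..b}. y - x < d \<longrightarrow> norm (integral {x..y} f - (y - x) *\<^sub>R f x) \<le> e * (y - x)"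
proof -
  let ?f = "\<lambda>x. if x \<in> {a..b} then f x else 0"
  have "?f integrable_on UNIV" using f by (simp only: Henstock_Kurzweil_Integration.integrable_restrict_UNIV)
  then have int: "?f integrable_on cbox c d" for c d by (rule integrable_on_subcbox) simp
  \<comment> \<open>In dimension 1 the cubes with corner \<open>x\<close> are the intervals
    \<open>[x, x + h]\<close>, so this differentiation theorem yields a right derivative.\<close>
  obtain S where S: "negligible S" "\<And>x e. \<lbrakk>x \<notin> S; 0 < e\<rbrakk> \<Longrightarrow> \<exists>d>0. \<forall>h. 0 < h \<and> h < d \<longrightarrow>
      norm (integral (cbox x (x + h *\<^sub>R One)) ?f /\<^sub>R h ^ DIM(real) - ?f x) < e"
    using integrable_ccontinuous_explicit[of ?f, OF int] by blast
  show thesis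
  proof (rule that[OF S(1)])
    fix x e :: real assume x: "x \<in> {a..b} - S" and e: "e > 0"
    then obtain d where d: "d > 0" "\<And>h. 0 < h \<Longrightarrow> h < d \<Longrightarrow>
        norm (integral {x..x + h} ?f /\<^sub>R h - ?f x) < e"
      using S(2)[of x e] by auto
    show "\<exists>d>0. \<forall>y\<in>{x..b}. y - x < d \<longrightarrow> norm (integral {x..y} f - (y - x) *\<^sub>R f x) \<le> e * (y - x)"
    proof (intro exI[of _ d] conjI ballI impI)
      fix y assume y: "y \<in> {x..b}" "y - x < d"
      show "norm (integral {x..y} f - (y - x) *\<^sub>R f x) \<le> e * (y - x)"
      proof (cases "y = x")
        case False
        define h where "h = y - x"
        have h: "h > 0" "h < d" "x + h = y" using y False by (auto simp: h_def)
        have "integral {x..y} ?f = integral {x..y} f"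
          using x y by (intro Henstock_Kurzweil_Integration.integral_cong) auto
        then have "norm (integral {x..y} f /\<^sub>R h - f x) < e" using d(2)[OF h(1,2)] x h(3) by simp
        moreover have "integral {x..y} f - h *\<^sub>R f x = h *\<^sub>R (integral {x..y} f /\<^sub>R h - f x)"
          using h(1) by (simp add: scaleR_diff_right)
        ultimately have "norm (integral {x..y} f - h *\<^sub>R f x) \<le> h * e"
          using h(1) by (simp del: scaleR_diff_right)
        then show ?thesis by (simp add: h_def mult.commute)
      qed simp
    qed (use d in auto)
  qed
qed

text \<open>The left-hand estimate at \<open>x\<close> is the right-hand estimate at
  \<open>- x\<close> for the reflected function; the exceptional set is a union of two null sets,
  one of them reflected.\<close>

lemma indefinite_integral_has_vector_derivative_AE:
  fixes f :: "real \<Rightarrow> 'b::euclidean_space"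
  assumes f: "f integrable_on {a..b}"
  obtains S where "negligible S"
    "\<And>x. x \<in> {a..b} - S \<Longrightarrow> ((\<lambda>t. integral {a..t} f) has_vector_derivative f x) (at x within {a..b})"
proof -
  obtain S1 where S1: "negligible S1"
    "\<And>x e. x \<in> {a..b} - S1 \<Longrightarrow> e > 0 \<Longrightarrow>
      \<exists>d>0. \<forall>y\<in>{x..b}. y - x < d \<longrightarrow> norm (integral {x..y} f - (y - x) *\<^sub>R f x) \<le> e * (y - x)"
    using has_right_derivative_AE[OF f] by blast
  have "(\<lambda>x. f (- x)) integrable_on {- b..- a}" using f by (simp add: integrable_reflect_real)
  then obtain S2 where S2: "negligible S2"
    "\<And>x e. x \<in> {- b..- a} - S2 \<Longrightarrow> e > 0 \<Longrightarrow>
      \<exists>d>0. \<forall>y\<in>{x..- a}. y - x < d \<longrightarrow>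
        norm (integral {x..y} (\<lambda>x. f (- x)) - (y - x) *\<^sub>R f (- x)) \<le> e * (y - x)"
    using has_right_derivative_AE[of "\<lambda>x. f (- x)" "- b" "- a"] by blast
  have neg: "negligible (uminus ` S2)"
    by (rule negligible_differentiable_image_negligible[OF _ S2(1)])
       (auto intro!: derivative_intros simp: differentiable_on_def)
  have diff: "integral {a..v} f - integral {a..u} f = integral {u..v} f" if "a \<le> u" "u \<le> v" "v \<le> b" for u v
  proof -
    have "integral {a..u} f + integral {u..v} f = integral {a..v} f"
      using that by (intro Henstock_Kurzweil_Integration.integral_combine integrable_on_subinterval[OF f]) auto
    then show ?thesis by (simp add: algebra_simps)
  qed
  show thesis
  proof (rule that[of "S1 \<union> uminus ` S2"])
    show "negligible (S1 \<union> uminus ` S2)" using S1(1) neg by (rule negligible_Un)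
    fix x assume x: "x \<in> {a..b} - (S1 \<union> uminus ` S2)"
    then have x1: "x \<in> {a..b} - S1" and x2: "- x \<in> {- b..- a} - S2" by (auto simp: image_iff)
    have ab: "a \<le> x" "x \<le> b" using x by auto
    show "((\<lambda>t. integral {a..t} f) has_vector_derivative f x) (at x within {a..b})"
      unfolding has_vector_derivative_def has_derivative_within_alt
    proof (intro conjI allI impI)
      show "bounded_linear (\<lambda>h. h *\<^sub>R f x)" by (rule bounded_linear_scaleR_left)
      fix e :: real assume e: "e > 0"
      obtain d1 where d1: "d1 > 0" "\<And>y. y \<in> {x..b} \<Longrightarrow> y - x < d1 \<Longrightarrow>
          norm (integral {x..y} f - (y - x) *\<^sub>R f x) \<le> e * (y - x)"
        using S1(2)[OF x1 e] by blast
      obtain d2 where d2: "d2 > 0" "\<And>y. y \<in> {- x..- a} \<Longrightarrow> y - (- x) < d2 \<Longrightarrow>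
          norm (integral {- x..y} (\<lambda>x. f (- x)) - (y - (- x)) *\<^sub>R f (- (- x))) \<le> e * (y - (- x))"
        using S2(2)[OF x2 e] by blast
      show "\<exists>d>0. \<forall>y\<in>{a..b}. norm (y - x) < d \<longrightarrow>
          norm (integral {a..y} f - integral {a..x} f - (y - x) *\<^sub>R f x) \<le> e * norm (y - x)"
      proof (intro exI[of _ "min d1 d2"] conjI ballI impI)
        fix y assume y: "y \<in> {a..b}" and yx: "norm (y - x) < min d1 d2"
        show "norm (integral {a..y} f - integral {a..x} f - (y - x) *\<^sub>R f x) \<le> e * norm (y - x)"
        proof (cases "x \<le> y")
          case True
          then show ?thesis using d1(2)[of y] y yx ab by (simp add: diff)
        next
          case False
          have "integral {- x..- y} (\<lambda>x. f (- x)) = integral {y..x} f"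
            by (rule Henstock_Kurzweil_Integration.integral_reflect_real)
          also have "\<dots> = integral {a..x} f - integral {a..y} f" using diff[of y x] False y ab by simp
          finally have eq: "integral {a..y} f - integral {a..x} f - (y - x) *\<^sub>R f x
              = - (integral {- x..- y} (\<lambda>x. f (- x)) - (- y - (- x)) *\<^sub>R f (- (- x)))"
            by (simp add: algebra_simps)
          have "norm (integral {- x..- y} (\<lambda>x. f (- x)) - (- y - (- x)) *\<^sub>R f (- (- x))) \<le> e * (- y - (- x))"
            using False y yx by (intro d2(2)) auto
          then show ?thesis unfolding eq norm_minus_cancel using False by simp
        qed
      qed (use d1 d2 in auto)
    qed
  qed
qed

section \<open>Absolute continuity of indefinite integrals\<close>

lemma integral_truncation_small:
  fixes \<beta> :: "real \<Rightarrow> real"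
  assumes \<beta>: "\<beta> integrable_on {a..b}" and nonneg: "\<And>t. t \<in> {a..b} \<Longrightarrow> 0 \<le> \<beta> t" and e: "e > 0"
  obtains k :: nat where "(\<lambda>t. min (\<beta> t) (real k)) integrable_on {a..b}"
    "integral {a..b} \<beta> - integral {a..b} (\<lambda>t. min (\<beta> t) (real k)) < e"
proof -
  have ai: "\<beta> absolutely_integrable_on {a..b}"
    using \<beta> nonneg by (intro nonnegative_absolutely_integrable_1) auto
  have int: "(\<lambda>t. min (\<beta> t) (real k)) integrable_on {a..b}" for k
  proof -
    have "(\<lambda>t. min (\<beta> t) (real k)) absolutely_integrable_on {a..b}"
      by (intro absolutely_integrable_min_1 ai) (simp add: absolutely_integrable_on_const)
    then show ?thesis by (simp add: absolutely_integrable_on_def)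
  qed
  have "(\<lambda>k. integral {a..b} (\<lambda>t. min (\<beta> t) (real k))) \<longlonglongrightarrow> integral {a..b} \<beta>"
  proof (rule dominated_convergence(2)[OF int \<beta>])
    show "norm (min (\<beta> t) (real k)) \<le> \<beta> t" if "t \<in> {a..b}" for k t
      using nonneg[OF that] by auto
    show "(\<lambda>k. min (\<beta> t) (real k)) \<longlonglongrightarrow> \<beta> t" for t
    proof (rule tendsto_eventually)
      show "\<forall>\<^sub>F k in sequentially. min (\<beta> t) (real k) = \<beta> t"
        using eventually_ge_at_top[of "nat \<lceil>\<beta> t\<rceil>"]
        by eventually_elim (metis min.absorb1 of_nat_le_iff order_trans real_nat_ceiling_ge)
    qed
  qed
  then have "\<forall>\<^sub>F k in sequentially. integral {a..b} \<beta> - e < integral {a..b} (\<lambda>t. min (\<beta> t) (real k))"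
    using e by (intro order_tendstoD) auto
  then obtain k where "integral {a..b} \<beta> - e < integral {a..b} (\<lambda>t. min (\<beta> t) (real k))"
    using eventually_happens'[OF sequentially_bot] by blast
  then show thesis by (intro that[OF int[of k]]) linarith
qed

text \<open>Restricted to disjoint open intervals and added up, a nonnegative \<open>\<psi>\<close>
  stays below \<open>\<psi>\<close>. Passing to open intervals changes no integral and avoids shared
  endpoints.\<close>

lemma sum_integral_disjoint_le:
  fixes \<psi> :: "real \<Rightarrow> real" and M :: nat
  assumes \<psi>: "\<psi> integrable_on {a..b}" and nonneg: "\<And>t. t \<in> {a..b} \<Longrightarrow> 0 \<le> \<psi> t"
    and uv: "\<forall>i<M. a \<le> u i \<and> u i \<le> v i \<and> v i \<le> b"
    and disj: "\<forall>i<M. \<forall>j<M. i \<noteq> j \<longrightarrow> {u i<..<v i} \<inter> {u j<..<v j} = {}"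
  shows "(\<Sum>i<M. integral {u i..v i} \<psi>) \<le> integral {a..b} \<psi>"
proof -
  let ?h = "\<lambda>i t. if t \<in> {u i<..<v i} then \<psi> t else 0"
  have h: "(?h i has_integral integral {u i..v i} \<psi>) {a..b}" if "i < M" for i
  proof -
    have sub: "{u i<..<v i} \<subseteq> {a..b}" "{u i..v i} \<subseteq> {a..b}" using uv that by force+
    have "(\<psi> has_integral integral {u i..v i} \<psi>) {u i..v i}"
      by (intro integrable_integral integrable_on_subinterval[OF \<psi>] sub)
    then have "(\<psi> has_integral integral {u i..v i} \<psi>) {u i<..<v i}"
      by (simp add: has_integral_Icc_iff_Ioo)
    then show ?thesis using sub(1) by (simp only: has_integral_restrict)
  qed
  have sum: "((\<lambda>t. \<Sum>i<M. ?h i t) has_integral (\<Sum>i<M. integral {u i..v i} \<psi>)) {a..b}"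
    using h by (intro has_integral_sum) auto
  have le: "(\<Sum>i<M. ?h i t) \<le> \<psi> t" if t: "t \<in> {a..b}" for t
  proof (cases "\<exists>i<M. t \<in> {u i<..<v i}")
    case True
    then obtain i where i: "i < M" "t \<in> {u i<..<v i}" by blast
    have "(\<Sum>j<M. ?h j t) = (\<Sum>j\<in>{i}. ?h j t)"
      using i disj by (intro sum.mono_neutral_right) (auto split: if_splits, force)
    then show ?thesis using i by simp
  next
    case False
    then have "(\<Sum>j<M. ?h j t) = 0" by (intro sum.neutral) auto
    then show ?thesis using nonneg[OF t] by simp
  qed
  show ?thesis
    using has_integral_le[OF sum integrable_integral[OF \<psi>] le] .
qed

text \<open>Split \<open>\<beta>\<close> into \<open>min \<beta> k\<close> and a rest. The rest has
  integral below \<open>\<epsilon>/2\<close> over the whole interval, and the bounded part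
  contributes at most \<open>k\<close> times the total length.\<close>

lemma abs_continuous_on_dominated:
  fixes f :: "real \<Rightarrow> 'b::real_normed_vector"
  assumes \<beta>: "\<beta> integrable_on {a..b}" and nonneg: "\<And>t. t \<in> {a..b} \<Longrightarrow> 0 \<le> \<beta> t"
    and le: "\<And>u v. a \<le> u \<Longrightarrow> u \<le> v \<Longrightarrow> v \<le> b \<Longrightarrow> norm (f v - f u) \<le> integral {u..v} \<beta>"
  shows "abs_continuous_on a b f"
  unfolding abs_continuous_on_def
proof (intro allI impI)
  fix \<epsilon> :: real assume \<epsilon>: "\<epsilon> > 0"
  obtain k :: nat where k: "(\<lambda>t. min (\<beta> t) (real k)) integrable_on {a..b}"
    "integral {a..b} \<beta> - integral {a..b} (\<lambda>t. min (\<beta> t) (real k)) < \<epsilon>/2"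
    using integral_truncation_small[OF \<beta> nonneg, of "\<epsilon>/2"] \<epsilon> by auto
  \<comment> \<open>A total length below \<open>\<delta>\<close> makes the bounded part at most
    \<open>\<epsilon>/2\<close>; the \<open>+ 1\<close> covers \<open>k = 0\<close>.\<close>
  define \<delta> where "\<delta> = \<epsilon> / (2 * (real k + 1))"
  have \<delta>: "\<delta> > 0" using \<epsilon> by (simp add: \<delta>_def)
  show "\<exists>\<delta>>0. \<forall>(N::nat) u v. (\<forall>i<N. a \<le> u i \<and> u i \<le> v i \<and> v i \<le> b) \<longrightarrow>
      (\<forall>i<N. \<forall>j<N. i \<noteq> j \<longrightarrow> {u i<..<v i} \<inter> {u j<..<v j} = {}) \<longrightarrow>
      (\<Sum>i<N. v i - u i) < \<delta> \<longrightarrow> (\<Sum>i<N. norm (f (v i) - f (u i))) < \<epsilon>"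
  proof (intro exI[of _ \<delta>] conjI allI impI \<delta>)
    fix N and u v :: "nat \<Rightarrow> real"
    assume uv: "\<forall>i<N. a \<le> u i \<and> u i \<le> v i \<and> v i \<le> b"
      and disj: "\<forall>i<N. \<forall>j<N. i \<noteq> j \<longrightarrow> {u i<..<v i} \<inter> {u j<..<v j} = {}"
      and small: "(\<Sum>i<N. v i - u i) < \<delta>"
    let ?\<psi> = "\<lambda>t. \<beta> t - min (\<beta> t) (real k)"
    have \<psi>: "?\<psi> integrable_on {a..b}" by (intro Henstock_Kurzweil_Integration.integrable_diff \<beta> k(1))
    have "(\<Sum>i<N. norm (f (v i) - f (u i))) \<le> (\<Sum>i<N. integral {u i..v i} ?\<psi> + real k * (v i - u i))"
    proof (rule sum_mono)
      fix i assume "i \<in> {..<N}"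
      then have i: "a \<le> u i" "u i \<le> v i" "v i \<le> b" using uv by auto
      have sub: "{u i..v i} \<subseteq> {a..b}" using i by auto
      have "norm (f (v i) - f (u i)) \<le> integral {u i..v i} \<beta>" using le i by blast
      also have "\<dots> \<le> integral {u i..v i} (\<lambda>t. ?\<psi> t + real k)"
        using sub
        by (intro integral_le integrable_on_subinterval[OF \<beta>] integrable_add
            integrable_on_subinterval[OF \<psi>]) auto
      also have "\<dots> = integral {u i..v i} ?\<psi> + real k * (v i - u i)"
        using sub i by (subst Henstock_Kurzweil_Integration.integral_add)
          (auto intro: integrable_on_subinterval[OF \<psi>])
      finally show "norm (f (v i) - f (u i)) \<le> integral {u i..v i} ?\<psi> + real k * (v i - u i)" .
    qed
    also have "\<dots> = (\<Sum>i<N. integral {u i..v i} ?\<psi>) + real k * (\<Sum>i<N. v i - u i)"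
      by (simp add: sum.distrib sum_distrib_left)
    finally have "(\<Sum>i<N. norm (f (v i) - f (u i)))
        \<le> (\<Sum>i<N. integral {u i..v i} ?\<psi>) + real k * (\<Sum>i<N. v i - u i)" .
    moreover have "(\<Sum>i<N. integral {u i..v i} ?\<psi>) \<le> integral {a..b} ?\<psi>"
      by (rule sum_integral_disjoint_le[OF \<psi> _ uv disj]) auto
    moreover have "integral {a..b} ?\<psi> < \<epsilon>/2"
      using k by (simp add: Henstock_Kurzweil_Integration.integral_diff \<beta>)
    moreover have "real k * (\<Sum>i<N. v i - u i) \<le> real k * \<delta>"
      using small by (intro mult_left_mono) auto
    moreover have "real k * \<delta> \<le> \<epsilon>/2" using \<epsilon> by (simp add: \<delta>_def field_simps)
    ultimately show "(\<Sum>i<N. norm (f (v i) - f (u i))) < \<epsilon>" by linarith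
  qed
qed

section \<open>Blocks, and solutions in integral form\<close>

lemma bounded_linear_block: "bounded_linear (\<lambda>s. block e s i)"
proof (rule linear_conv_bounded_linear[THEN iffD1], rule linearI)
  show "block e (x + y) i = block e x i + block e y i" for x y
    by (simp add: block_def vec_eq_iff)
  show "block e (c *\<^sub>R x) i = c *\<^sub>R block e x i" for c x
    by (simp add: block_def vec_eq_iff)
qed

lemma norm_block_le: "norm (block e s i) \<le> norm (s :: real ^ ('n::finite \<times> 'm::finite))"
proof -
  have "(\<Sum>j\<in>UNIV. (s $ (e i, j))\<^sup>2) = (\<Sum>p\<in>Pair (e i) ` UNIV. (s $ p)\<^sup>2)"
    by (subst sum.reindex) (auto simp: inj_on_def)
  also have "\<dots> \<le> (\<Sum>p\<in>UNIV. (s $ p)\<^sup>2)" by (rule sum_mono2) auto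
  finally show ?thesis by (simp add: norm_vec_def L2_set_def block_def)
qed

lemma block_eqI:
  fixes v w :: "real ^ ('n::finite \<times> 'm::finite)"
  assumes e: "bij_betw e {1..n} (UNIV :: 'n set)" and "\<And>i. i \<in> {1..n} \<Longrightarrow> block e v i = block e w i"
  shows "v = w"
proof -
  have "v $ (\<nu>, j) = w $ (\<nu>, j)" for \<nu> j
  proof -
    obtain i where "i \<in> {1..n}" "e i = \<nu>" using e by (metis UNIV_I bij_betw_def imageE)
    then show ?thesis using assms(2)[of i] by (auto simp: block_def vec_eq_iff)
  qed
  then show ?thesis by (auto simp: vec_eq_iff)
qed

text \<open>Domination of \<open>F\<close> by \<open>\<beta>\<close> gives absolute continuity;
  differentiating the integral almost everywhere and discarding \<open>S\<close> gives the
  equations.\<close>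

lemma periodic_solutionI:
  fixes x :: "real \<Rightarrow> real ^ ('n::finite \<times> 'm::finite)"
  assumes T: "T > 0" and x: "x \<in> mspace (C_space T)"
    and F: "F integrable_on {0..T}" and \<beta>: "\<beta> integrable_on {0..T}"
    and le: "\<And>t. t \<in> {0..T} \<Longrightarrow> norm (F t) \<le> \<beta> t"
    and eq: "\<And>t. t \<in> {0..T} \<Longrightarrow> x t = x 0 + integral {0..t} F"
    and per: "x T = x 0"
    and S: "negligible S"
    and sys: "\<And>t i. t \<in> {0..T} - S \<Longrightarrow> i \<in> {1..<n} \<Longrightarrow> block e (F t) i = g i (block e (x t) (i + 1))"
      "\<And>t. t \<in> {0..T} - S \<Longrightarrow> block e (F t) n = f t (x t)"
  shows "periodic_solution T n e g f x"
proof -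
  obtain S' where S': "negligible S'"
    "\<And>t. t \<in> {0..T} - S' \<Longrightarrow> ((\<lambda>t. integral {0..t} F) has_vector_derivative F t) (at t within {0..T})"
    using indefinite_integral_has_vector_derivative_AE[OF F] by blast
  have der: "((\<lambda>\<tau>. block e (x \<tau>) i) has_vector_derivative block e (F t) i) (at t within {0..T})"
    if t: "t \<in> {0..T} - S'" for t i
  proof -
    have "((\<lambda>t. x 0 + integral {0..t} F) has_vector_derivative F t) (at t within {0..T})"
      using has_vector_derivative_add[OF has_vector_derivative_const S'(2)[OF t], of "x 0"] by simp
    then have "(x has_vector_derivative F t) (at t within {0..T})"
      by (intro has_vector_derivative_transform[where f = "\<lambda>t. x 0 + integral {0..t} F", OF _ eq]) (use t in auto)
    then show ?thesis by (rule bounded_linear.has_vector_derivative[OF bounded_linear_block])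
  qed
  have "AE t in lebesgue_on {0..T}. t \<notin> S \<union> S'"
  proof -
    have "S \<union> S' \<in> null_sets lebesgue"
      using S S'(1) by (simp add: negligible_iff_null_sets[symmetric])
    then have "AE t in lebesgue. t \<notin> S \<union> S'" by (rule AE_not_in)
    then show ?thesis by (subst AE_restrict_space_iff) auto
  qed
  moreover have "AE t in lebesgue_on {0..T}. t \<in> {0..T}"
    by (rule AE_I2) simp
  ultimately have "AE t in lebesgue_on {0..T}.
        (\<forall>i\<in>{1..<n}. ((\<lambda>\<tau>. block e (x \<tau>) i) has_vector_derivative
                        g i (block e (x t) (i + 1))) (at t within {0..T})) \<and>
        ((\<lambda>\<tau>. block e (x \<tau>) n) has_vector_derivative f t (x t)) (at t within {0..T})"
  proof eventually_elim
    case (elim t)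
    then have t: "t \<in> {0..T} - S" "t \<in> {0..T} - S'" by auto
    show ?case
    proof (intro conjI ballI)
      show "((\<lambda>\<tau>. block e (x \<tau>) i) has_vector_derivative g i (block e (x t) (i + 1))) (at t within {0..T})"
        if "i \<in> {1..<n}" for i
        using der[OF t(2), of i] sys(1)[OF t(1) that] by simp
      show "((\<lambda>\<tau>. block e (x \<tau>) n) has_vector_derivative f t (x t)) (at t within {0..T})"
        using der[OF t(2), of n] sys(2)[OF t(1)] by simp
    qed
  qed
  moreover have "abs_continuous_on 0 T (\<lambda>t. block e (x t) i)" for i
  proof (rule abs_continuous_on_dominated[OF \<beta>])
    show "0 \<le> \<beta> t" if "t \<in> {0..T}" for t using le[OF that] norm_ge_zero order_trans by blast
    fix u v :: real assume uv: "0 \<le> u" "u \<le> v" "v \<le> T"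
    have sub: "{u..v} \<subseteq> {0..T}" using uv by auto
    have "integral {0..u} F + integral {u..v} F = integral {0..v} F"
      using uv by (intro Henstock_Kurzweil_Integration.integral_combine integrable_on_subinterval[OF F]) auto
    then have "x v - x u = integral {u..v} F" using eq[of u] eq[of v] uv by (simp add: algebra_simps)
    moreover have "block e (x v) i - block e (x u) i = block e (x v - x u) i"
      by (simp add: block_def vec_eq_iff)
    ultimately have "norm (block e (x v) i - block e (x u) i) \<le> norm (integral {u..v} F)"
      by (simp add: norm_block_le)
    also have "\<dots> \<le> integral {u..v} \<beta>"
      using sub le by (intro Henstock_Kurzweil_Integration.integral_norm_bound_integral
          integrable_on_subinterval[OF F] integrable_on_subinterval[OF \<beta>]) auto
    finally show "norm (block e (x v) i - block e (x u) i) \<le> integral {u..v} \<beta>" .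
  qed
  ultimately show ?thesis
    using x per by (simp add: periodic_solution_def)
qed

section \<open>The truncated system\<close>

text \<open>
  The homotopy parameter \<open>p\<close> first switches on the equations for \<open>x\<^sub>1, \<dots>, x\<^sub>n\<^sub>-\<^sub>1\<close> (for
  \<open>p\<close> from \<open>0\<close> to \<open>1/2\<close>) and then the equation for \<open>x\<^sub>n\<close>, with \<open>\<theta> = 2 * p - 1\<close>.
\<close>

definition scaling ::
    "(nat \<Rightarrow> 'n::finite) \<Rightarrow> nat \<Rightarrow> real \<Rightarrow> real ^ ('n \<times> 'm::finite) \<Rightarrow> real ^ ('n \<times> 'm)" where
  "scaling e n p v =
     (\<chi> q. (if fst q = e n then max 0 (min 1 (2 * p - 1)) else max 0 (min 1 (2 * p))) * v $ q)"

lemma linear_scaling: "linear (scaling e n p)"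
  by (rule linearI) (auto simp: scaling_def vec_eq_iff algebra_simps)

lemma norm_scaling_le:
  fixes v :: "real ^ ('n::finite \<times> 'm::finite)"
  shows "norm (scaling e n p v) \<le> norm v"
proof (rule norm_le_componentwise_cart)
  fix q :: "'n \<times> 'm"
  have "\<bar>c * v $ q\<bar> \<le> \<bar>v $ q\<bar>" if "0 \<le> c" "c \<le> 1" for c
    using that by (simp add: abs_mult mult_left_le_one_le)
  then show "norm (scaling e n p v $ q) \<le> norm (v $ q)" by (simp add: scaling_def)
qed

lemma norm_scaling_diff_le:
  fixes v :: "real ^ ('n::finite \<times> 'm::finite)"
  shows "norm (scaling e n p v - scaling e n p' v) \<le> 2 * \<bar>p - p'\<bar> * norm v"
proof -
  have "norm (scaling e n p v - scaling e n p' v) \<le> norm ((2 * \<bar>p - p'\<bar>) *\<^sub>R v)"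
  proof (rule norm_le_componentwise_cart)
    fix q :: "'n \<times> 'm"
    define c where "c p = (if fst q = e n then max 0 (min 1 (2 * p - 1)) else max 0 (min 1 (2 * p)))"
      for p :: real
    have lip: "\<bar>max 0 (min 1 x) - max 0 (min 1 y)\<bar> \<le> \<bar>x - y\<bar>" for x y :: real
      by (simp add: max_def min_def)
    have "\<bar>2 * p - 2 * p'\<bar> = 2 * \<bar>p - p'\<bar>"
      using abs_mult[of 2 "p - p'"] by (simp add: right_diff_distrib)
    then have "\<bar>c p - c p'\<bar> \<le> 2 * \<bar>p - p'\<bar>"
      using lip[of "2 * p - 1" "2 * p' - 1"] lip[of "2 * p" "2 * p'"] by (simp add: c_def)
    then have "\<bar>(c p - c p') * v $ q\<bar> \<le> 2 * \<bar>p - p'\<bar> * \<bar>v $ q\<bar>"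
      unfolding abs_mult by (intro mult_right_mono) auto
    moreover have "(scaling e n p v - scaling e n p' v) $ q = (c p - c p') * v $ q"
      by (simp add: scaling_def left_diff_distrib c_def)
    ultimately show "norm ((scaling e n p v - scaling e n p' v) $ q) \<le> norm (((2 * \<bar>p - p'\<bar>) *\<^sub>R v) $ q)"
      by (simp add: abs_mult)
  qed
  then show ?thesis by simp
qed

lemma scaling_0: "scaling e n 0 v = 0"
  by (simp add: scaling_def vec_eq_iff)

lemma block_scaling_n: "block e (scaling e n p v) n = max 0 (min 1 (2 * p - 1)) *\<^sub>R block e v n"
  by (simp add: block_def scaling_def vec_eq_iff)

lemma block_scaling:
  assumes "bij_betw e {1..n} (UNIV :: 'n::finite set)" "i \<in> {1..<n}"
  shows "block e (scaling e n p v) i = max 0 (min 1 (2 * p)) *\<^sub>R block e v i"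
proof -
  have "e i \<noteq> e n"
    using inj_onD[of e "{1..n}" i n] assms bij_betw_imp_inj_on by fastforce
  then show ?thesis by (simp add: block_def scaling_def vec_eq_iff)
qed

text \<open>The identities with \<open>g\<close> and \<open>h\<close> are asked for only in the ball
  of radius \<open>R\<close> and off the null set \<open>S\<close>; the paths to which they are
  applied stay in that ball.\<close>

locale truncated_system = tonelli_scheme T N \<beta> "scaling e n"
  for T :: real and N :: "real \<Rightarrow> real ^ ('n::finite \<times> 'm::finite) \<Rightarrow> real ^ ('n \<times> 'm)"
    and \<beta> :: "real \<Rightarrow> real" and e :: "nat \<Rightarrow> 'n" and n :: nat +
  fixes g :: "nat \<Rightarrow> real ^ 'm \<Rightarrow> real ^ 'm" and h :: "real \<Rightarrow> real ^ ('n \<times> 'm) \<Rightarrow> real ^ 'm"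
    and R :: real and S :: "real set"
  assumes e: "bij_betw e {1..n} (UNIV :: 'n set)"
    and S: "negligible S"
    and N_block: "\<And>t s i. t \<in> {0..T} - S \<Longrightarrow> norm s \<le> R \<Longrightarrow> i \<in> {1..<n} \<Longrightarrow>
      block e (N t s) i = g i (block e s (i + 1))"
    and N_block_n: "\<And>t s. t \<in> {0..T} - S \<Longrightarrow> norm s \<le> R \<Longrightarrow> block e (N t s) n = h t s"
    and h_meas: "\<And>s. (\<lambda>t. h t s) \<in> borel_measurable (lebesgue_on {0..T})"
begin

lemma block_I:
  assumes z: "continuous_on {0..T} z" and t: "t \<in> {0..T}"
  shows "block e (I z t) i = integral {0..t} (\<lambda>\<tau>. block e (N \<tau> (z \<tau>)) i)"
  using integral_linear[OF superposition_integrable_sub(1)[OF z] bounded_linear_block, of 0 t] t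
  by (simp add: I_def o_def)

lemma block_I_const:
  assumes z: "continuous_on {0..T} z" and t: "t \<in> {0..T}" and R: "\<And>\<tau>. \<tau> \<in> {0..T} \<Longrightarrow> norm (z \<tau>) \<le> R"
    and i: "i \<in> {1..<n}" and c: "\<And>\<tau>. \<tau> \<in> {0..T} \<Longrightarrow> block e (z \<tau>) (i + 1) = c"
  shows "block e (I z t) i = t *\<^sub>R g i c"
proof -
  have "integral {0..t} (\<lambda>\<tau>. block e (N \<tau> (z \<tau>)) i) = integral {0..t} (\<lambda>\<tau>. g i c)"
    by (rule integral_spike[OF S]) (use t R N_block[OF _ _ i] c in auto)
  also have "\<dots> = t *\<^sub>R g i c" using t by simp
  finally show ?thesis using block_I[OF z t] by simp
qed

text \<open>Along a constant path each of the first blocks integrates to \<open>T\<close> times a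
  constant. In the last block the gauge integral of \<open>I\<close> and the Lebesgue integral of
  \<open>mean_value\<close> agree, the integrand being Lebesgue integrable.\<close>

lemma g_hat_eq:
  assumes s: "norm s \<le> R"
  shows "(1 / T) *\<^sub>R I (\<lambda>t. s) T = g_hat T n e g h s"
proof (rule block_eqI[OF e])
  fix i assume i: "i \<in> {1..n}"
  have scale: "block e ((1 / T) *\<^sub>R v) i = (1 / T) *\<^sub>R block e v i" for v :: "real ^ ('n \<times> 'm)"
    by (simp add: block_def vec_eq_iff)
  show "block e ((1 / T) *\<^sub>R I (\<lambda>t. s) T) i = block e (g_hat T n e g h s) i"
  proof (cases "i < n")
    case True
    then have "block e (I (\<lambda>t. s) T) i = T *\<^sub>R g i (block e s (i + 1))"
      using T s i by (intro block_I_const) auto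
    then show ?thesis using T True i by (simp add: scale g_hat_def block_stack[OF e])
  next
    case False
    then have i_n: "i = n" using i by simp
    let ?f = "\<lambda>t. block e (N t s) n"
    have int: "integrable (lebesgue_on {0..T}) ?f"
      using superposition_integrable(1)[of "\<lambda>t. s"]
      by (intro integrable_bounded_linear[OF bounded_linear_block]) auto
    have "AE t in lebesgue_on {0..T}. ?f t = h t s"
    proof -
      have "AE t in lebesgue. t \<notin> S"
        using S by (intro AE_not_in) (simp add: negligible_iff_null_sets[symmetric])
      then have "AE t in lebesgue_on {0..T}. t \<notin> S" by (subst AE_restrict_space_iff) auto
      moreover have "AE t in lebesgue_on {0..T}. t \<in> {0..T}" by (rule AE_I2) simp
      ultimately show ?thesis by eventually_elim (use N_block_n s in auto)
    qed
    then have "integral\<^sup>L (lebesgue_on {0..T}) ?f = integral\<^sup>L (lebesgue_on {0..T}) (\<lambda>t. h t s)"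
      using int h_meas by (intro integral_cong_AE) auto
    moreover have "integral\<^sup>L (lebesgue_on {0..T}) ?f = integral {0..T} ?f"
      using int by (rule lebesgue_integral_eq_integral) simp
    moreover have "block e (I (\<lambda>t. s) T) n = integral {0..T} ?f"
      using T by (intro block_I) auto
    ultimately show ?thesis using i scale unfolding i_n by (simp add: g_hat_def block_stack[OF e] mean_value_def)
  qed
qed

text \<open>Downward induction over the blocks. For \<open>p \<le> 1/2\<close> the last block is
  frozen. If block \<open>i + 1\<close> is a constant \<open>c\<close>, then block \<open>i\<close>
  of \<open>I z T\<close> is \<open>T *\<^sub>R g i c\<close>; as this is 0, so is
  \<open>g i c\<close>, the integral of block \<open>i\<close> vanishes at all times, and block
  \<open>i\<close> is constant as well.\<close>

lemma limit_constant:
  assumes z: "continuous_on {0..T} z" and R: "\<And>t. t \<in> {0..T} \<Longrightarrow> norm (z t) \<le> R"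
    and eq: "\<And>t. t \<in> {0..T} \<Longrightarrow> z t = z 0 + scaling e n p (I z t)" and IT: "I z T = 0"
    and p: "p \<le> 1/2"
  shows "\<And>t. t \<in> {0..T} \<Longrightarrow> z t = z 0" and "g_hat T n e g h (z 0) = 0"
proof -
  have add: "block e (v + w) i = block e v i + block e w i" for v w :: "real ^ ('n \<times> 'm)" and i
    by (simp add: block_def vec_eq_iff)
  have zero: "block e 0 i = 0" for i by (simp add: block_def vec_eq_iff)
  have const: "\<forall>t\<in>{0..T}. block e (z t) (n - j) = block e (z 0) (n - j)" if "j < n" for j
    using that
  proof (induction j)
    case 0
    show ?case
    proof
      fix t assume t: "t \<in> {0..T}"
      have "block e (z t) n = block e (z 0 + scaling e n p (I z t)) n"
        by (rule arg_cong[OF eq[OF t], of "\<lambda>v. block e v n"])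
      then show "block e (z t) (n - 0) = block e (z 0) (n - 0)"
        using p by (simp add: add block_scaling_n max_def min_def)
    qed
  next
    case (Suc j)
    \<comment> \<open>The induction counts down: this step treats block \<open>n - Suc j\<close>,
      whose equation involves block \<open>n - j\<close>.\<close>
    define i where "i = n - Suc j"
    have i: "i \<in> {1..<n}" "i + 1 = n - j" using Suc.prems by (auto simp: i_def)
    have c: "block e (z t) (i + 1) = block e (z 0) (i + 1)" if "t \<in> {0..T}" for t
      using Suc.IH[OF Suc_lessD[OF Suc.prems]] that unfolding i(2) by blast
    have It: "block e (I z t) i = t *\<^sub>R g i (block e (z 0) (i + 1))" if "t \<in> {0..T}" for t
      by (rule block_I_const[OF z that R i(1) c])
    have "T *\<^sub>R g i (block e (z 0) (i + 1)) = 0" using It[of T] IT T by (simp add: zero)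
    then have "g i (block e (z 0) (i + 1)) = 0" using T by simp
    then have It0: "block e (I z t) i = 0" if "t \<in> {0..T}" for t using It[OF that] by simp
    show ?case
    proof
      fix t assume t: "t \<in> {0..T}"
      have "block e (z t) i = block e (z 0 + scaling e n p (I z t)) i"
        by (rule arg_cong[OF eq[OF t], of "\<lambda>v. block e v i"])
      then show "block e (z t) (n - Suc j) = block e (z 0) (n - Suc j)"
        unfolding i_def[symmetric] using It0[OF t] by (simp add: add block_scaling[OF e i(1)])
    qed
  qed
  show zc: "z t = z 0" if t: "t \<in> {0..T}" for t
  proof (rule block_eqI[OF e])
    fix i assume i: "i \<in> {1..n}"
    then have j: "n - i < n" "n - (n - i) = i" by auto
    show "block e (z t) i = block e (z 0) i" using const[OF j(1)] t unfolding j(2) by blast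
  qed
  have "I z T = I (\<lambda>t. z 0) T"
    unfolding I_def by (rule Henstock_Kurzweil_Integration.integral_cong) (metis zc)
  then show "g_hat T n e g h (z 0) = 0"
    using g_hat_eq[of "z 0"] R[of 0] T IT by simp
qed

text \<open>For \<open>1/2 \<le> p \<le> 1\<close> the factor of the first blocks is 1 and that of
  the last is \<open>2 * p - 1\<close>; \<open>I z T = 0\<close> closes the path.\<close>

lemma limit_periodic_solution:
  assumes z: "continuous_on {0..T} z" and R: "\<And>t. t \<in> {0..T} \<Longrightarrow> norm (z t) \<le> R"
    and eq: "\<And>t. t \<in> {0..T} \<Longrightarrow> z t = z 0 + scaling e n p (I z t)" and IT: "I z T = 0"
    and p: "1/2 \<le> p" "p \<le> 1"
  shows "periodic_solution T n e g (\<lambda>t s. (2 * p - 1) *\<^sub>R h t s) (restrict z {0..T})"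
proof (rule periodic_solutionI[OF T _ _ beta_integrable _ _ _ S])
  let ?F = "\<lambda>t. scaling e n p (N t (z t))" and ?x = "restrict z {0..T}"
  show "?x \<in> mspace (C_space T)"
    by (rule restrict_in_C_space[OF z])
  show "?F integrable_on {0..T}"
    using integrable_linear[OF superposition_integrable(2)[OF z] D_bounded_linear[of p]] by (simp add: o_def)
  show "norm (?F t) \<le> \<beta> t" if "t \<in> {0..T}" for t
    using norm_scaling_le bound[OF that] by (rule order_trans)
  show "?x t = ?x 0 + integral {0..t} ?F" if t: "t \<in> {0..T}" for t
  proof -
    have "integral {0..t} ?F = scaling e n p (I z t)"
      using integral_linear[OF superposition_integrable_sub(1)[OF z] D_bounded_linear[of p], of 0 t] t
      by (simp add: I_def o_def)
    then show ?thesis using eq[OF t] T t by simp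
  qed
  show "?x T = ?x 0" using eq[of T] T IT D_0 by simp
  show "block e (?F t) i = g i (block e (?x t) (i + 1))" if "t \<in> {0..T} - S" "i \<in> {1..<n}" for t i
    using that p N_block[OF that(1) R that(2)] by (simp add: block_scaling[OF e that(2)])
  show "block e (?F t) n = (2 * p - 1) *\<^sub>R h t (?x t)" if "t \<in> {0..T} - S" for t
    using that p N_block_n[OF that R] by (simp add: block_scaling_n)
qed

end

lemma norm_stack_le:
  fixes v :: "nat \<Rightarrow> real ^ 'm::finite" and e :: "nat \<Rightarrow> 'n::finite"
  assumes "bij_betw e {1..n} (UNIV :: 'n set)"
  shows "norm (stack e n v) \<le> real CARD('n \<times> 'm) * (\<Sum>i\<in>{1..n}. norm (v i))"
proof -
  have "\<bar>stack e n v $ p\<bar> \<le> (\<Sum>i\<in>{1..n}. norm (v i))" for p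
  proof -
    have i: "inv_into {1..n} e (fst p) \<in> {1..n}"
      using assms by (intro inv_into_into) (simp add: bij_betw_def)
    have "\<bar>stack e n v $ p\<bar> \<le> norm (v (inv_into {1..n} e (fst p)))"
      by (simp add: stack_def component_le_norm_cart)
    also have "\<dots> \<le> (\<Sum>i\<in>{1..n}. norm (v i))" using i by (intro member_le_sum) auto
    finally show ?thesis .
  qed
  then have "(\<Sum>p\<in>UNIV. \<bar>stack e n v $ p\<bar>) \<le> (\<Sum>p\<in>(UNIV :: ('n \<times> 'm) set). \<Sum>i\<in>{1..n}. norm (v i))"
    by (intro sum_mono)
  then show ?thesis using norm_le_l1_cart[of "stack e n v"] by simp
qed

text \<open>The state is projected onto the ball before the field is evaluated, which keeps
  continuity and makes the bound for radius \<open>R\<close> hold for all states. On the null set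
  where the Caratheodory conditions fail the field is set to 0, so that continuity and the bound
  hold at every time.\<close>

lemma truncated_system_exists:
  fixes e :: "nat \<Rightarrow> 'n::finite" and g :: "nat \<Rightarrow> real ^ 'm::finite \<Rightarrow> real ^ 'm"
    and h :: "real \<Rightarrow> real ^ ('n \<times> 'm) \<Rightarrow> real ^ 'm"
  assumes T: "T > 0" and e: "bij_betw e {1..n} (UNIV :: 'n set)"
    and g: "\<And>i. i \<in> {1..<n} \<Longrightarrow> continuous_on UNIV (g i)"
    and h: "L1_Caratheodory T h" and R: "R > 0"
  obtains N \<beta> S where "truncated_system T N \<beta> e n g h R S"
proof -
  have h_meas: "\<And>s. (\<lambda>t. h t s) \<in> borel_measurable (lebesgue_on {0..T})"
    and h_cont: "AE t in lebesgue_on {0..T}. continuous_on UNIV (h t)"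
    using h by (auto simp: L1_Caratheodory_def)
  obtain \<alpha> where \<alpha>: "integrable (lebesgue_on {0..T}) \<alpha>"
    "AE t in lebesgue_on {0..T}. \<forall>s. norm s \<le> R \<longrightarrow> norm (h t s) \<le> \<alpha> t"
    using h R by (auto simp: L1_Caratheodory_def)
  have "AE t in lebesgue_on {0..T}. continuous_on UNIV (h t) \<and> (\<forall>s. norm s \<le> R \<longrightarrow> norm (h t s) \<le> \<alpha> t)"
    using h_cont \<alpha>(2) by eventually_elim auto
  then obtain S where S: "S \<in> null_sets (lebesgue_on {0..T})"
    "\<And>t. t \<in> {0..T} - S \<Longrightarrow> continuous_on UNIV (h t)"
    "\<And>t s. t \<in> {0..T} - S \<Longrightarrow> norm s \<le> R \<Longrightarrow> norm (h t s) \<le> \<alpha> t"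
    unfolding eventually_ae_filter by auto
  define proj where "proj = closest_point (cball (0 :: real ^ ('n \<times> 'm)) R)"
  have proj_cont: "continuous_on UNIV proj"
    unfolding proj_def using R by (intro continuous_on_closest_point) auto
  have proj_le: "norm (proj s) \<le> R" for s
    using closest_point_in_set[of "cball (0 :: real ^ ('n \<times> 'm)) R" s] R by (simp add: proj_def)
  have proj_id: "proj s = s" if "norm s \<le> R" for s
    unfolding proj_def using that by (intro closest_point_self) simp
  define w where "w t s i = (if i < n then g i (block e s (i + 1)) else h t s)" for t s i
  define N where "N t s = (if t \<in> S then 0 else stack e n (w t (proj s)))" for t s
  have "\<exists>B. \<forall>s. norm s \<le> R \<longrightarrow> norm (g i (block e s (i + 1))) \<le> B" if "i \<in> {1..<n}" for i
  proof -
    have "continuous_on (cball 0 R) (\<lambda>s. g i (block e s (i + 1)))"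
      by (intro continuous_on_compose2[OF g[OF that]] linear_continuous_on bounded_linear_block) auto
    then have "bounded ((\<lambda>s. g i (block e s (i + 1))) ` cball 0 R)"
      by (intro compact_imp_bounded compact_continuous_image compact_cball)
    then obtain a where "\<forall>x\<in>cball 0 R. norm (g i (block e x (i + 1))) \<le> a" by (auto simp: bounded_iff)
    then show ?thesis by (intro exI[of _ a]) auto
  qed
  then obtain B where B: "\<And>i s. i \<in> {1..<n} \<Longrightarrow> norm s \<le> R \<Longrightarrow> norm (g i (block e s (i + 1))) \<le> B i"
    by metis
  \<comment> \<open>The factor is the constant of \<open>norm_stack_le\<close>; the absolute values
    keep the bound nonnegative on \<open>S\<close>, where \<open>N\<close> is 0.\<close>
  define \<beta> where "\<beta> t = real CARD('n \<times> 'm) * ((\<Sum>i\<in>{1..<n}. \<bar>B i\<bar>) + \<bar>\<alpha> t\<bar>)" for t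
  have n: "{1..n} = insert n {1..<n}"
  proof -
    have "n \<noteq> 0" using e by (auto simp: bij_betw_def)
    then show ?thesis by auto
  qed
  have idx: "inv_into {1..n} e \<nu> \<in> {1..n}" for \<nu>
    using e by (intro inv_into_into) (simp add: bij_betw_def)
  have "truncated_system T N \<beta> e n g h R S"
  proof (intro truncated_system.intro tonelli_scheme.intro truncated_system_axioms.intro)
    show "T > 0" by (rule T)
    show "(\<lambda>t. N t s) \<in> borel_measurable (lebesgue_on {0..T})" for s
    proof -
      have "S \<in> sets (lebesgue_on {0..T})" using S(1) by blast
      moreover have "(\<lambda>t. stack e n (w t (proj s))) \<in> borel_measurable (lebesgue_on {0..T})"
      proof (subst borel_measurable_euclidean_space, rule ballI)
        fix b :: "real ^ ('n \<times> 'm)" assume "b \<in> Basis"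
        then obtain q where b: "b = axis q 1" by (auto simp: Basis_vec_def)
        have "(\<lambda>t. h t (proj s) $ snd q) \<in> borel_measurable (lebesgue_on {0..T})"
          using h_meas[of "proj s"] by (rule measurable_compose) simp
        then have "(\<lambda>t. w t (proj s) i $ snd q) \<in> borel_measurable (lebesgue_on {0..T})" for i
          by (cases "i < n") (simp_all add: w_def)
        then show "(\<lambda>t. stack e n (w t (proj s)) \<bullet> b) \<in> borel_measurable (lebesgue_on {0..T})"
          by (simp add: b inner_axis stack_def)
      qed
      ultimately show ?thesis
        unfolding N_def by (intro measurable_If_set) auto
    qed
    show "continuous_on UNIV (N t)" if t: "t \<in> {0..T}" for t
    proof (cases "t \<in> S")
      case False
      have "continuous_on UNIV (\<lambda>s. w t s i)" if i: "i \<in> {1..n}" for i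
      proof (cases "i < n")
        case True
        then have "continuous_on UNIV (\<lambda>s. g i (block e s (i + 1)))"
          using i by (intro continuous_on_compose2[OF g] linear_continuous_on bounded_linear_block) auto
        then show ?thesis using True by (simp add: w_def)
      next
        case False
        then show ?thesis using S(2)[of t] t \<open>t \<notin> S\<close> by (simp add: w_def)
      qed
      then have "continuous_on UNIV (\<lambda>s. stack e n (w t s))"
        unfolding stack_def using idx by (intro continuous_on_vec_lambda continuous_on_component) auto
      then have "continuous_on UNIV (\<lambda>s. stack e n (w t (proj s)))"
        by (rule continuous_on_compose2[OF _ proj_cont]) auto
      then show ?thesis using False by (simp add: N_def[abs_def])
    qed (simp add: N_def[abs_def])
    show "integrable (lebesgue_on {0..T}) \<beta>"
      unfolding \<beta>_def
      by (intro integrable_mult_right Bochner_Integration.integrable_add integrable_abs \<alpha>(1))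
         (simp add: integrable_const_ivl)
    show "norm (N t s) \<le> \<beta> t" if t: "t \<in> {0..T}" for t s
    proof (cases "t \<in> S")
      case True
      then show ?thesis by (simp add: N_def \<beta>_def sum_nonneg)
    next
      case False
      have "(\<Sum>i\<in>{1..n}. norm (w t (proj s) i)) \<le> (\<Sum>i\<in>{1..<n}. \<bar>B i\<bar>) + \<bar>\<alpha> t\<bar>"
      proof -
        have "(\<Sum>i\<in>{1..<n}. norm (w t (proj s) i)) \<le> (\<Sum>i\<in>{1..<n}. \<bar>B i\<bar>)"
          using B[OF _ proj_le] by (intro sum_mono) (auto simp: w_def intro: order_trans[OF _ abs_ge_self])
        moreover have "norm (w t (proj s) n) \<le> \<bar>\<alpha> t\<bar>"
          using S(3)[OF _ proj_le, of t s] t False by (auto simp: w_def intro: order_trans[OF _ abs_ge_self])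
        ultimately show ?thesis unfolding n by simp
      qed
      then have "real CARD('n \<times> 'm) * (\<Sum>i\<in>{1..n}. norm (w t (proj s) i)) \<le> \<beta> t"
        unfolding \<beta>_def by (intro mult_left_mono) auto
      then show ?thesis
        using norm_stack_le[OF e, of "w t (proj s)"] False by (simp add: N_def)
    qed
    show "linear (scaling e n p :: real ^ ('n \<times> 'm) \<Rightarrow> _)" "norm (scaling e n p v) \<le> norm v"
      "norm (scaling e n p v - scaling e n q v) \<le> 2 * \<bar>p - q\<bar> * norm v"
      for p q and v :: "real ^ ('n \<times> 'm)"
      by (rule linear_scaling norm_scaling_le norm_scaling_diff_le)+
    show "bij_betw e {1..n} UNIV" by (rule e)
    show "negligible S"
    proof -
      have "S \<in> null_sets lebesgue" using S(1) by (simp add: null_sets_restrict_space)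
      then show ?thesis by (simp add: negligible_iff_null_sets)
    qed
    show "block e (N t s) i = g i (block e s (i + 1))"
      if "t \<in> {0..T} - S" "norm s \<le> R" "i \<in> {1..<n}" for t s i
      using that by (simp add: N_def proj_id block_stack[OF e] w_def)
    show "block e (N t s) n = h t s" if "t \<in> {0..T} - S" "norm s \<le> R" for t s
      using that n by (simp add: N_def proj_id block_stack[OF e] w_def)
    show "(\<lambda>t. h t s) \<in> borel_measurable (lebesgue_on {0..T})" for s by (rule h_meas)
  qed
  then show thesis by (rule that)
qed

section \<open>The shooting map and its homotopy\<close>

lemma compactin_subsequence:
  assumes "compactin (mtopology_of m) K" "\<And>k :: nat. y k \<in> K"
  obtains l r where "l \<in> K" "strict_mono (r :: nat \<Rightarrow> nat)" "(\<lambda>k. mdist m (y (r k)) l) \<longlonglongrightarrow> 0"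
proof -
  interpret Metric_space "mspace m" "mdist m" by (rule Metric_space_mspace_mdist)
  have "\<exists>l r. l \<in> K \<and> strict_mono (r :: nat \<Rightarrow> nat) \<and> limitin mtopology (y \<circ> r) l sequentially"
    using assms by (simp add: mtopology_of_def compactin_sequentially image_subset_iff)
  then obtain l r where l: "l \<in> K" and r: "strict_mono (r :: nat \<Rightarrow> nat)"
    and lim: "limitin mtopology (y \<circ> r) l sequentially" by blast
  have "(\<lambda>k. mdist m (y (r k)) l) \<longlonglongrightarrow> 0"
    using lim by (simp add: limitin_metric_dist_null o_def)
  with l r show thesis by (rule that)
qed

text \<open>Points of \<open>K\<close> within \<open>c\<close> of the sequence have a convergent
  subsequence, and the distance passes to the limit: the closed \<open>c\<close>-neighbourhood of a
  compact set is closed.\<close>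

lemma compact_neighbourhood_limit:
  assumes K: "compactin (mtopology_of m) K" and x: "\<And>k :: nat. x k \<in> mspace m" "l \<in> mspace m"
    and lim: "(\<lambda>k. mdist m (x k) l) \<longlonglongrightarrow> 0" and near: "\<And>k. \<exists>y\<in>K. mdist m (x k) y \<le> c"
  shows "\<exists>y\<in>K. mdist m l y \<le> c"
proof -
  have "\<exists>y. \<forall>k. y k \<in> K \<and> mdist m (x k) (y k) \<le> c" using near by (intro choice) blast
  then obtain y where y: "\<And>k. y k \<in> K" "\<And>k. mdist m (x k) (y k) \<le> c" by blast
  have sub: "K \<subseteq> mspace m" using compactin_subset_topspace[OF K] by simp
  obtain w r where w: "w \<in> K" and r: "strict_mono (r :: nat \<Rightarrow> nat)" and lw: "(\<lambda>k. mdist m (y (r k)) w) \<longlonglongrightarrow> 0"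
    by (rule compactin_subsequence[OF K y(1)]) (rule that)
  have lx: "(\<lambda>k. mdist m (x (r k)) l) \<longlonglongrightarrow> 0"
    using LIMSEQ_subseq_LIMSEQ[OF lim r] by (simp add: o_def)
  have "mdist m l w \<le> mdist m (x (r k)) l + c + mdist m (y (r k)) w" for k
  proof -
    have "mdist m l w \<le> mdist m l (x (r k)) + mdist m (x (r k)) w"
      using x w sub by (intro mdist_triangle) auto
    also have "mdist m (x (r k)) w \<le> mdist m (x (r k)) (y (r k)) + mdist m (y (r k)) w"
      using x w y(1) sub by (intro mdist_triangle) auto
    finally show ?thesis using y(2)[of "r k"] by (simp add: mdist_commute)
  qed
  moreover have "(\<lambda>k. mdist m (x (r k)) l + c + mdist m (y (r k)) w) \<longlonglongrightarrow> 0 + c + 0"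
    by (intro tendsto_intros lx lw)
  ultimately have "mdist m l w \<le> 0 + c + 0" by (intro LIMSEQ_le_const) auto
  then show ?thesis using w by auto
qed

lemma uniform_limit_imp_mdist:
  assumes T: "T \<ge> 0" and x: "\<And>k. x k \<in> mspace (C_space T)" "l \<in> mspace (C_space T)"
    and lim: "uniform_limit {0..T} x l sequentially"
  shows "(\<lambda>k. mdist (C_space T) (x k) l) \<longlonglongrightarrow> 0"
proof (rule tendstoI)
  fix e :: real assume e: "e > 0"
  then have "\<forall>\<^sub>F k in sequentially. \<forall>t\<in>{0..T}. dist (x k t) (l t) < e/2"
    using lim by (intro uniform_limitD) auto
  then show "\<forall>\<^sub>F k in sequentially. dist (mdist (C_space T) (x k) l) 0 < e"
  proof eventually_elim
    case (elim k)
    then have "mdist (C_space T) (x k) l \<le> e/2"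
      using mdist_C_space_le_iff[OF T x] by (meson less_imp_le)
    then show ?case using e by simp
  qed
qed

text \<open>A Lebesgue number of the cover \<open>{U}\<close>, halved so that the non-strict
  inequality suffices.\<close>

lemma compact_uniform_neighbourhood:
  assumes K: "compactin (mtopology_of m) K" and U: "openin (mtopology_of m) U" "K \<subseteq> U"
  obtains r where "r > 0" "\<And>x y. x \<in> mspace m \<Longrightarrow> y \<in> K \<Longrightarrow> mdist m x y \<le> r \<Longrightarrow> x \<in> U"
proof -
  interpret Metric_space "mspace m" "mdist m" by (rule Metric_space_mspace_mdist)
  obtain \<epsilon> where \<epsilon>: "\<epsilon> > 0" "\<And>y. y \<in> K \<Longrightarrow> mball y \<epsilon> \<subseteq> U"
    using lebesgue_number[of K "{U}"] assms by (auto simp: mtopology_of_def)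
  have sub: "K \<subseteq> mspace m" using compactin_subset_topspace[OF K] by simp
  show thesis
  proof (rule that[of "\<epsilon>/2"])
    fix x y assume x: "x \<in> mspace m" "y \<in> K" "mdist m x y \<le> \<epsilon>/2"
    then have "x \<in> mball y \<epsilon>" using \<epsilon>(1) sub by (auto simp: in_mball mdist_commute)
    then show "x \<in> U" using \<epsilon>(2) x by blast
  qed (use \<epsilon> in simp)
qed

lemma compactin_C_space_bounded:
  assumes T: "T \<ge> 0" and K: "compactin (mtopology_of (C_space T)) K"
  obtains R where "R > 0" "\<And>x t. x \<in> K \<Longrightarrow> t \<in> {0..T} \<Longrightarrow> norm (x t) \<le> R"
proof -
  interpret Metric_space "mspace (C_space T)" "mdist (C_space T)" by (rule Metric_space_mspace_mdist)
  let ?c = "const_fun T 0"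
  have "mbounded K" using compactin_imp_mbounded K by (simp add: mtopology_of_def)
  then have "mbounded (insert ?c K)" by (simp add: mbounded_insert const_fun_in_C_space)
  then obtain B where B: "\<And>x. x \<in> K \<Longrightarrow> mdist (C_space T) ?c x \<le> B"
    unfolding mbounded_alt by blast
  have sub: "K \<subseteq> mspace (C_space T)" using compactin_subset_topspace[OF K] by simp
  show thesis
  proof (rule that[of "\<bar>B\<bar> + 1"])
    fix x t assume x: "x \<in> K" and t: "t \<in> {0..T}"
    have "dist (?c t) (x t) \<le> B"
      using mdist_C_space_le_iff[OF T const_fun_in_C_space, of x 0 B] B x t sub by blast
    then show "norm (x t) \<le> \<bar>B\<bar> + 1" using t by (simp add: const_fun_def)
  qed simp
qed

text \<open>\<open>const_fun T\<close> is an isometric embedding, so convergent subsequences carry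
  over.\<close>

lemma compactin_const_fun:
  fixes C :: "(real ^ 'k::finite) set"
  assumes T: "T \<ge> 0" and C: "compact C"
  shows "compactin (mtopology_of (C_space T)) (const_fun T ` C)"
proof -
  interpret Metric_space "mspace (C_space T :: (real \<Rightarrow> real ^ 'k) metric)" "mdist (C_space T)"
    by (rule Metric_space_mspace_mdist)
  show ?thesis
    unfolding mtopology_of_def compactin_sequentially
  proof (intro conjI allI impI)
    show "const_fun T ` C \<subseteq> mspace (C_space T)" using const_fun_in_C_space by blast
    fix \<sigma> :: "nat \<Rightarrow> real \<Rightarrow> real ^ 'k" assume "range \<sigma> \<subseteq> const_fun T ` C"
    then have "\<forall>k. \<exists>s\<in>C. \<sigma> k = const_fun T s" by blast
    then have "\<exists>s. \<forall>k. s k \<in> C \<and> \<sigma> k = const_fun T (s k)" by (intro choice) blast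
    then obtain s where s: "\<And>k. s k \<in> C" "\<And>k. \<sigma> k = const_fun T (s k)" by blast
    obtain l r where l: "l \<in> C" "strict_mono (r :: nat \<Rightarrow> nat)" "(s \<circ> r) \<longlonglongrightarrow> l"
      using C s(1) unfolding compact_def by meson
    have "(\<lambda>k. dist (s (r k)) l) \<longlonglongrightarrow> 0"
      using tendsto_dist_iff[THEN iffD1, OF l(3)] by (simp add: o_def)
    then have "limitin mtopology (\<sigma> \<circ> r) (const_fun T l) sequentially"
      by (simp add: limitin_metric_dist_null const_fun_in_C_space s(2) mdist_const_fun[OF T])
    then show "\<exists>l r. l \<in> const_fun T ` C \<and> strict_mono r \<and> limitin mtopology (\<sigma> \<circ> r) l sequentially"
      using l by blast
  qed
qed

lemma open_const_part:
  fixes \<Omega> :: "(real \<Rightarrow> real ^ 'k::finite) set"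
  assumes T: "T \<ge> 0" and \<Omega>: "openin (mtopology_of (C_space T)) \<Omega>"
  shows "open (const_part T \<Omega>)"
proof -
  interpret Metric_space "mspace (C_space T :: (real \<Rightarrow> real ^ 'k) metric)" "mdist (C_space T)"
    by (rule Metric_space_mspace_mdist)
  show ?thesis
    unfolding open_dist
  proof
    fix s assume "s \<in> const_part T \<Omega>"
    then obtain r where r: "r > 0" "mball (const_fun T s) r \<subseteq> \<Omega>"
      using \<Omega> by (auto simp: const_part_def mtopology_of_def openin_mtopology)
    have "s' \<in> const_part T \<Omega>" if "dist s' s < r" for s'
      using that r(2) mdist_const_fun[OF T, of s s']
      by (auto simp: const_part_def in_mball const_fun_in_C_space dist_commute)
    then show "\<exists>r>0. \<forall>s'. dist s' s < r \<longrightarrow> s' \<in> const_part T \<Omega>" using r(1) by blast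
  qed
qed

section \<open>The shooting map near a compact set of paths\<close>

context truncated_system
begin

definition path_sol :: "nat \<Rightarrow> real \<Rightarrow> real ^ ('n \<times> 'm) \<Rightarrow> real \<Rightarrow> real ^ ('n \<times> 'm)" where
  "path_sol k p s = restrict (approx_sol k p s) {0..T}"

text \<open>The integral runs over all of \<open>{0..T}\<close>, whereas the path at time
  \<open>T\<close> has used it only up to \<open>T - T / (k + 1)\<close>; so a zero need not give a
  closed path, and periodicity appears only in the limit.\<close>

definition shooting :: "nat \<Rightarrow> real \<Rightarrow> real ^ ('n \<times> 'm) \<Rightarrow> real ^ ('n \<times> 'm)" where
  "shooting k p s = (1 / T) *\<^sub>R I (approx_sol k p s) T"

lemma path_sol_in_C_space: "path_sol k p s \<in> mspace (C_space T)"
  unfolding path_sol_def by (rule restrict_in_C_space[OF continuous_on_approx_sol])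

lemma path_sol_tendsto:
  assumes "pk \<longlonglongrightarrow> p" "sk \<longlonglongrightarrow> s"
  shows "(\<lambda>i. mdist (C_space T) (path_sol k (pk i) (sk i)) (path_sol k p s)) \<longlonglongrightarrow> 0"
proof (rule uniform_limit_imp_mdist[OF _ path_sol_in_C_space path_sol_in_C_space])
  show "uniform_limit {0..T} (\<lambda>i. path_sol k (pk i) (sk i)) (path_sol k p s) sequentially"
    using uniform_limit_approx_sol[OF assms, of k]
    by (rule uniform_limit_cong'[THEN iffD1, rotated 2]) (auto simp: path_sol_def)
qed (use T in simp)

lemma shooting_tendsto:
  assumes "pk \<longlonglongrightarrow> p" "sk \<longlonglongrightarrow> s"
  shows "(\<lambda>i. shooting k (pk i) (sk i)) \<longlonglongrightarrow> shooting k p s"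
proof -
  have "uniform_limit {0..T} (\<lambda>i. I (approx_sol k (pk i) (sk i))) (I (approx_sol k p s)) sequentially"
    by (rule superposition_limit[OF continuous_on_approx_sol uniform_limit_approx_sol[OF assms]])
  then have "(\<lambda>i. I (approx_sol k (pk i) (sk i)) T) \<longlonglongrightarrow> I (approx_sol k p s) T"
    by (rule tendsto_uniform_limitI) (use T in simp)
  then show ?thesis unfolding shooting_def by (intro tendsto_intros)
qed

lemma path_sol_0: "path_sol k 0 s = const_fun T s"
  unfolding path_sol_def const_fun_def
  by (rule restrict_ext) (simp add: approx_sol_zero_parameter scaling_0)

lemma shooting_0:
  assumes "norm s \<le> R"
  shows "shooting k 0 s = g_hat T n e g h s"
proof -
  have "I (approx_sol k 0 s) T = I (\<lambda>t. s) T"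
    unfolding I_def
    by (rule Henstock_Kurzweil_Integration.integral_cong) (simp add: approx_sol_zero_parameter scaling_0)
  then show ?thesis using g_hat_eq[OF assms] by (simp add: shooting_def)
qed

text \<open>The domain \<open>P\<close> collects the \<open>(p, s)\<close> whose path is at distance
  less than \<open>r\<close> from \<open>K\<close>. For a suitable \<open>k\<close>, zeros with path
  at distance at most \<open>r\<close> already belong to \<open>P\<close> and have
  \<open>p \<noteq> 1\<close>. So zeros cannot escape through the boundary of \<open>P\<close>,
  their set is compact, and none is left at \<open>p = 1\<close>.\<close>

lemma shooting_homotopy:
  fixes \<Omega> K :: "(real \<Rightarrow> real ^ ('n \<times> 'm)) set"
  assumes K: "compactin (mtopology_of (C_space T)) K" and r: "r > 0"
    and near: "\<And>x y. x \<in> mspace (C_space T) \<Longrightarrow> y \<in> K \<Longrightarrow> mdist (C_space T) x y \<le> r \<Longrightarrow>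
      x \<in> \<Omega> \<and> (\<forall>t\<in>{0..T}. norm (x t) \<le> R)"
    and sol: "\<And>\<theta> x. \<theta> \<in> {0<..1} \<Longrightarrow> periodic_solution T n e g (\<lambda>t s. \<theta> *\<^sub>R h t s) x \<Longrightarrow> x \<in> K"
    and no_sol: "\<And>x. x \<in> \<Omega> \<Longrightarrow> \<not> periodic_solution T n e g h x"
    and V: "\<And>s. s \<in> closure V \<Longrightarrow> const_fun T s \<in> K"
    and zeros: "\<And>s. const_fun T s \<in> \<Omega> \<Longrightarrow> g_hat T n e g h s = 0 \<Longrightarrow> s \<in> V"
  shows "\<exists>H P. null_homotopy H P V \<and> (\<forall>s\<in>closure V. H 0 s = g_hat T n e g h s)"
proof -
  let ?m = "C_space T :: (real \<Rightarrow> real ^ ('n \<times> 'm)) metric"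
  let ?near = "\<lambda>x. \<exists>y\<in>K. mdist ?m x y \<le> r" and ?inside = "\<lambda>x. \<exists>y\<in>K. mdist ?m x y < r"
  have T0: "0 \<in> {0..T}" using T by simp
  have Ksub: "K \<subseteq> mspace ?m" using compactin_subset_topspace[OF K] by simp
  \<comment> \<open>A limit path near \<open>K\<close> lies in \<open>K\<close> itself: for
    \<open>p \<le> 1/2\<close> it is a constant from \<open>V\<close>, for larger \<open>p\<close> a
    periodic solution with \<open>\<theta> = 2 * p - 1\<close>, and \<open>p = 1\<close> would
    contradict \<open>no_sol\<close>.\<close>
  have in_K: "restrict z {0..T} \<in> K \<and> p \<noteq> 1"
    if z: "continuous_on {0..T} z" and nz: "?near (restrict z {0..T})"
      and eq: "\<And>t. t \<in> {0..T} \<Longrightarrow> z t = z 0 + scaling e n p (I z t)" and IT: "I z T = 0"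
      and p: "p \<in> {0..1}" for z p
  proof -
    have zm: "restrict z {0..T} \<in> mspace ?m"
      by (rule restrict_in_C_space[OF z])
    have z\<Omega>: "restrict z {0..T} \<in> \<Omega>" and bd: "\<And>t. t \<in> {0..T} \<Longrightarrow> norm (z t) \<le> R"
      using near[OF zm] nz by auto
    show ?thesis
    proof (cases "p \<le> 1/2")
      case True
      have const: "z t = z 0" if "t \<in> {0..T}" for t by (rule limit_constant(1)[OF z bd eq IT True that])
      have c: "restrict z {0..T} = const_fun T (z 0)"
        unfolding const_fun_def by (rule restrict_ext) (rule const)
      have "g_hat T n e g h (z 0) = 0" by (rule limit_constant(2)[OF z bd eq IT True])
      then have "z 0 \<in> V" using zeros z\<Omega> c by simp
      then have "const_fun T (z 0) \<in> K" using V closure_subset by blast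
      then show ?thesis using c True by auto
    next
      case False
      then have ps: "periodic_solution T n e g (\<lambda>t s. (2 * p - 1) *\<^sub>R h t s) (restrict z {0..T})"
        using p by (intro limit_periodic_solution[OF z bd eq IT]) auto
      moreover have "2 * p - 1 \<in> {0<..1}" using p False by auto
      ultimately have "restrict z {0..T} \<in> K" by (rule sol[rotated])
      moreover have "p \<noteq> 1"
      proof
        assume "p = 1"
        then have "periodic_solution T n e g h (restrict z {0..T})" using ps by simp
        then show False using no_sol[OF z\<Omega>] by blast
      qed
      ultimately show ?thesis by blast
    qed
  qed
  \<comment> \<open>Counterexamples for all \<open>k\<close> would have a subsequence whose paths
    converge to a path in \<open>K\<close> and whose parameters converge to a value other than 1;
    late members would then satisfy both claims.\<close>
  have "\<exists>k. \<forall>p\<in>{0..1}. \<forall>s. ?near (path_sol k p s) \<longrightarrow> shooting k p s = 0 \<longrightarrow> ?inside (path_sol k p s) \<and> p \<noteq> 1"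
  proof (rule ccontr)
    assume "\<not> ?thesis"
    then have "\<forall>k. \<exists>p s. p \<in> {0..1} \<and> ?near (path_sol k p s) \<and> shooting k p s = 0 \<and>
        \<not> (?inside (path_sol k p s) \<and> p \<noteq> 1)" by blast
    then obtain pk sk where pk: "\<And>k. pk k \<in> {0..1}" and nk: "\<And>k. ?near (path_sol k (pk k) (sk k))"
      and sk: "\<And>k. shooting k (pk k) (sk k) = 0"
      and bad: "\<And>k. \<not> (?inside (path_sol k (pk k) (sk k)) \<and> pk k \<noteq> 1)" by metis
    have bd: "norm (approx_sol k (pk k) (sk k) t) \<le> R" if t: "t \<in> {0..T}" for k t
      using near[OF path_sol_in_C_space] nk[of k] t by (force simp: path_sol_def)
    obtain \<rho> p z where \<rho>: "strict_mono (\<rho> :: nat \<Rightarrow> nat)" and p: "p \<in> {0..1}" "(pk \<circ> \<rho>) \<longlonglongrightarrow> p"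
      and z: "continuous_on {0..T} z"
      and lim: "uniform_limit {0..T} (\<lambda>k. approx_sol (\<rho> k) (pk (\<rho> k)) (sk (\<rho> k))) z sequentially"
      and eq: "\<And>t. t \<in> {0..T} \<Longrightarrow> z t = z 0 + scaling e n p (I z t)"
      by (rule approx_sol_compactness[OF bd pk]) (assumption, rule that, assumption+)
    let ?x = "restrict z {0..T}"
    have xm: "?x \<in> mspace ?m"
      by (rule restrict_in_C_space[OF z])
    have xlim: "(\<lambda>k. mdist ?m (path_sol (\<rho> k) (pk (\<rho> k)) (sk (\<rho> k))) ?x) \<longlonglongrightarrow> 0"
    proof (rule uniform_limit_imp_mdist[OF _ path_sol_in_C_space xm])
      show "uniform_limit {0..T} (\<lambda>k. path_sol (\<rho> k) (pk (\<rho> k)) (sk (\<rho> k))) ?x sequentially"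
        using lim by (rule uniform_limit_cong'[THEN iffD1, rotated 2]) (auto simp: path_sol_def)
    qed (use T in simp)
    have nx: "?near ?x"
      by (rule compact_neighbourhood_limit[OF K path_sol_in_C_space xm xlim nk])
    have "uniform_limit {0..T} (\<lambda>k. I (approx_sol (\<rho> k) (pk (\<rho> k)) (sk (\<rho> k)))) (I z) sequentially"
      by (rule superposition_limit[OF continuous_on_approx_sol lim])
    then have "(\<lambda>k. I (approx_sol (\<rho> k) (pk (\<rho> k)) (sk (\<rho> k))) T) \<longlonglongrightarrow> I z T"
      by (rule tendsto_uniform_limitI) (use T in simp)
    moreover have "I (approx_sol k (pk k) (sk k)) T = 0" for k
      using sk[of k] T by (simp add: shooting_def)
    ultimately have IT: "I z T = 0" by (simp add: LIMSEQ_const_iff)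
    have xK: "?x \<in> K" and p1: "p \<noteq> 1" using in_K[OF z nx eq IT p(1)] by auto
    have "\<forall>\<^sub>F k in sequentially. mdist ?m (path_sol (\<rho> k) (pk (\<rho> k)) (sk (\<rho> k))) ?x < r"
      using xlim r by (rule order_tendstoD)
    moreover have "\<forall>\<^sub>F k in sequentially. (pk \<circ> \<rho>) k \<noteq> 1"
      using p(2) p1 by (rule tendsto_imp_eventually_ne)
    ultimately have "\<forall>\<^sub>F k in sequentially. False"
      by eventually_elim (use bad xK in auto)
    then show False by simp
  qed
  then obtain k where k: "\<And>p s. p \<in> {0..1} \<Longrightarrow> ?near (path_sol k p s) \<Longrightarrow> shooting k p s = 0 \<Longrightarrow>
      ?inside (path_sol k p s) \<and> p \<noteq> 1" by blast
  have inside_near: "?near x" if "?inside x" for x using that less_imp_le by blast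
  define P where "P = {x. ?inside (path_sol k (fst x) (snd x))}"
  let ?H = "\<lambda>x. shooting k (fst x) (snd x)"
  have contH: "continuous_on A ?H" for A
  proof (rule continuous_on_subset)
    show "continuous_on UNIV ?H"
      unfolding continuous_on_sequentially
    proof (intro ballI allI impI)
      fix \<xi> :: "nat \<Rightarrow> real \<times> (real ^ ('n \<times> 'm))" and x assume "(\<forall>i. \<xi> i \<in> UNIV) \<and> \<xi> \<longlonglongrightarrow> x"
      then have "(\<lambda>i. fst (\<xi> i)) \<longlonglongrightarrow> fst x" "(\<lambda>i. snd (\<xi> i)) \<longlonglongrightarrow> snd x" by (auto intro: tendsto_intros)
      then show "(?H \<circ> \<xi>) \<longlonglongrightarrow> ?H x" unfolding o_def by (rule shooting_tendsto)
    qed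
  qed simp
  have openP: "open P"
  proof -
    have "closed (- P)"
      unfolding closed_sequential_limits
    proof (intro allI impI)
      fix \<xi> :: "nat \<Rightarrow> real \<times> (real ^ ('n \<times> 'm))" and x assume \<xi>: "(\<forall>i. \<xi> i \<in> - P) \<and> \<xi> \<longlonglongrightarrow> x"
      then have "(\<lambda>i. fst (\<xi> i)) \<longlonglongrightarrow> fst x" "(\<lambda>i. snd (\<xi> i)) \<longlonglongrightarrow> snd x" by (auto intro: tendsto_intros)
      then have lim: "(\<lambda>i. mdist ?m (path_sol k (fst (\<xi> i)) (snd (\<xi> i))) (path_sol k (fst x) (snd x))) \<longlonglongrightarrow> 0"
        by (rule path_sol_tendsto)
      show "x \<in> - P"
      proof
        assume "x \<in> P"
        then obtain y where y: "y \<in> K" "mdist ?m (path_sol k (fst x) (snd x)) y < r" by (auto simp: P_def)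
        have "\<forall>\<^sub>F i in sequentially. mdist ?m (path_sol k (fst (\<xi> i)) (snd (\<xi> i))) (path_sol k (fst x) (snd x))
            < r - mdist ?m (path_sol k (fst x) (snd x)) y"
          using lim y(2) by (intro order_tendstoD) auto
        then obtain i where i: "mdist ?m (path_sol k (fst (\<xi> i)) (snd (\<xi> i))) (path_sol k (fst x) (snd x))
            < r - mdist ?m (path_sol k (fst x) (snd x)) y"
          using eventually_happens'[OF sequentially_bot] by blast
        have "mdist ?m (path_sol k (fst (\<xi> i)) (snd (\<xi> i))) y
            \<le> mdist ?m (path_sol k (fst (\<xi> i)) (snd (\<xi> i))) (path_sol k (fst x) (snd x))
              + mdist ?m (path_sol k (fst x) (snd x)) y"
          using y(1) Ksub by (intro mdist_triangle path_sol_in_C_space) auto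
        also have "\<dots> < r" using i by simp
        finally have "\<xi> i \<in> P" using y(1) by (auto simp: P_def)
        then show False using \<xi> by blast
      qed
    qed
    then show ?thesis by (simp add: closed_open)
  qed
  \<comment> \<open>The strict inequality makes \<open>P\<close> open, the non-strict one survives
    limits; on zeros the two agree by the choice of \<open>k\<close>.\<close>
  have zero_set: "{x \<in> P \<inter> {0..1} \<times> UNIV. ?H x = 0}
      = {x \<in> {0..1} \<times> UNIV. ?near (path_sol k (fst x) (snd x)) \<and> ?H x = 0}" (is "?L = ?Z")
  proof (intro equalityI subsetI)
    fix x assume x: "x \<in> ?L"
    then have "?inside (path_sol k (fst x) (snd x))" by (simp add: P_def)
    from inside_near[OF this] x show "x \<in> ?Z" by simp
  next
    fix x assume x: "x \<in> ?Z"
    then have "?inside (path_sol k (fst x) (snd x)) \<and> fst x \<noteq> 1" by (intro k) (auto simp: mem_Times_iff)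
    with x show "x \<in> ?L" by (simp add: P_def)
  qed
  have "closed ?Z"
    unfolding closed_sequential_limits
  proof (intro allI impI)
    fix \<xi> :: "nat \<Rightarrow> real \<times> (real ^ ('n \<times> 'm))" and x assume \<xi>: "(\<forall>i. \<xi> i \<in> ?Z) \<and> \<xi> \<longlonglongrightarrow> x"
    then have lims: "(\<lambda>i. fst (\<xi> i)) \<longlonglongrightarrow> fst x" "(\<lambda>i. snd (\<xi> i)) \<longlonglongrightarrow> snd x" by (auto intro: tendsto_intros)
    have "?near (path_sol k (fst x) (snd x))"
      by (rule compact_neighbourhood_limit[OF K path_sol_in_C_space path_sol_in_C_space path_sol_tendsto[OF lims]])
         (use \<xi> in blast)
    moreover have "?H x = 0"
    proof -
      have "(\<lambda>i. ?H (\<xi> i)) \<longlonglongrightarrow> ?H x" by (rule shooting_tendsto[OF lims])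
      moreover have "?H (\<xi> i) = 0" for i using \<xi> by blast
      ultimately show ?thesis by (simp add: LIMSEQ_const_iff)
    qed
    moreover have "fst x \<in> {0..1}"
    proof -
      have "\<forall>i. fst (\<xi> i) \<in> {0..1}" using \<xi> by (auto simp: mem_Times_iff)
      then show ?thesis using closed_sequentially[OF closed_atLeastAtMost _ lims(1)] by blast
    qed
    ultimately show "x \<in> ?Z" by (simp add: mem_Times_iff)
  qed
  moreover have "bounded ?Z"
  proof (rule bounded_subset[OF bounded_Times[OF bounded_closed_interval bounded_cball]])
    show "?Z \<subseteq> {0..1} \<times> cball 0 R"
    proof
      fix x assume x: "x \<in> ?Z"
      \<comment> \<open>The starting point is the value of the path at time 0, so it inherits the
        bound \<open>R\<close>.\<close>
      have "path_sol k (fst x) (snd x) 0 = snd x"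
        using T0 approx_sol_eq[OF T0, of k "fst x" "snd x"] T by (simp add: path_sol_def I_0 D_0)
      moreover have "norm (path_sol k (fst x) (snd x) 0) \<le> R"
        using near[OF path_sol_in_C_space] x T0 by blast
      ultimately show "x \<in> {0..1} \<times> cball 0 R" using x by (auto simp: mem_Times_iff)
    qed
  qed
  ultimately have "compact ?Z" by (simp add: compact_eq_bounded_closed)
  then have "compact {x \<in> P \<inter> {0..1} \<times> UNIV. ?H x = 0}" unfolding zero_set .
  moreover have "shooting k 1 s \<noteq> 0" if "(1, s) \<in> P" for s
    using k[of 1 s] that inside_near by (auto simp: P_def)
  moreover have "(0, s) \<in> P \<and> shooting k 0 s = g_hat T n e g h s" if s: "s \<in> closure V" for s
  proof
    have c: "const_fun T s \<in> K" using V[OF s] .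
    have "mdist ?m (const_fun T s) (const_fun T s) = 0" using T by (simp add: mdist_const_fun)
    then show "(0, s) \<in> P" using c r by (force simp: P_def path_sol_0)
    have "norm (const_fun T s 0) \<le> R" using near[OF const_fun_in_C_space c, of s] T0 \<open>mdist ?m _ _ = 0\<close> r by simp
    then show "shooting k 0 s = g_hat T n e g h s" using T0 by (intro shooting_0) (simp add: const_fun_def)
  qed
  moreover have "s \<in> V" if s: "(0, s) \<in> P" "shooting k 0 s = 0" for s
  proof -
    have "?near (const_fun T s)" using s(1) inside_near by (auto simp: P_def path_sol_0)
    then have c: "const_fun T s \<in> \<Omega>" "norm (const_fun T s 0) \<le> R"
      using near[OF const_fun_in_C_space] T0 by auto
    then have "norm s \<le> R" using T0 by (simp add: const_fun_def)
    then show ?thesis using zeros[OF c(1)] shooting_0 s(2) by simp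
  qed
  ultimately show ?thesis
    unfolding null_homotopy_def using openP contH by (intro exI[of _ "shooting k"] exI[of _ P]) blast
qed

end

theorem theorem3p1:
  fixes T :: real and n :: nat and e :: "nat \<Rightarrow> 'n::finite"
    and g :: "nat \<Rightarrow> real ^ 'm::finite \<Rightarrow> real ^ 'm"
    and h :: "real \<Rightarrow> real ^ ('n \<times> 'm) \<Rightarrow> real ^ 'm"
    and \<Omega> :: "(real \<Rightarrow> real ^ ('n \<times> 'm)) set"
  assumes T: "T > 0"
    and e: "bij_betw e {1..n} (UNIV :: 'n set)"
    and g: "\<And>i. i \<in> {1..<n} \<Longrightarrow> continuous_on UNIV (g i)"
    and h: "L1_Caratheodory T h"
    and \<Omega>: "openin (mtopology_of (C_space T)) \<Omega>"
    and c1: "\<exists>K. compactin (mtopology_of (C_space T)) K \<and> K \<subseteq> \<Omega> \<and>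
               (\<forall>\<theta>\<in>{0<..1}. \<forall>x. periodic_solution T n e g (\<lambda>t s. \<theta> *\<^sub>R h t s) x \<longrightarrow> x \<in> K)"
    and c2: "compact (g_hat T n e g h -` {0} \<inter> const_part T \<Omega>)"
    and deg: "brouwer_degree_ext (g_hat T n e g h) (const_part T \<Omega>) 0 \<noteq> 0"
  shows "\<exists>x\<in>\<Omega>. periodic_solution T n e g h x"
proof (rule ccontr)
  assume no_sol: "\<not> ?thesis"
  have T0: "T \<ge> 0" using T by simp
  obtain K where K: "compactin (mtopology_of (C_space T)) K" "K \<subseteq> \<Omega>"
    "\<And>\<theta> x. \<theta> \<in> {0<..1} \<Longrightarrow> periodic_solution T n e g (\<lambda>t s. \<theta> *\<^sub>R h t s) x \<Longrightarrow> x \<in> K"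
    using c1 by blast
  have "brouwer_degree_ext (g_hat T n e g h) (const_part T \<Omega>) 0 = 0"
  proof (rule brouwer_degree_ext_eq_0[OF open_const_part[OF T0 \<Omega>] c2])
    fix V assume V: "open V" "bounded V" "g_hat T n e g h -` {0} \<inter> const_part T \<Omega> \<subseteq> V"
      "closure V \<subseteq> const_part T \<Omega>"
    \<comment> \<open>The constants from \<open>closure V\<close> are added because the hypothesis
      on \<open>K\<close> says nothing about \<open>\<theta> = 0\<close>, and because the homotopy
      has to start on all of \<open>closure V\<close>.\<close>
    define K' where "K' = K \<union> const_fun T ` closure V"
    have K': "compactin (mtopology_of (C_space T)) K'"
      unfolding K'_def using V(2)
      by (intro compactin_Un K(1) compactin_const_fun[OF T0]) (simp add: compact_closure)
    have K'sub: "K' \<subseteq> \<Omega>" using K(2) V(4) by (auto simp: K'_def const_part_def)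
    have K'm: "K' \<subseteq> mspace (C_space T)" using compactin_subset_topspace[OF K'] by simp
    obtain r where r: "r > 0"
      "\<And>x y. x \<in> mspace (C_space T) \<Longrightarrow> y \<in> K' \<Longrightarrow> mdist (C_space T) x y \<le> r \<Longrightarrow> x \<in> \<Omega>"
      using compact_uniform_neighbourhood[OF K' \<Omega> K'sub] by blast
    obtain R0 where R0: "R0 > 0" "\<And>x t. x \<in> K' \<Longrightarrow> t \<in> {0..T} \<Longrightarrow> norm (x t) \<le> R0"
      using compactin_C_space_bounded[OF T0 K'] by blast
    \<comment> \<open>Every path within \<open>r\<close> of \<open>K'\<close> is bounded by
      \<open>R\<close>, so truncation does not alter the field along it.\<close>
    define R where "R = R0 + r"
    have "R > 0" using r(1) R0(1) by (simp add: R_def)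
    obtain N \<beta> S where sys: "truncated_system T N \<beta> e n g h R S"
      by (rule truncated_system_exists[where g = g, OF T e g h \<open>R > 0\<close>]) (assumption, rule that)
    interpret truncated_system T N \<beta> e n g h R S by (rule sys)
    show "\<exists>H P. null_homotopy H P V \<and> (\<forall>s\<in>closure V. H 0 s = g_hat T n e g h s)"
    proof (rule shooting_homotopy[OF K' r(1)])
      fix x y assume x: "x \<in> mspace (C_space T)" and y: "y \<in> K'" and xy: "mdist (C_space T) x y \<le> r"
      have "norm (x t) \<le> R" if t: "t \<in> {0..T}" for t
      proof -
        have "dist (x t) (y t) \<le> r"
          using mdist_C_space_le_iff[OF T0 x, of y r] y K'm xy t by blast
        then show ?thesis
          using R0(2)[OF y t] norm_triangle_sub[of "x t" "y t"] by (simp add: R_def dist_norm)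
      qed
      then show "x \<in> \<Omega> \<and> (\<forall>t\<in>{0..T}. norm (x t) \<le> R)" using r(2)[OF x y xy] by blast
    next
      show "x \<in> K'" if "\<theta> \<in> {0<..1}" "periodic_solution T n e g (\<lambda>t s. \<theta> *\<^sub>R h t s) x" for \<theta> x
        using K(3)[OF that] by (simp add: K'_def)
      show "\<not> periodic_solution T n e g h x" if "x \<in> \<Omega>" for x using no_sol that by blast
      show "const_fun T s \<in> K'" if "s \<in> closure V" for s using that by (simp add: K'_def)
      show "s \<in> V" if "const_fun T s \<in> \<Omega>" "g_hat T n e g h s = 0" for s
        using V(3) that by (auto simp: const_part_def)
    qed
  qed
  with deg show False by simp
qed

end
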